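(* Let $n\ge1$ be an integer and let $k$ be a positive integer. Then the vertex operator superalgebra $L_{osp(2|2n)}(k,0)$ is not $C_2$-cofinite.
   Context: All spaces are over $\mathbb{C}$. $\mathfrak{g}=osp(2|2n)$ consists of the $(2+2n)\times(2+2n)$ block matrices $$\begin{pmatrix} a & 0 & y & y_1 \\ 0 & -a & z & z_1 \\ -z_1^t & -y_1^t & d & e \\ z^t & y^t & f & -d^t \end{pmatrix}$$ with $a\in\mathbb{C}$, $y,y_1,z,z_1$ of size $1\times n$, $d,e,f$ of size $n\times n$, and $e,f$ symmetric (the first two indices are even, the last $2n$ odd), equipped with the nondegenerate even supersymmetric invariant form $(X|Y)=-\mathrm{Str}(XY)$. Put $\hat{\mathfrak{g}}=\mathfrak{g}\otimes\mathbb{C}[t,t^{-1}]\oplus\mathbb{C}K$, $x(m)=x\otimes t^m$, $[x(m),y(l)]=[x,y](m+l)+(x|y)m\delta_{m+l,0}K$, $K$ central. $V^k(\mathfrak{g})=\mathrm{Ind}_{\mathfrak{g}\otimes\mathbb{C}[t]\oplus\mathbb{C}K}^{\hat{\mathfrak{g}}}\mathbb{C}\mathbf{1}$, where $\mathfrak{g}\otimes\mathbb{C}[t]$ acts on $\mathbf{1}$ by $0$ and $K$ by $k$; $L_{\mathfrak{g}}(k,0)$ is its unique irreducible quotient. It is a vertex operator superalgebra with vacuum $\mathbf{1}$, $Y(x(-1)\mathbf{1},z)=\sum_{m\in\mathbb{Z}}x(m)z^{-m-1}$ for $x\in\mathfrak{g}$, and conformal vector $\omega=\frac{1}{2(k+h^\vee)}\sum_ia^i(-1)b^i(-1)\mathbf{1}$,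 where $\{a^i\},\{b^i\}$ are dual bases of $\mathfrak{g}$ and $h^\vee$ is the dual Coxeter number of $(\mathfrak{g},(\cdot|\cdot))$. A vertex operator superalgebra $V$, with $Y(v,z)=\sum_{m\in\mathbb{Z}}v_mz^{-m-1}$, is $C_2$-cofinite if $\dim V/C_2(V)<\infty$, where $C_2(V)$ is the linear span of $\{u_{-2}v\mid u,v\in V\}$. *)

theory Defs
  imports "HOL-Analysis.Analysis" "HOL-Library.Poly_Mapping"
begin

section \<open>The Lie superalgebra osp(2|2n)\<close>

text \<open>
  The integer \<open>n \<ge> 1\<close> is the cardinality of the finite type \<open>'n\<close>.  Rows and columns are indexed by
  \<open>bool + ('n + 'n)\<close>: \<open>Inl False\<close>, \<open>Inl True\<close> are the two even indices, the \<open>2n\<close> indices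
  \<open>Inr _\<close> are odd.  Parities are booleans, \<open>True\<close> being odd, so they add up by \<open>\<noteq>\<close>.
\<close>

type_synonym 'n idx = "bool + ('n + 'n)"
type_synonym 'n smat = "complex ^ 'n idx ^ 'n idx"

definition smat_scale :: "complex \<Rightarrow> 'n::finite smat \<Rightarrow> 'n smat" where
  "smat_scale c X = (\<chi> i j. c * X $ i $ j)"

definition osp_matrix ::
  "complex \<Rightarrow> complex ^ 'n \<Rightarrow> complex ^ 'n \<Rightarrow> complex ^ 'n \<Rightarrow> complex ^ 'n \<Rightarrow>
   complex ^ 'n ^ 'n \<Rightarrow> complex ^ 'n ^ 'n \<Rightarrow> complex ^ 'n ^ 'n \<Rightarrow> 'n::finite smat" where
  "osp_matrix a y y1 z z1 d e f = (\<chi> i j.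
     case i of
       Inl False \<Rightarrow>
         (case j of Inl False \<Rightarrow> a | Inl True \<Rightarrow> 0 | Inr (Inl q) \<Rightarrow> y $ q | Inr (Inr q) \<Rightarrow> y1 $ q)
     | Inl True \<Rightarrow>
         (case j of Inl False \<Rightarrow> 0 | Inl True \<Rightarrow> - a | Inr (Inl q) \<Rightarrow> z $ q | Inr (Inr q) \<Rightarrow> z1 $ q)
     | Inr (Inl p) \<Rightarrow>
         (case j of Inl False \<Rightarrow> - (z1 $ p) | Inl True \<Rightarrow> - (y1 $ p)
            | Inr (Inl q) \<Rightarrow> d $ p $ q | Inr (Inr q) \<Rightarrow> e $ p $ q)
     | Inr (Inr p) \<Rightarrow>
         (case j of Inl False \<Rightarrow> z $ p | Inl True \<Rightarrow> y $ p
            | Inr (Inl q) \<Rightarrow> f $ p $ q | Inr (Inr q) \<Rightarrow> - (transpose d $ p $ q)))"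

definition osp :: "'n::finite smat set" where
  "osp = {osp_matrix a y y1 z z1 d e f | a y y1 z z1 d e f. transpose e = e \<and> transpose f = f}"

definition smat_part :: "bool \<Rightarrow> 'n::finite smat \<Rightarrow> 'n smat" where
  "smat_part p X = (\<chi> i j. if (isl i \<noteq> isl j) = p then X $ i $ j else 0)"

text \<open>The bilinear extension of \<open>[X, Y] = X Y - (-1)\<^sup>p\<^sup>q Y X\<close> from homogeneous \<open>X\<close>, \<open>Y\<close> of parities
  \<open>p\<close>, \<open>q\<close>.\<close>

definition super_sign :: "bool \<Rightarrow> bool \<Rightarrow> complex" where
  "super_sign p q = (if p \<and> q then - 1 else 1)"

definition sbracket :: "'n::finite smat \<Rightarrow> 'n smat \<Rightarrow> 'n smat" where
  "sbracket X Y = (\<Sum>p\<in>UNIV. \<Sum>q\<in>UNIV.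
     smat_part p X ** smat_part q Y
     - smat_scale (super_sign p q) (smat_part q Y ** smat_part p X))"

definition supertrace :: "'n::finite smat \<Rightarrow> complex" where
  "supertrace X = (\<Sum>i\<in>UNIV. if isl i then X $ i $ i else - (X $ i $ i))"

definition osp_form :: "'n::finite smat \<Rightarrow> 'n smat \<Rightarrow> complex" where
  "osp_form X Y = - supertrace (X ** Y)"

text \<open>
  The order of the arguments of the form matters for odd elements: \<open>\<Sum>i. a\<^sub>i \<otimes> b\<^sub>i\<close> is the
  \<open>osp\<close>-invariant tensor when \<open>(b\<^sub>i | a\<^sub>j) = \<delta>\<^sub>i\<^sub>j\<close>, whereas \<open>(a\<^sub>i | b\<^sub>j) = \<delta>\<^sub>i\<^sub>j\<close> would change the sign
  of its odd part, and neither the Casimir operator nor the Sugawara vector would have the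
  properties they are named for.
\<close>

definition osp_dual_bases :: "nat \<Rightarrow> (nat \<Rightarrow> 'n::finite smat) \<Rightarrow> (nat \<Rightarrow> 'n smat) \<Rightarrow> bool" where
  "osp_dual_bases N a b \<longleftrightarrow>
     (\<forall>i<N. a i \<in> osp \<and> b i \<in> osp) \<and>
     module.span smat_scale (a ` {..<N}) = osp \<and>
     module.span smat_scale (b ` {..<N}) = osp \<and>
     (\<forall>i<N. \<forall>j<N. osp_form (b i) (a j) = (if i = j then 1 else 0))"

text \<open>\<open>2 h\<^sup>\<or>\<close> is the eigenvalue of the Casimir operator on the adjoint representation.\<close>

definition dual_coxeter_number :: "'n::finite itself \<Rightarrow> complex" where
  "dual_coxeter_number _ = (THE h. \<forall>N a b. osp_dual_bases N a b \<longrightarrow>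
     (\<forall>x\<in>(osp :: 'n smat set).
        (\<Sum>i<N. sbracket (a i) (sbracket (b i) x)) = smat_scale (2 * h) x))"


section \<open>The affine Lie superalgebra\<close>

text \<open>A pair \<open>(X, c)\<close> stands for \<open>\<Sum>m. X\<^sub>m \<otimes> t\<^sup>m + c K\<close>.\<close>

type_synonym 'n aff = "(int \<Rightarrow>\<^sub>0 'n smat) \<times> complex"

definition aff_osp :: "'n::finite aff set" where
  "aff_osp = {(X, c). \<forall>m. Poly_Mapping.lookup X m \<in> osp}"

definition aff_scale :: "complex \<Rightarrow> 'n::finite aff \<Rightarrow> 'n aff" where
  "aff_scale s = (\<lambda>(X, c). (Poly_Mapping.map (smat_scale s) X, s * c))"

definition aff_bracket :: "'n::finite aff \<Rightarrow> 'n aff \<Rightarrow> 'n aff" where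
  "aff_bracket = (\<lambda>(X, _) (Y, _).
     (\<Sum>m\<in>Poly_Mapping.keys X. \<Sum>l\<in>Poly_Mapping.keys Y. Poly_Mapping.single (m + l) (sbracket (Poly_Mapping.lookup X m) (Poly_Mapping.lookup Y l)),
      \<Sum>m\<in>Poly_Mapping.keys X. \<Sum>l\<in>Poly_Mapping.keys Y.
        if m + l = 0 then osp_form (Poly_Mapping.lookup X m) (Poly_Mapping.lookup Y l) * of_int m else 0))"

definition aff_homogeneous :: "bool \<Rightarrow> 'n::finite aff \<Rightarrow> bool" where
  "aff_homogeneous p = (\<lambda>(X, c). (\<forall>m. smat_part p (Poly_Mapping.lookup X m) = Poly_Mapping.lookup X m) \<and> (p \<longrightarrow> c = 0))"

definition aff_mode :: "'n::finite smat \<Rightarrow> int \<Rightarrow> 'n aff" where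
  "aff_mode x m = (Poly_Mapping.single m x, 0)"

definition aff_nonneg :: "'n::finite aff set" where
  "aff_nonneg = {(X, c) \<in> aff_osp. \<forall>m<0. Poly_Mapping.lookup X m = 0}"


section \<open>The universal vacuum module and its irreducible quotient\<close>

text \<open>
  \<open>tensor_alg\<close> is the tensor algebra of the vector space underlying the affine superalgebra,
  presented by noncommutative words; the multilinearity of words is imposed by the first family of
  relations below.  The first two families together present the universal enveloping
  superalgebra \<open>U\<close>, and the third one is the left ideal generated by the elements \<open>b - \<chi>(b)\<close>, where
  \<open>\<chi>\<close> is the character of \<open>g \<otimes> C[t] + C K\<close> that vanishes on \<open>g \<otimes> C[t]\<close> and sends \<open>K\<close> to \<open>k\<close>.  Thus
  \<open>V\<^sup>k = U \<otimes> C 1\<close> (tensor product over the enveloping algebra of \<open>g \<otimes> C[t] + C K\<close>) is the quotient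
  of \<open>tensor_alg\<close> by \<open>vacuum_relations k\<close>, and \<open>1\<close> is the class of the empty word.
\<close>

type_synonym 'n tensors = "'n aff list \<Rightarrow>\<^sub>0 complex"

definition word :: "'n::finite aff list \<Rightarrow> 'n tensors" where
  "word w = Poly_Mapping.single w 1"

definition tensor_scale :: "complex \<Rightarrow> 'n::finite tensors \<Rightarrow> 'n tensors" where
  "tensor_scale c = Poly_Mapping.map ((*) c)"

definition tensor_alg :: "'n::finite tensors set" where
  "tensor_alg = {f. Poly_Mapping.keys f \<subseteq> lists aff_osp}"

definition left_mult :: "'n::finite aff \<Rightarrow> 'n tensors \<Rightarrow> 'n tensors" where
  "left_mult x f = (\<Sum>w\<in>Poly_Mapping.keys f. Poly_Mapping.single (x # w) (Poly_Mapping.lookup f w))"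

definition vacuum_relations :: "complex \<Rightarrow> 'n::finite tensors set" where
  "vacuum_relations k = module.span tensor_scale
     ({word (u @ [aff_scale c x + aff_scale d y] @ w)
         - tensor_scale c (word (u @ [x] @ w)) - tensor_scale d (word (u @ [y] @ w)) |
         u w x y c d. u \<in> lists aff_osp \<and> w \<in> lists aff_osp \<and> x \<in> aff_osp \<and> y \<in> aff_osp}
    \<union> {word (u @ [x, y] @ w) - tensor_scale (super_sign p q) (word (u @ [y, x] @ w))
         - word (u @ [aff_bracket x y] @ w) |
         u w x y p q. u \<in> lists aff_osp \<and> w \<in> lists aff_osp \<and> x \<in> aff_osp \<and> y \<in> aff_osp \<and>
           aff_homogeneous p x \<and> aff_homogeneous q y}
    \<union> {word (u @ [x]) - tensor_scale (k * snd x) (word u) |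
         u x. u \<in> lists aff_osp \<and> x \<in> aff_nonneg})"

text \<open>
  \<open>irreducible_vacuum_quotient k smul act \<pi>\<close>: the complex vector space given by \<open>smul\<close>, on which
  the affine superalgebra acts by \<open>act\<close>, is an irreducible quotient of \<open>V\<^sup>k\<close>, the quotient map being
  induced by \<open>\<pi>\<close>.  So it is \<open>L(k, 0)\<close>, with \<open>\<pi> (word [])\<close> as vacuum vector.  The values of \<open>\<pi>\<close> outside
  \<open>tensor_alg\<close>, and of \<open>act x\<close> for \<open>x \<notin> aff_osp\<close>, are irrelevant.
\<close>

definition irreducible_vacuum_quotient ::
  "complex \<Rightarrow> (complex \<Rightarrow> 'v::ab_group_add \<Rightarrow> 'v) \<Rightarrow> ('n::finite aff \<Rightarrow> 'v \<Rightarrow> 'v) \<Rightarrow>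
   ('n tensors \<Rightarrow> 'v) \<Rightarrow> bool" where
  "irreducible_vacuum_quotient k smul act \<pi> \<longleftrightarrow>
     Vector_Spaces.linear tensor_scale smul \<pi> \<and>
     \<pi> ` tensor_alg = UNIV \<and>
     (\<forall>f\<in>vacuum_relations k. \<pi> f = 0) \<and>
     (\<forall>x\<in>aff_osp. \<forall>f\<in>tensor_alg. \<pi> (left_mult x f) = act x (\<pi> f)) \<and>
     (UNIV :: 'v set) \<noteq> {0} \<and>
     (\<forall>S. module.subspace smul S \<and> (\<forall>x\<in>aff_osp. \<forall>v\<in>S. act x v \<in> S) \<longrightarrow> S = {0} \<or> S = UNIV)"

definition parity_subspace ::
  "(complex \<Rightarrow> 'v::ab_group_add \<Rightarrow> 'v) \<Rightarrow> ('n::finite tensors \<Rightarrow> 'v) \<Rightarrow> bool \<Rightarrow> 'v set" where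
  "parity_subspace smul \<pi> p = module.span smul
     {\<pi> (word w) | w ps. w \<in> lists aff_osp \<and> list_all2 aff_homogeneous ps w \<and>
        odd (count_list ps True) = p}"

definition sugawara_vector ::
  "complex \<Rightarrow> (complex \<Rightarrow> 'v::ab_group_add \<Rightarrow> 'v) \<Rightarrow> ('n::finite aff \<Rightarrow> 'v \<Rightarrow> 'v) \<Rightarrow> 'v \<Rightarrow>
   nat \<Rightarrow> (nat \<Rightarrow> 'n smat) \<Rightarrow> (nat \<Rightarrow> 'n smat) \<Rightarrow> 'v" where
  "sugawara_vector k smul act vac N a b =
     smul (1 / (2 * (k + dual_coxeter_number TYPE('n))))
       (\<Sum>i<N. act (aff_mode (a i) (- 1)) (act (aff_mode (b i) (- 1)) vac))"


section \<open>Vertex operator superalgebras\<close>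

text \<open>
  \<open>Y u m v\<close> is \<open>u\<^sub>m v\<close>, and \<open>V p\<close> is the subspace of parity \<open>p\<close>.  The last axiom is the Jacobi identity
  in components (the Borcherds identity); its sums over \<open>i\<close> have only finitely many nonzero
  terms because of \<open>truncation\<close>.
\<close>

locale vertex_superalgebra = vector_space smul
  for smul :: "complex \<Rightarrow> 'v::ab_group_add \<Rightarrow> 'v" +
  fixes V :: "bool \<Rightarrow> 'v set"
    and Y :: "'v \<Rightarrow> int \<Rightarrow> 'v \<Rightarrow> 'v"
    and vac :: 'v
  assumes subspace_V: "subspace (V p)"
    and V_sum: "\<exists>v0\<in>V False. \<exists>v1\<in>V True. v = v0 + v1"
    and V_direct: "V False \<inter> V True = {0}"
    and Y_linear_left: "Vector_Spaces.linear smul smul (\<lambda>u. Y u m v)"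
    and Y_linear_right: "Vector_Spaces.linear smul smul (Y u m)"
    and Y_parity: "u \<in> V p \<Longrightarrow> v \<in> V q \<Longrightarrow> Y u m v \<in> V (p \<noteq> q)"
    and truncation: "\<exists>M. \<forall>m\<ge>M. Y u m v = 0"
    and vacuum_even: "vac \<in> V False"
    and vacuum: "Y vac m v = (if m = - 1 then v else 0)"
    and creation: "Y u (- 1) vac = u" "m \<ge> 0 \<Longrightarrow> Y u m vac = 0"
    and borcherds_identity: "u \<in> V p \<Longrightarrow> v \<in> V q \<Longrightarrow>
      Sum_any (\<lambda>i::nat. smul (of_int m gchoose i) (Y (Y u (l + int i) v) (m + r - int i) w)) =
      Sum_any (\<lambda>i::nat. smul ((- 1) ^ i * (of_int l gchoose i))
         (Y u (m + l - int i) (Y v (r + int i) w)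
          - smul ((- 1) powi l * super_sign p q) (Y v (r + l - int i) (Y u (m + int i) w))))"
begin

definition C2 :: "'v set" where
  "C2 = span {Y u (- 2) v | u v. True}"

text \<open>That the quotient by \<open>C2\<close> has finite dimension: it is spanned by the classes of finitely many
  vectors.\<close>

definition C2_cofinite :: bool where
  "C2_cofinite \<longleftrightarrow> (\<exists>B. finite B \<and> span (C2 \<union> B) = UNIV)"

end

text \<open>Conformal weights in \<open>\<half>\<int>\<close>, with no relation between weight and parity imposed: the odd
  elements \<open>x(-1)1\<close> of the affine examples have weight \<open>1\<close>.\<close>

locale vertex_operator_superalgebra = vertex_superalgebra +
  fixes \<omega> :: 'a
  assumes conformal_even: "\<omega> \<in> V False"
    and virasoro: "\<exists>c. \<forall>m r v.
      Y \<omega> (m + 1) (Y \<omega> (r + 1) v) - Y \<omega> (r + 1) (Y \<omega> (m + 1) v) =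
      smul (of_int (m - r)) (Y \<omega> (m + r + 1) v)
      + smul (if m + r = 0 then (of_int m ^ 3 - of_int m) / 12 * c else 0) v"
    and L_minus_1_derivative: "Y (Y \<omega> 0 u) m v = smul (- of_int m) (Y u (m - 1) v)"
    and weight_decomposition: "span (\<Union>j::int. {v. Y \<omega> 1 v = smul (of_int j / 2) v}) = UNIV"
    and weight_finite: "\<exists>B. finite B \<and> {v. Y \<omega> 1 v = smul (of_int j / 2) v} \<subseteq> span B"
    and weight_bounded_below: "\<exists>j0::int. \<forall>j<j0. \<forall>v. Y \<omega> 1 v = smul (of_int j / 2) v \<longrightarrow> v = 0"

text \<open>The vertex operator superalgebra structure of \<open>L(k, 0)\<close>; it is unique, because the vectors
  \<open>x(-1)1\<close> generate.\<close>

definition affine_osp_VOSA ::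
  "complex \<Rightarrow> (complex \<Rightarrow> 'v::ab_group_add \<Rightarrow> 'v) \<Rightarrow> ('n::finite aff \<Rightarrow> 'v \<Rightarrow> 'v) \<Rightarrow>
   ('n tensors \<Rightarrow> 'v) \<Rightarrow> ('v \<Rightarrow> int \<Rightarrow> 'v \<Rightarrow> 'v) \<Rightarrow> bool" where
  "affine_osp_VOSA k smul act \<pi> Y \<longleftrightarrow>
     (\<forall>N a b. osp_dual_bases N a b \<longrightarrow>
        vertex_operator_superalgebra smul (parity_subspace smul \<pi>) Y (\<pi> (word []))
          (sugawara_vector k smul act (\<pi> (word [])) N a b)) \<and>
     (\<forall>x\<in>osp. \<forall>m v. Y (act (aff_mode x (- 1)) (\<pi> (word []))) m v = act (aff_mode x m) v)"

end

theory Submission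
  imports Defs "HOL-Computational_Algebra.Polynomial"
begin

text \<open>
  Let \<open>h = diag(1, -1, 0, \<dots>, 0)\<close>.  Its adjoint action splits \<open>g = osp(2|2n)\<close> into parts of charge
  \<open>-1\<close>, \<open>0\<close>, \<open>1\<close>, the charged parts being odd and the neutral part even, and \<open>(h|h) = -2\<close>.  The sign
  of \<open>(h|h)\<close> against \<open>k > 0\<close> is what excludes \<open>C\<^sub>2\<close>-cofiniteness.

  For an integer \<open>s\<close>, let \<open>x(m)\<close> act on \<open>V = L(k, 0)\<close> by \<open>x(m - s q)\<close> when \<open>x\<close> has charge \<open>q \<noteq> 0\<close>, and
  shift \<open>h(0)\<close> to \<open>h(0) + 2 k s\<close>.  This spectral flow is another \<open>V\<close>-module on the same space, and its
  energy is, up to a constant, weight minus \<open>s\<close> times charge.  For \<open>s \<ge> 0\<close> this energy is bounded below: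
  only the modes \<open>\<psi>(-j)\<close> with \<open>\<psi>\<close> of charge \<open>1\<close> and \<open>1 \<le> j < s\<close> lower it when applied to the vacuum;
  there are finitely many of them up to linear combination, and they anticommute
  (\<open>monomial_bound\<close>).  For \<open>s > 0\<close> a vector of least energy has charge \<open>q \<ge> 0\<close>, since its weight is nonnegative and its
  energy is at most that of the vacuum.  So \<open>h\<close> has the eigenvalue \<open>q + 2 k s \<ge> 2 k s\<close> on
  the lowest energy space of the module, and these eigenvalues are unbounded as \<open>s\<close> grows.  If \<open>V\<close> were
  \<open>C\<^sub>2\<close>-cofinite, its Zhu algebra, which acts on all these lowest energy spaces, would have finite dimension,
  and \<open>h\<close> would satisfy one polynomial equation on all of them.

  In place of the modules and of Zhu's algebra the proof uses linear functionals on \<open>V\<close>.  The vectors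
  \<open>x(n)w + x(n + 1)w\<close> with \<open>n \<le> -2\<close> span a subspace \<open>O\<close> whose elements have zero modes that
  vanish on the lowest energy space of every module.  With a lowest energy vector \<open>v\<close> and a functional \<open>\<theta>\<close> concentrated on the bidegree of \<open>v\<close>, the matrix
  coefficient \<open>\<phi>(u) = \<theta>(Y(u, 1)v)\<close> belongs to the untwisted action of \<open>V\<close>; composing it
  with Li's operator \<open>\<Delta> = exp(-s \<Sum>\<^sub>i (-1)\<^sup>i\<^sup>+\<^sup>1 h(i)/i)\<close>, the sum over \<open>i \<ge> 1\<close>, gives a functional \<open>\<Phi>\<close> that vanishes on \<open>O\<close>
  (\<open>\<Phi>_vanishing\<close>) and sends \<open>h(-1)\<^sup>j1\<close> to \<open>(q + 2 k s)\<^sup>j\<close> (\<open>\<Phi>_heis_power\<close>).  On the other hand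
  \<open>C\<^sub>2\<close>-cofiniteness makes \<open>V/O\<close> finite-dimensional (\<open>C2_cofinite_imp_zhu_finite\<close>), so that some nonzero
  polynomial in \<open>h(-1)\<close> sends the vacuum into \<open>O\<close>, and it would have infinitely many roots.

  Passing from \<open>C\<^sub>2\<close> to \<open>O\<close>, and choosing \<open>\<theta>\<close>, needs a weight operator \<open>D\<close> with \<open>[D, x(m)] = -m x(m)\<close>
  and \<open>D1 = 0\<close>.  It is extracted from the first three modes of the conformal vector \<open>\<omega>\<close>
  (\<open>weight_operator_exists\<close>).
\<close>

section \<open>The matrices of osp(2|2n)\<close>

interpretation smat: vector_space "smat_scale :: complex \<Rightarrow> 'n::finite smat \<Rightarrow> _"
  by unfold_locales (simp_all add: smat_scale_def vec_eq_iff algebra_simps)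

text \<open>
  \<open>osp(2|2n)\<close> is the fixed point set of minus the supertranspose of its invariant form.  The form pairs
  the basis vector of index \<open>i\<close> with that of index \<open>swap_idx i\<close>, and \<open>idx_sign\<close> carries its signs.  In these
  terms membership is one linear equation per entry, which is easier to transport through products than
  the block shape.
\<close>

fun swap_idx :: "'n idx \<Rightarrow> 'n idx" where
  "swap_idx (Inl b) = Inl (\<not> b)"
| "swap_idx (Inr (Inl p)) = Inr (Inr p)"
| "swap_idx (Inr (Inr p)) = Inr (Inl p)"

fun idx_sign :: "'n idx \<Rightarrow> complex" where
  "idx_sign (Inl b) = 1"
| "idx_sign (Inr (Inl p)) = 1"
| "idx_sign (Inr (Inr p)) = - 1"

text \<open>The eigenvalue of \<open>h\<close> on the basis vector of index \<open>i\<close>.\<close>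

fun idx_charge :: "'n idx \<Rightarrow> int" where
  "idx_charge (Inl b) = (if b then - 1 else 1)"
| "idx_charge (Inr p) = 0"

definition osp_sign :: "'n idx \<Rightarrow> 'n idx \<Rightarrow> complex" where
  "osp_sign i j = (if isl i \<and> \<not> isl j then 1 else - 1) * idx_sign i * idx_sign j"

lemma idx_cases: obtains "i = Inl False" | "i = Inl True" | p where "i = Inr (Inl p)" | p where "i = Inr (Inr p)"
proof (cases i)
  case (Inl b)
  thus thesis using that(1,2) by (cases b) auto
next
  case (Inr r)
  thus thesis using that(3,4) by (cases r) auto
qed

lemma swap_swap [simp]: "swap_idx (swap_idx i) = i"
  by (cases i rule: swap_idx.cases) auto

lemma isl_swap [simp]: "isl (swap_idx i) = isl i"
  by (cases i rule: swap_idx.cases) auto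

lemma idx_charge_swap [simp]: "idx_charge (swap_idx i) = - idx_charge i"
  by (cases i rule: swap_idx.cases) auto

lemma idx_sign_sq [simp]: "idx_sign i * idx_sign i = 1"
  by (cases i rule: swap_idx.cases) auto

lemma osp_iff: "X \<in> osp \<longleftrightarrow> (\<forall>i j. X $ swap_idx j $ swap_idx i = osp_sign i j * X $ i $ j)"
  for X :: "'n::finite smat"
proof
  assume "X \<in> osp"
  then obtain a y y1 z z1 d e f where X: "X = osp_matrix a y y1 z z1 d e f"
    and e: "transpose e = e" and f: "transpose f = f"
    unfolding osp_def by blast
  have e': "e $ q $ p = e $ p $ q" for p q 
    using arg_cong[OF e, of "\<lambda>M. M $ p $ q"] by (simp add: transpose_def)
  have f': "f $ q $ p = f $ p $ q" for p q 
    using arg_cong[OF f, of "\<lambda>M. M $ p $ q"] by (simp add: transpose_def)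
  show "\<forall>i j. X $ swap_idx j $ swap_idx i = osp_sign i j * X $ i $ j"
  proof (intro allI)
    fix i j
    show "X $ swap_idx j $ swap_idx i = osp_sign i j * X $ i $ j"
      by (cases i rule: idx_cases; cases j rule: idx_cases;
          simp add: X osp_matrix_def osp_sign_def transpose_def; rule e' f')
  qed
next
  assume *: "\<forall>i j. X $ swap_idx j $ swap_idx i = osp_sign i j * X $ i $ j"
  let ?e = "(\<chi> p q. X $ Inr (Inl p) $ Inr (Inr q)) :: complex ^ 'n ^ 'n"
  let ?f = "(\<chi> p q. X $ Inr (Inr p) $ Inr (Inl q)) :: complex ^ 'n ^ 'n"
  have eq_e: "X $ Inr (Inl q) $ Inr (Inr p) = X $ Inr (Inl p) $ Inr (Inr q)" for p q
    using *[rule_format, of "Inr (Inr q)" "Inr (Inl p)"] by (simp add: osp_sign_def)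
  have eq_f: "X $ Inr (Inr q) $ Inr (Inl p) = X $ Inr (Inr p) $ Inr (Inl q)" for p q
    using *[rule_format, of "Inr (Inl q)" "Inr (Inr p)"] by (simp add: osp_sign_def)
  have e: "transpose ?e = ?e"
    unfolding transpose_def vec_eq_iff by (intro allI) (simp add: eq_e)
  have f: "transpose ?f = ?f"
    unfolding transpose_def vec_eq_iff by (intro allI) (simp add: eq_f)
  let ?M = "osp_matrix (X $ Inl False $ Inl False) (\<chi> q. X $ Inl False $ Inr (Inl q))
     (\<chi> q. X $ Inl False $ Inr (Inr q)) (\<chi> q. X $ Inl True $ Inr (Inl q))
     (\<chi> q. X $ Inl True $ Inr (Inr q)) (\<chi> p q. X $ Inr (Inl p) $ Inr (Inl q)) ?e ?f"
  have "X = ?M"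
  proof -
    have FT: "X $ Inl False $ Inl True = 0" "X $ Inl True $ Inl False = 0"
      using *[rule_format, of "Inl False" "Inl True"] *[rule_format, of "Inl True" "Inl False"]
      by (simp_all add: osp_sign_def)
    have TT: "X $ Inl True $ Inl True = - (X $ Inl False $ Inl False)"
      using *[rule_format, of "Inl False" "Inl False"] by (simp add: osp_sign_def)
    have odd_even: "X $ Inr (Inl p) $ Inl False = - (X $ Inl True $ Inr (Inr p))"
      "X $ Inr (Inl p) $ Inl True = - (X $ Inl False $ Inr (Inr p))"
      "X $ Inr (Inr p) $ Inl False = X $ Inl True $ Inr (Inl p)"
      "X $ Inr (Inr p) $ Inl True = X $ Inl False $ Inr (Inl p)" for p
      using *[rule_format, of "Inl True" "Inr (Inr p)"] *[rule_format, of "Inl False" "Inr (Inr p)"]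
        *[rule_format, of "Inl True" "Inr (Inl p)"] *[rule_format, of "Inl False" "Inr (Inl p)"]
      by (simp_all add: osp_sign_def)
    have odd_odd: "X $ Inr (Inr p) $ Inr (Inr q) = - (X $ Inr (Inl q) $ Inr (Inl p))" for p q
      using *[rule_format, of "Inr (Inl p)" "Inr (Inl q)"] by (simp add: osp_sign_def)
    have "X $ i $ j = ?M $ i $ j" for i j
      by (cases i rule: idx_cases; cases j rule: idx_cases;
          simp add: osp_matrix_def transpose_def FT TT odd_even odd_odd)
    thus ?thesis by (intro iffD2[OF vec_eq_iff] allI)
  qed
  thus "X \<in> osp"
    unfolding osp_def by (intro CollectI exI conjI) (assumption, rule e, rule f)
qed

text \<open>
  The parity of a homogeneous component can be read off the position of an entry, so the four terms of
  the superbracket combine into one sum with a sign that depends on the three indices.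
\<close>

lemma sbracket_entry:
  fixes X Y :: "'n::finite smat"
  shows "sbracket X Y $ i $ j = (\<Sum>l\<in>UNIV. X $ i $ l * Y $ l $ j
     - super_sign (isl l \<noteq> isl j) (isl i \<noteq> isl l) * (Y $ i $ l * X $ l $ j))"
proof -
  have "sbracket X Y $ i $ j = (\<Sum>p\<in>UNIV. \<Sum>q\<in>UNIV. \<Sum>l\<in>UNIV.
     smat_part p X $ i $ l * smat_part q Y $ l $ j
       - super_sign p q * (smat_part q Y $ i $ l * smat_part p X $ l $ j))"
    by (simp add: sbracket_def smat_scale_def matrix_matrix_mult_def sum_distrib_left sum_subtractf)
  also have "\<dots> = (\<Sum>p\<in>UNIV. \<Sum>l\<in>UNIV. \<Sum>q\<in>UNIV.
     smat_part p X $ i $ l * smat_part q Y $ l $ j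
       - super_sign p q * (smat_part q Y $ i $ l * smat_part p X $ l $ j))"
    by (rule sum.cong[OF refl], rule sum.swap)
  also have "\<dots> = (\<Sum>l\<in>UNIV. \<Sum>p\<in>UNIV. \<Sum>q\<in>UNIV.
     smat_part p X $ i $ l * smat_part q Y $ l $ j
       - super_sign p q * (smat_part q Y $ i $ l * smat_part p X $ l $ j))"
    by (rule sum.swap)
  also have "\<dots> = (\<Sum>l\<in>UNIV. X $ i $ l * Y $ l $ j
     - super_sign (isl l \<noteq> isl j) (isl i \<noteq> isl l) * (Y $ i $ l * X $ l $ j))"
    by (rule sum.cong[OF refl]) (auto simp: smat_part_def UNIV_bool)
  finally show ?thesis .
qed

lemma sbracket_osp: "X \<in> osp \<Longrightarrow> Y \<in> osp \<Longrightarrow> sbracket X Y \<in> osp"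
  for X Y :: "'n::finite smat"
proof -
  assume X: "X \<in> osp" and Y: "Y \<in> osp"
  have X': "X $ swap_idx j $ swap_idx i = osp_sign i j * X $ i $ j" for i j using X osp_iff by blast
  have Y': "Y $ swap_idx j $ swap_idx i = osp_sign i j * Y $ i $ j" for i j using Y osp_iff by blast
  have bij: "bij (swap_idx :: 'n idx \<Rightarrow> _)" by (rule bij_betw_byWitness[of _ swap_idx]) auto
  have "sbracket X Y $ swap_idx j $ swap_idx i = osp_sign i j * sbracket X Y $ i $ j" for i j
  proof -
    have "sbracket X Y $ swap_idx j $ swap_idx i = (\<Sum>l\<in>UNIV. X $ swap_idx j $ l * Y $ l $ swap_idx i
     - super_sign (isl l \<noteq> isl i) (isl j \<noteq> isl l) * (Y $ swap_idx j $ l * X $ l $ swap_idx i))"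
      by (simp add: sbracket_entry)
    also have "\<dots> = (\<Sum>l\<in>UNIV. X $ swap_idx j $ swap_idx l * Y $ swap_idx l $ swap_idx i
     - super_sign (isl l \<noteq> isl i) (isl j \<noteq> isl l) * (Y $ swap_idx j $ swap_idx l * X $ swap_idx l $ swap_idx i))"
      by (subst sum.reindex_bij_betw[OF bij, symmetric]) simp
    also have "\<dots> = (\<Sum>l\<in>UNIV. osp_sign i j * (X $ i $ l * Y $ l $ j
     - super_sign (isl l \<noteq> isl j) (isl i \<noteq> isl l) * (Y $ i $ l * X $ l $ j)))"
    proof (rule sum.cong[OF refl])
      fix l :: "'n idx"
      have g: "osp_sign l j * osp_sign i l = - super_sign (isl l \<noteq> isl j) (isl i \<noteq> isl l) * osp_sign i j"
        by (cases i rule: idx_cases; cases j rule: idx_cases; cases l rule: idx_cases;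
            simp add: osp_sign_def super_sign_def)
      have g2: "super_sign (isl l \<noteq> isl i) (isl j \<noteq> isl l) = super_sign (isl l \<noteq> isl j) (isl i \<noteq> isl l)"
        by (auto simp: super_sign_def)
      have g3: "super_sign a b * super_sign a b = 1" for a b by (simp add: super_sign_def)
      let ?S = "super_sign (isl l \<noteq> isl j) (isl i \<noteq> isl l)"
      have "X $ swap_idx j $ swap_idx l * Y $ swap_idx l $ swap_idx i
     - ?S * (Y $ swap_idx j $ swap_idx l * X $ swap_idx l $ swap_idx i)
       = (osp_sign l j * osp_sign i l) * (X $ l $ j * Y $ i $ l - ?S * (Y $ l $ j * X $ i $ l))"
        by (simp add: X' Y' algebra_simps)
      also have "\<dots> = osp_sign i j * ((?S * ?S) * (Y $ l $ j * X $ i $ l) - ?S * (X $ l $ j * Y $ i $ l))"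
        unfolding g by (simp add: algebra_simps)
      also have "\<dots> = osp_sign i j * (X $ i $ l * Y $ l $ j - ?S * (Y $ i $ l * X $ l $ j))"
        unfolding g3 by (simp add: algebra_simps)
      finally show "X $ swap_idx j $ swap_idx l * Y $ swap_idx l $ swap_idx i
     - super_sign (isl l \<noteq> isl i) (isl j \<noteq> isl l) * (Y $ swap_idx j $ swap_idx l * X $ swap_idx l $ swap_idx i)
       = osp_sign i j * (X $ i $ l * Y $ l $ j
     - super_sign (isl l \<noteq> isl j) (isl i \<noteq> isl l) * (Y $ i $ l * X $ l $ j))" unfolding g2 .
    qed
    also have "\<dots> = osp_sign i j * sbracket X Y $ i $ j"
      by (simp add: sbracket_entry sum_distrib_left)
    finally show ?thesis .
  qed
  thus ?thesis by (simp add: osp_iff)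
qed

lemma subspace_osp: "smat.subspace (osp :: 'n::finite smat set)"
  by (simp add: smat.subspace_def osp_iff smat_scale_def algebra_simps)

lemma sbracket_zero_right [simp]: "sbracket X 0 = 0"
  by (simp add: vec_eq_iff sbracket_entry)

lemma sbracket_zero_left [simp]: "sbracket 0 Y = 0"
  by (simp add: vec_eq_iff sbracket_entry)

definition charge_space :: "int \<Rightarrow> 'n::finite smat set" where
  "charge_space q = {X \<in> osp. \<forall>i j. X $ i $ j \<noteq> 0 \<longrightarrow> idx_charge i - idx_charge j = q}"

lemma charge_space_osp: "x \<in> charge_space q \<Longrightarrow> x \<in> osp"
  by (simp add: charge_space_def)

lemma charge_spaceD: "x \<in> charge_space q \<Longrightarrow> x $ i $ j \<noteq> 0 \<Longrightarrow> idx_charge i - idx_charge j = q"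
  by (simp add: charge_space_def)

text \<open>
  Charge \<open>\<plusminus>2\<close> would need an entry at the two even off-diagonal positions.  These are fixed by the
  symmetry of \<open>osp_iff\<close> with sign \<open>-1\<close>, hence zero.
\<close>

lemma osp_no_charge_two:
  assumes "x \<in> (osp :: 'n::finite smat set)" "x $ i $ j \<noteq> 0"
  shows "\<bar>idx_charge i - idx_charge j\<bar> \<le> 1"
proof -
  have *: "x $ swap_idx j $ swap_idx i = osp_sign i j * x $ i $ j" for i j using assms(1) osp_iff by blast
  show ?thesis
    using *[of "Inl False" "Inl True"] *[of "Inl True" "Inl False"] assms(2)
    by (cases i rule: idx_cases; cases j rule: idx_cases) (simp_all add: osp_sign_def)
qed

lemma charge_space_trivial: "x \<in> charge_space q \<Longrightarrow> \<bar>q\<bar> > 1 \<Longrightarrow> x = (0 :: 'n::finite smat)"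
proof -
  assume x: "x \<in> charge_space q" and q: "\<bar>q\<bar> > 1"
  have "x $ i $ j = 0" for i j
  proof (rule ccontr)
    assume "x $ i $ j \<noteq> 0"
    hence "idx_charge i - idx_charge j = q" "\<bar>idx_charge i - idx_charge j\<bar> \<le> 1"
      using osp_no_charge_two[OF charge_space_osp[OF x]] charge_spaceD[OF x] by auto
    with q show False by simp
  qed
  thus "x = 0" by (simp add: vec_eq_iff)
qed

definition charge_part :: "int \<Rightarrow> 'n::finite smat \<Rightarrow> 'n smat" where
  "charge_part q X = (\<chi> i j. if idx_charge i - idx_charge j = q then X $ i $ j else 0)"

lemma charge_part_in: "X \<in> osp \<Longrightarrow> charge_part q X \<in> charge_space q"
  by (auto simp: charge_space_def charge_part_def osp_iff)

lemma charge_decomposition: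
  assumes "X \<in> (osp :: 'n::finite smat set)"
  shows "X = charge_part (- 1) X + charge_part 0 X + charge_part 1 X"
proof -
  have "X $ i $ j = charge_part (- 1) X $ i $ j + charge_part 0 X $ i $ j + charge_part 1 X $ i $ j" for i j
    using osp_no_charge_two[OF assms, of i j] by (cases "X $ i $ j = 0") (auto simp: charge_part_def)
  thus ?thesis by (simp add: vec_eq_iff)
qed

lemma osp_charge_induct [consumes 1, case_names charge add]:
  assumes "X \<in> (osp :: 'n::finite smat set)"
    and "\<And>q x. x \<in> charge_space q \<Longrightarrow> P x"
    and "\<And>x y. x \<in> osp \<Longrightarrow> y \<in> osp \<Longrightarrow> P x \<Longrightarrow> P y \<Longrightarrow> P (x + y)"
  shows "P X"
proof -
  have o: "charge_part q X \<in> osp" for q using charge_part_in[OF assms(1)] charge_space_osp by blast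
  have "P (charge_part (- 1) X + charge_part 0 X + charge_part 1 X)"
    by (intro assms(3) assms(2)[OF charge_part_in[OF assms(1)]] o smat.subspace_add[OF subspace_osp])
  thus ?thesis using charge_decomposition[OF assms(1)] by simp
qed

text \<open>
  Charge determines parity: the odd entries are those between an index of charge \<open>\<plusminus>1\<close> and one of charge
  \<open>0\<close>.  This makes the bookkeeping of signs a matter of charges only.
\<close>

lemma charge_space_parity: "x \<in> charge_space q \<Longrightarrow> smat_part (odd q) x = (x :: 'n::finite smat)"
proof -
  assume x: "x \<in> charge_space q"
  have "smat_part (odd q) x $ i $ j = x $ i $ j" for i j
  proof (cases "x $ i $ j = 0")
    case False
    hence q: "idx_charge i - idx_charge j = q" and q1: "\<bar>idx_charge i - idx_charge j\<bar> \<le> 1"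
      using osp_no_charge_two[OF charge_space_osp[OF x] False] charge_spaceD[OF x False] by auto
    have "(isl i \<noteq> isl j) = odd (idx_charge i - idx_charge j)" using q1
      by (cases i rule: idx_cases; cases j rule: idx_cases) simp_all
    with q show ?thesis by (simp add: smat_part_def)
  qed (simp add: smat_part_def)
  thus ?thesis by (simp add: vec_eq_iff)
qed

lemma sbracket_charge:
  assumes "x \<in> charge_space p" "y \<in> charge_space q"
  shows "sbracket x y \<in> (charge_space (p + q) :: 'n::finite smat set)"
proof -
  have "idx_charge i - idx_charge j = p + q" if "sbracket x y $ i $ j \<noteq> 0" for i j
  proof -
    from that obtain l where "x $ i $ l * y $ l $ j
     - super_sign (isl l \<noteq> isl j) (isl i \<noteq> isl l) * (y $ i $ l * x $ l $ j) \<noteq> 0"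
      unfolding sbracket_entry by (meson sum.neutral)
    hence "(x $ i $ l \<noteq> 0 \<and> y $ l $ j \<noteq> 0) \<or> (y $ i $ l \<noteq> 0 \<and> x $ l $ j \<noteq> 0)" by auto
    thus ?thesis using assms unfolding charge_space_def by fastforce
  qed
  moreover have "sbracket x y \<in> osp" using assms sbracket_osp charge_space_osp by blast
  ultimately show ?thesis by (simp add: charge_space_def)
qed

definition heis :: "'n::finite smat" where
  "heis = (\<chi> i j. if i = j then of_int (idx_charge i) else 0)"

lemma osp_form_entry: "osp_form X Y = - (\<Sum>i\<in>UNIV. \<Sum>l\<in>UNIV. (if isl i then 1 else - 1) * X $ i $ l * Y $ l $ i)"
proof -
  have "supertrace (X ** Y) = (\<Sum>i\<in>UNIV. \<Sum>l\<in>UNIV. (if isl i then 1 else - 1) * X $ i $ l * Y $ l $ i)"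
    unfolding supertrace_def matrix_matrix_mult_def
    by (rule sum.cong[OF refl]) (simp add: sum_negf)
  thus ?thesis by (simp add: osp_form_def)
qed

lemma osp_form_add_left: "osp_form (X + X') Y = osp_form X Y + osp_form X' Y"
  by (simp add: osp_form_entry algebra_simps sum.distrib)

lemma osp_form_add_right: "osp_form X (Y + Y') = osp_form X Y + osp_form X Y'"
  by (simp add: osp_form_entry algebra_simps sum.distrib)

lemma osp_form_scale_left: "osp_form (smat_scale c X) Y = c * osp_form X Y"
  by (simp add: osp_form_entry smat_scale_def sum_distrib_left algebra_simps)

lemma osp_form_scale_right: "osp_form X (smat_scale c Y) = c * osp_form X Y"
  by (simp add: osp_form_entry smat_scale_def sum_distrib_left algebra_simps)

lemma osp_form_zero [simp]: "osp_form 0 Y = 0" "osp_form X 0 = 0"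
  by (simp_all add: osp_form_entry)

lemma osp_form_sum_left: "osp_form (\<Sum>i\<in>I. f i) Y = (\<Sum>i\<in>I. osp_form (f i) Y)"
  by (induction I rule: infinite_finite_induct) (simp_all add: osp_form_add_left)

lemma osp_form_diff_left: "osp_form (X - X') Y = osp_form X Y - osp_form X' Y"
  by (metis add_diff_cancel_right' diff_add_cancel osp_form_add_left)

lemma osp_form_charge:
  assumes "x \<in> charge_space p" "y \<in> charge_space q" "p + q \<noteq> 0"
  shows "osp_form x (y :: 'n::finite smat) = 0"
proof -
  have "x $ i $ l = 0 \<or> y $ l $ i = 0" for i l
  proof (rule ccontr)
    assume "\<not> ?thesis"
    hence "idx_charge i - idx_charge l = p" "idx_charge l - idx_charge i = q"
      using assms(1,2) by (auto simp: charge_space_def)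
    with assms(3) show False by simp
  qed
  hence *: "(if isl i then 1 else - 1) * x $ i $ l * y $ l $ i = 0" for i l
    by (metis mult_zero_right mult_zero_left)
  show ?thesis unfolding osp_form_entry * by simp
qed

lemma heis_charge: "heis \<in> (charge_space 0 :: 'n::finite smat set)"
proof -
  have "heis $ swap_idx j $ swap_idx i = osp_sign i j * (heis :: 'n smat) $ i $ j" for i j
  proof -
    have "swap_idx j = swap_idx i \<longleftrightarrow> i = j" by (metis swap_swap)
    thus ?thesis by (auto simp: heis_def osp_sign_def)
  qed
  thus ?thesis by (auto simp: charge_space_def osp_iff heis_def)
qed

lemma sbracket_heis:
  assumes "x \<in> charge_space q"
  shows "sbracket heis x = smat_scale (of_int q) (x :: 'n::finite smat)"
proof -
  have "sbracket heis x $ i $ j = of_int q * x $ i $ j" for i j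
  proof -
    have "sbracket heis x $ i $ j = (\<Sum>l\<in>UNIV. (if l = i then of_int (idx_charge i) * x $ i $ j else 0)
        - (if l = j then x $ i $ j * of_int (idx_charge j) else 0))"
      unfolding sbracket_entry
      by (rule sum.cong[OF refl]) (auto simp: heis_def super_sign_def)
    also have "\<dots> = (of_int (idx_charge i) - of_int (idx_charge j)) * x $ i $ j"
      by (simp add: sum_subtractf algebra_simps)
    also have "\<dots> = of_int q * x $ i $ j"
      using charge_spaceD[OF assms, of i j] by (cases "x $ i $ j = 0") (auto simp flip: of_int_diff)
    finally show ?thesis .
  qed
  thus ?thesis by (simp add: vec_eq_iff smat_scale_def)
qed

lemma sum_idx: "(\<Sum>i\<in>UNIV. f i) = f (Inl False) + f (Inl True) + (\<Sum>r\<in>UNIV. f (Inr r))"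
  for f :: "'n::finite idx \<Rightarrow> complex"
proof -
  have "(\<Sum>i\<in>UNIV. f i) = (\<Sum>i\<in>range Inl. f i) + (\<Sum>i\<in>range Inr. f i)"
    by (subst UNIV_sum, rule sum.union_disjoint) auto
  thus ?thesis by (simp add: sum.reindex UNIV_bool)
qed

lemma osp_form_heis: "osp_form heis (heis :: 'n::finite smat) = - 2"
proof -
  have "(\<Sum>l\<in>UNIV. (if isl i then 1 else - 1) * heis $ i $ l * (heis :: 'n smat) $ l $ i)
     = (\<Sum>l\<in>UNIV. if l = i then of_int ((idx_charge i)\<^sup>2) else 0)" for i
    by (rule sum.cong[OF refl]) (cases i rule: idx_cases; auto simp: heis_def)
  hence "osp_form heis (heis :: 'n smat) = - (\<Sum>i\<in>(UNIV :: 'n idx set). of_int ((idx_charge i)\<^sup>2))"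
    by (simp add: osp_form_entry)
  thus ?thesis by (simp add: sum_idx)
qed

text \<open>
  The projection to \<open>osp\<close> of the matrix unit at \<open>(a, b)\<close>, up to a factor \<open>2\<close>.
\<close>

definition osp_unit :: "'n idx \<Rightarrow> 'n idx \<Rightarrow> 'n::finite smat" where
  "osp_unit a b = (\<chi> i j. (if i = a \<and> j = b then 1 else 0)
     + osp_sign (swap_idx j) (swap_idx i) * (if i = swap_idx b \<and> j = swap_idx a then 1 else 0))"

lemma osp_sign_swap: "osp_sign i j * osp_sign (swap_idx j) (swap_idx i) = 1"
  by (cases i rule: idx_cases; cases j rule: idx_cases) (simp_all add: osp_sign_def)

lemma osp_sign_flip: "osp_sign i j * osp_sign j i = (if isl i = isl j then 1 else - 1)"
  by (cases i rule: idx_cases; cases j rule: idx_cases) (simp_all add: osp_sign_def)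

lemma swap_eq_iff: "i = swap_idx j \<longleftrightarrow> swap_idx i = j"
  by auto

lemma osp_unit_in: "osp_unit a b \<in> (osp :: 'n::finite smat set)"
proof -
  have "osp_unit a b $ swap_idx j $ swap_idx i = osp_sign i j * (osp_unit a b :: 'n smat) $ i $ j" for i j
    using osp_sign_swap[of i j] by (auto simp: osp_unit_def algebra_simps swap_eq_iff)
  thus ?thesis by (simp add: osp_iff)
qed

lemma osp_form_unit:
  assumes "X \<in> (osp :: 'n::finite smat set)"
  shows "osp_form X (osp_unit j i) = (if isl i then - 2 else 2) * X $ i $ j"
proof -
  have X: "X $ swap_idx j $ swap_idx i = osp_sign i j * X $ i $ j" using assms osp_iff by blast
  have "osp_form X (osp_unit j i) = - ((\<Sum>a\<in>UNIV. \<Sum>l\<in>UNIV.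
       (if l = j then if a = i then (if isl i then 1 else - 1) * X $ i $ j else 0 else 0))
     + (\<Sum>a\<in>UNIV. \<Sum>l\<in>UNIV. (if l = swap_idx i then if a = swap_idx j then
         (if isl j then 1 else - 1) * (osp_sign j i * X $ swap_idx j $ swap_idx i) else 0 else 0)))"
    unfolding osp_form_entry sum.distrib[symmetric]
    by (intro arg_cong[where f = uminus] sum.cong refl)
       (auto simp: osp_unit_def algebra_simps)
  also have "\<dots> = - ((if isl i then 1 else - 1) * X $ i $ j
      + (if isl j then 1 else - 1) * ((osp_sign i j * osp_sign j i) * X $ i $ j))"
    by (simp add: X algebra_simps)
  also have "\<dots> = (if isl i then - 2 else 2) * X $ i $ j"
    unfolding osp_sign_flip by simp
  finally show ?thesis .
qed

text \<open>Pairing with \<open>osp_unit j i\<close> reads off the entry at \<open>(i, j)\<close> up to a factor \<open>\<plusminus>2\<close>.\<close>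

lemma osp_form_nondegenerate:
  assumes "X \<in> (osp :: 'n::finite smat set)" "\<And>y. y \<in> osp \<Longrightarrow> osp_form X y = 0"
  shows "X = 0"
proof -
  have "X $ i $ j = 0" for i j
    using osp_form_unit[OF assms(1), of j i] assms(2)[OF osp_unit_in, of j i] by (simp split: if_splits)
  thus ?thesis by (simp add: vec_eq_iff)
qed

text \<open>
  Invariance is cyclicity of the supertrace.  For even \<open>a\<close> the sign of the bracket \<open>[x, y]\<close>
  cancels against the sign from moving an odd factor through the supertrace.
\<close>

lemma osp_form_invariant:
  assumes "smat_part False a = (a :: 'n::finite smat)"
  shows "osp_form (sbracket a x) y = osp_form a (sbracket x y)"
proof -
  let ?s = "\<lambda>i :: 'n idx. (if isl i then 1 else - 1) :: complex"
  have a: "a $ i $ j = 0" if "isl i \<noteq> isl j" for i j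
    using that arg_cong[OF assms, of "\<lambda>M. M $ i $ j"] by (simp add: smat_part_def)
  have "osp_form (sbracket a x) y = - (\<Sum>i\<in>UNIV. \<Sum>l\<in>UNIV. \<Sum>m\<in>UNIV.
      ?s i * a $ i $ m * x $ m $ l * y $ l $ i - ?s i * x $ i $ m * a $ m $ l * y $ l $ i)"
  proof -
    have "?s i * sbracket a x $ i $ l * y $ l $ i = (\<Sum>m\<in>UNIV.
      ?s i * a $ i $ m * x $ m $ l * y $ l $ i - ?s i * x $ i $ m * a $ m $ l * y $ l $ i)" for i l
      unfolding sbracket_entry sum_distrib_left sum_distrib_right
    proof (rule sum.cong[OF refl])
      fix m :: "'n idx"
      have "super_sign (isl m \<noteq> isl l) (isl i \<noteq> isl m) * (x $ i $ m * a $ m $ l) = x $ i $ m * a $ m $ l"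
        using a[of m l] by (cases "isl m = isl l") (auto simp: super_sign_def)
      thus "?s i * (a $ i $ m * x $ m $ l - super_sign (isl m \<noteq> isl l) (isl i \<noteq> isl m) * (x $ i $ m * a $ m $ l)) * y $ l $ i
        = ?s i * a $ i $ m * x $ m $ l * y $ l $ i - ?s i * x $ i $ m * a $ m $ l * y $ l $ i"
        by (simp only: algebra_simps)
    qed
    thus ?thesis by (simp add: osp_form_entry)
  qed
  also have "\<dots> = - ((\<Sum>i\<in>UNIV. \<Sum>l\<in>UNIV. \<Sum>m\<in>UNIV. ?s i * a $ i $ m * x $ m $ l * y $ l $ i)
      - (\<Sum>i\<in>UNIV. \<Sum>l\<in>UNIV. \<Sum>m\<in>UNIV. ?s i * x $ i $ m * a $ m $ l * y $ l $ i))"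
    by (simp only: sum_subtractf)
  also have "(\<Sum>i\<in>UNIV. \<Sum>l\<in>UNIV. \<Sum>m\<in>UNIV. ?s i * a $ i $ m * x $ m $ l * y $ l $ i)
     = (\<Sum>i\<in>UNIV. \<Sum>l\<in>UNIV. \<Sum>m\<in>UNIV. ?s i * a $ i $ l * x $ l $ m * y $ m $ i)"
    by (rule sum.cong[OF refl], rule sum.swap)
  also have "(\<Sum>i\<in>UNIV. \<Sum>l\<in>UNIV. \<Sum>m\<in>UNIV. ?s i * x $ i $ m * a $ m $ l * y $ l $ i)
     = (\<Sum>i\<in>UNIV. \<Sum>m\<in>UNIV. \<Sum>l\<in>UNIV. ?s i * x $ i $ m * a $ m $ l * y $ l $ i)"
    by (rule sum.cong[OF refl], rule sum.swap)
  also have "\<dots> = (\<Sum>i\<in>UNIV. \<Sum>m\<in>UNIV. \<Sum>l\<in>UNIV. ?s m * x $ m $ i * a $ i $ l * y $ l $ m)"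
    by (rule sum.swap)
  also have "\<dots> = (\<Sum>i\<in>UNIV. \<Sum>l\<in>UNIV. \<Sum>m\<in>UNIV. ?s m * x $ m $ i * a $ i $ l * y $ l $ m)"
    by (rule sum.cong[OF refl], rule sum.swap)
  also have "- ((\<Sum>i\<in>UNIV. \<Sum>l\<in>UNIV. \<Sum>m\<in>UNIV. ?s i * a $ i $ l * x $ l $ m * y $ m $ i) - \<dots>)
    = - (\<Sum>i\<in>UNIV. \<Sum>l\<in>UNIV. ?s i * a $ i $ l * sbracket x y $ l $ i)"
  proof -
    have "?s i * a $ i $ l * x $ l $ m * y $ m $ i - ?s m * x $ m $ i * a $ i $ l * y $ l $ m
      = ?s i * a $ i $ l * (x $ l $ m * y $ m $ i
     - super_sign (isl m \<noteq> isl i) (isl l \<noteq> isl m) * (y $ l $ m * x $ m $ i))" for i l m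
      using a[of i l] by (cases "isl i = isl l") (auto simp: super_sign_def algebra_simps)
    thus ?thesis by (simp add: sum_subtractf[symmetric] sbracket_entry sum_distrib_left)
  qed
  also have "\<dots> = osp_form a (sbracket x y)" by (simp add: osp_form_entry)
  finally show ?thesis .
qed

definition charge_one_basis :: "'n + 'n \<Rightarrow> 'n::finite smat" where
  "charge_one_basis r = osp_unit (Inl False) (Inr r)"

lemma charge_one_basis_in: "charge_one_basis r \<in> (charge_space 1 :: 'n::finite smat set)"
proof -
  have "idx_charge i - idx_charge j = 1" if "osp_unit (Inl False) (Inr r) $ i $ j \<noteq> 0" for i j :: "'n idx"
    using that by (cases r) (auto simp: osp_unit_def split: if_splits)
  thus ?thesis using osp_unit_in by (auto simp: charge_space_def charge_one_basis_def)
qed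

lemma charge_one_expansion:
  assumes "x \<in> (charge_space 1 :: 'n::finite smat set)"
  shows "x = (\<Sum>r\<in>UNIV. smat_scale (x $ Inl False $ Inr r) (charge_one_basis r))"
proof -
  have X: "x $ swap_idx j $ swap_idx i = osp_sign i j * x $ i $ j" for i j
    using assms osp_iff charge_space_osp by blast
  have z: "x $ i $ j = 0" if "idx_charge i - idx_charge j \<noteq> 1" for i j
    using assms that by (auto simp: charge_space_def)
  have e: "(\<Sum>r\<in>UNIV. smat_scale (x $ Inl False $ Inr r) (charge_one_basis r)) $ i $ j
     = (\<Sum>r\<in>UNIV. x $ Inl False $ Inr r * (charge_one_basis r $ i $ j))" for i j
    by (simp add: smat_scale_def)
  have "x $ i $ j = (\<Sum>r\<in>UNIV. x $ Inl False $ Inr r * (charge_one_basis r $ i $ j))" for i j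
  proof (cases "idx_charge i - idx_charge j = 1")
    case False
    have "(charge_one_basis r :: 'n smat) $ i $ j = 0" for r
      using charge_one_basis_in[of r] False by (auto simp: charge_space_def)
    thus ?thesis using z[OF False] by simp
  next
    case True
    then consider (a) r where "i = Inl False" "j = Inr r" | (b) r where "i = Inr r" "j = Inl True"
      by (cases i rule: idx_cases; cases j rule: idx_cases) auto
    thus ?thesis
    proof cases
      case a
      have "(charge_one_basis r' :: 'n smat) $ i $ j = (if r' = r then 1 else 0)" for r'
        by (cases r') (auto simp: charge_one_basis_def osp_unit_def a)
      hence "(\<Sum>r'\<in>UNIV. x $ Inl False $ Inr r' * ((charge_one_basis r' :: 'n smat) $ i $ j))
        = (\<Sum>r'\<in>UNIV. if r' = r then x $ Inl False $ Inr r else 0)"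
        by (intro sum.cong refl) auto
      thus ?thesis by (simp add: a)
    next
      case b
      obtain t where t: "swap_idx (Inr r) = (Inr t :: 'n idx)" by (cases r) auto
      hence t': "swap_idx (Inr t) = (Inr r :: 'n idx)" by (metis swap_swap)
      have "(charge_one_basis r' :: 'n smat) $ i $ j = (if r' = t then osp_sign (Inl False) (Inr t) else 0)" for r'
        using t t' by (auto simp: charge_one_basis_def osp_unit_def b swap_eq_iff)
      hence "(\<Sum>r'\<in>UNIV. x $ Inl False $ Inr r' * ((charge_one_basis r' :: 'n smat) $ i $ j))
        = (\<Sum>r'\<in>UNIV. if r' = t then x $ Inl False $ Inr t * osp_sign (Inl False) (Inr t) else 0)"
        by (intro sum.cong refl) auto
      thus ?thesis using X[of "Inr t" "Inl False"] t' by (simp add: b)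
    qed
  qed
  thus ?thesis unfolding vec_eq_iff e by blast
qed

text \<open>
  Indexing by numbers rather than by a set of vectors covers the case that \<open>g\<close> repeats a value, which is
  itself a relation.
\<close>

lemma (in vector_space) nontrivial_relation:
  fixes g :: "nat \<Rightarrow> 'b"
  assumes "finite B" "\<And>j. j \<le> card B \<Longrightarrow> g j \<in> span B"
  obtains c where "\<exists>j\<le>card B. c j \<noteq> 0" "(\<Sum>j\<le>card B. scale (c j) (g j)) = 0"
proof (cases "inj_on g {..card B}")
  case True
  have "dependent (g ` {..card B})"
  proof (rule ccontr)
    assume "independent (g ` {..card B})"
    hence "card (g ` {..card B}) \<le> card B"
      using independent_span_bound[OF assms(1)] assms(2) by blast
    thus False by (simp add: card_image[OF True])
  qed
  then obtain u v where u: "v \<in> g ` {..card B}" "u v \<noteq> 0" "(\<Sum>v\<in>g ` {..card B}. scale (u v) v) = 0"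
    by (subst (asm) dependent_finite) auto
  show thesis
    using u by (intro that[of "u \<circ> g"]) (auto simp: sum.reindex[OF True])
next
  case False
  then obtain i j where ij: "i \<le> card B" "j \<le> card B" "i \<noteq> j" "g i = g j"
    by (auto simp: inj_on_def)
  show thesis
  proof (rule that[of "\<lambda>l. if l = i then 1 else if l = j then - 1 else 0"])
    have "(\<Sum>l\<le>card B. scale (if l = i then 1 else if l = j then - 1 else 0) (g l))
      = (\<Sum>l\<le>card B. (if l = i then g i else 0) - (if l = j then g j else 0))"
      using ij by (intro sum.cong refl) auto
    also have "\<dots> = 0" using ij by (simp add: sum_subtractf)
    finally show "(\<Sum>l\<le>card B. scale (if l = i then 1 else if l = j then - 1 else 0) (g l)) = 0" .
  qed (use ij in auto)
qed

interpretation poly_vs: vector_space "smult :: complex \<Rightarrow> complex poly \<Rightarrow> _"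
  by unfold_locales (simp_all add: smult_add_right smult_add_left)

lemma osp_finite_basis:
  obtains a :: "nat \<Rightarrow> 'n::finite smat" and N where
    "inj_on a {..<N}" "smat.independent (a ` {..<N})" "smat.span (a ` {..<N}) = osp"
proof -
  obtain C :: "'n smat set" where C: "C \<subseteq> osp" "smat.independent C" "osp \<subseteq> smat.span C"
    using smat.maximal_independent_subset by blast
  let ?U = "range (\<lambda>(i, j). (\<chi> i' j'. if i' = i \<and> j' = j then 1 else 0)) :: 'n smat set"
  have "x \<in> smat.span ?U" for x :: "'n smat"
  proof -
    have "x = (\<Sum>i\<in>UNIV. \<Sum>j\<in>UNIV. smat_scale (x $ i $ j) (\<chi> i' j'. if i' = i \<and> j' = j then 1 else 0))"
    proof -
      have "x $ a $ b = (\<Sum>i\<in>UNIV. \<Sum>j\<in>UNIV. smat_scale (x $ i $ j) (\<chi> i' j'. if i' = i \<and> j' = j then 1 else 0)) $ a $ b" for a b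
      proof -
        have "(\<Sum>i\<in>UNIV. \<Sum>j\<in>UNIV. smat_scale (x $ i $ j) (\<chi> i' j'. if i' = i \<and> j' = j then 1 else 0)) $ a $ b
          = (\<Sum>i\<in>UNIV. \<Sum>j\<in>UNIV. if j = b then if i = a then x $ a $ b else 0 else 0)"
          unfolding sum_component smat_scale_def by (intro sum.cong refl) auto
        thus ?thesis by simp
      qed
      thus ?thesis unfolding vec_eq_iff by blast
    qed
    moreover have "\<dots> \<in> smat.span ?U"
      by (intro smat.span_sum smat.span_scale smat.span_base) auto
    ultimately show ?thesis by simp
  qed
  hence "finite C"
    using smat.independent_span_bound[of ?U C] C(2) by (auto simp: finite_imageI)
  then obtain a where a: "bij_betw a {..<card C} C"
    using ex_bij_betw_nat_finite[of C] by (auto simp: atLeast0LessThan)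
  have "smat.span C = osp"
    using C smat.span_minimal[OF C(1) subspace_osp] by blast
  with a C(2) show thesis
    by (intro that[of a "card C"]) (auto simp: bij_betw_def)
qed

text \<open>
  The vertex algebra structure is given for dual bases only, so a pair of them has to be
  found.  Start from any basis \<open>a\<close> of \<open>osp\<close>.  The \<open>N - 1\<close> equations \<open>(x|a\<^sub>j) = 0\<close> with \<open>j \<noteq> i\<close> have a nonzero
  solution in a space of dimension \<open>N\<close>, and \<open>(x|a\<^sub>i) \<noteq> 0\<close> by nondegeneracy; rescale \<open>x\<close> to get \<open>b\<^sub>i\<close>.
\<close>

lemma osp_dual_bases_exist:
  obtains N and a b :: "nat \<Rightarrow> 'n::finite smat" where "osp_dual_bases N a b"
proof -
  obtain a :: "nat \<Rightarrow> 'n smat" and N where a: "inj_on a {..<N}" "smat.independent (a ` {..<N})"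
    "smat.span (a ` {..<N}) = osp" by (rule osp_finite_basis)
  have ao: "a i \<in> osp" if "i < N" for i
    using smat.span_base[of "a i" "a ` {..<N}"] that unfolding a(3) by simp
  have nondeg: "x = 0" if "x \<in> osp" "\<And>j. j < N \<Longrightarrow> osp_form x (a j) = 0" for x
  proof (rule osp_form_nondegenerate[OF that(1)])
    fix y :: "'n smat" assume "y \<in> osp"
    hence "y \<in> smat.span (a ` {..<N})" using a(3) by simp
    thus "osp_form x y = 0"
      by (induction rule: smat.span_induct_alt)
         (use that(2) in \<open>auto simp: osp_form_add_right osp_form_scale_right\<close>)
  qed
  have "\<exists>b\<in>osp. \<forall>j<N. osp_form b (a j) = (if i = j then 1 else 0)" if i: "i < N" for i
  proof -
    \<comment> \<open>The vector of the \<open>N - 1\<close> values is encoded as a polynomial, so that linear dependence among \<open>N\<close> of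
      these vectors can be quoted.\<close>
    let ?B = "(\<lambda>j. monom 1 j :: complex poly) ` ({..<N} - {i})"
    let ?g = "\<lambda>l. \<Sum>j\<in>{..<N} - {i}. smult (osp_form (a l) (a j)) (monom 1 j)"
    have cB: "card ?B = N - 1"
      using i by (subst card_image) (auto simp: inj_on_def monom_eq_iff')
    have N: "{..N - 1} = {..<N}" using i by auto
    obtain c where c: "\<exists>j\<le>N - 1. c j \<noteq> 0" "(\<Sum>l\<le>N - 1. smult (c l) (?g l)) = 0"
    proof (rule poly_vs.nontrivial_relation[of ?B ?g])
      show "?g l \<in> poly_vs.span ?B" for l
        by (rule poly_vs.span_sum, rule poly_vs.span_scale, rule poly_vs.span_base) simp
    qed (auto simp: cB)
    define x where "x = (\<Sum>l<N. smat_scale (c l) (a l))"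
    have xo: "x \<in> osp" unfolding x_def
      using ao by (intro smat.subspace_sum[OF subspace_osp] smat.subspace_scale[OF subspace_osp]) auto
    have xz: "osp_form x (a j) = 0" if j: "j < N" "j \<noteq> i" for j
    proof -
      have "coeff (?g l) j = osp_form (a l) (a j)" for l
        using j by (simp add: coeff_sum if_distrib sum.delta cong: if_cong)
      hence "(\<Sum>l<N. c l * osp_form (a l) (a j)) = coeff (\<Sum>l\<le>N - 1. smult (c l) (?g l)) j"
        unfolding N by (simp add: coeff_sum)
      also have "\<dots> = 0" by (simp only: c(2) coeff_0)
      finally show ?thesis by (simp add: x_def osp_form_sum_left osp_form_scale_left)
    qed
    have "x \<noteq> 0"
    proof
      assume "x = 0"
      hence "(\<Sum>v\<in>a ` {..<N}. smat_scale (c (the_inv_into {..<N} a v)) v) = 0"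
        by (simp add: sum.reindex[OF a(1)] x_def the_inv_into_f_f[OF a(1)])
      hence "c (the_inv_into {..<N} a (a j)) = 0" if "j < N" for j
        using a(2) that smat.dependent_finite[of "a ` {..<N}"]
        by (meson finite_imageI finite_lessThan imageI lessThan_iff)
      hence "c j = 0" if "j < N" for j using that by (simp add: the_inv_into_f_f[OF a(1)])
      with c(1) i show False by (metis Suc_pred' less_Suc_eq_le gr_implies_not0 neq0_conv)
    qed
    hence ne: "osp_form x (a i) \<noteq> 0" using nondeg[OF xo] xz by metis
    show ?thesis
      using ne xz by (intro bexI[of _ "smat_scale (1 / osp_form x (a i)) x"])
        (auto simp: osp_form_scale_left smat.subspace_scale[OF subspace_osp xo])
  qed
  then obtain b where b: "\<And>i. i < N \<Longrightarrow> b i \<in> osp"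
      "\<And>i j. i < N \<Longrightarrow> j < N \<Longrightarrow> osp_form (b i) (a j) = (if i = j then 1 else 0)"
    by metis
  have "x \<in> smat.span (b ` {..<N})" if x: "x \<in> osp" for x
  proof -
    let ?y = "\<Sum>i<N. smat_scale (osp_form x (a i)) (b i)"
    have "?y \<in> osp" using b
      by (intro smat.subspace_sum[OF subspace_osp] smat.subspace_scale[OF subspace_osp]) auto
    moreover have "osp_form (x - ?y) (a j) = 0" if "j < N" for j
    proof -
      have "osp_form ?y (a j) = (\<Sum>i<N. if i = j then osp_form x (a i) else 0)"
        unfolding osp_form_sum_left osp_form_scale_left using b(2) that by (intro sum.cong) auto
      thus ?thesis using that by (simp add: osp_form_diff_left)
    qed
    ultimately have "x - ?y = 0"
      using x by (intro nondeg) (auto intro: smat.subspace_diff[OF subspace_osp])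
    hence "x = ?y" by simp
    moreover have "?y \<in> smat.span (b ` {..<N})"
      by (intro smat.span_sum smat.span_scale smat.span_base) auto
    ultimately show ?thesis by simp
  qed
  hence "smat.span (b ` {..<N}) = osp"
    using b(1) smat.span_minimal[of "b ` {..<N}", OF _ subspace_osp] by blast
  hence "osp_dual_bases N a b"
    using a(3) ao b by (simp add: osp_dual_bases_def)
  thus thesis by (rule that)
qed

section \<open>Vertex superalgebras generated by osp currents\<close>

text \<open>
  A product of factors \<open>A - \<mu>\<close> with \<open>\<mu> \<noteq> l\<close> annihilates a given combination of eigenvectors of other
  eigenvalues, but multiplies \<open>v\<close> by a nonzero number.
\<close>

lemma (in vector_space) eigenvector_not_in_other_eigenspaces:
  assumes A: "\<And>u v. A (u + v) = A u + A v" "\<And>c u. A (scale c u) = scale c (A u)"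
    and v: "A v = scale l v" "v \<in> span {w. \<exists>\<mu>. \<mu> \<noteq> l \<and> A w = scale \<mu> w}"
  shows "v = 0"
proof -
  define T where "T \<mu> u = A u - scale \<mu> u" for \<mu> u
  have T_add: "T \<mu> (u + u') = T \<mu> u + T \<mu> u'" for \<mu> u u'
    by (simp add: T_def A scale_right_distrib)
  have T_scale: "T \<mu> (scale c u) = scale c (T \<mu> u)" for \<mu> u c
    by (simp add: T_def A scale_right_diff_distrib mult.commute)
  have T_comm: "T \<mu> (T \<nu> u) = T \<nu> (T \<mu> u)" for \<mu> \<nu> u
  proof -
    have A_diff: "A (u - v) = A u - A v" for u v
      using A(1)[of "u - v" v] by (simp add: algebra_simps)
    show ?thesis by (simp add: T_def A_diff A scale_right_diff_distrib mult.commute algebra_simps)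
  qed
  have T_fold: "foldr T ms (T \<mu> u) = T \<mu> (foldr T ms u)" for ms \<mu> u
    by (induction ms) (simp_all add: T_comm)
  have T_zero: "T \<mu> 0 = 0" for \<mu> using T_scale[of \<mu> 0 0] by simp
  have fold_zero: "foldr T ms 0 = 0" for ms by (induction ms) (simp_all add: T_zero)
  have "\<exists>ms. l \<notin> set ms \<and> foldr T ms v = 0"
    using v(2)
  proof (induction rule: span_induct_alt)
    case base
    show ?case by (rule exI[of _ "[]"]) simp
  next
    case (step c x y)
    then obtain \<mu> ms where *: "\<mu> \<noteq> l" "A x = scale \<mu> x" "l \<notin> set ms" "foldr T ms y = 0" by auto
    have "T \<mu> (scale c x + y) = T \<mu> y"
      by (simp only: T_add T_scale) (simp add: T_def *)
    hence "foldr T (ms @ [\<mu>]) (scale c x + y) = 0" by (simp add: T_fold * T_zero)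
    thus ?case using * by (intro exI[of _ "ms @ [\<mu>]"]) auto
  qed
  then obtain ms where ms: "l \<notin> set ms" "foldr T ms v = 0" by blast
  have "\<exists>c. c \<noteq> 0 \<and> foldr T ms v = scale c v" using ms(1)
  proof (induction ms)
    case Nil
    show ?case by (rule exI[of _ 1]) simp
  next
    case (Cons \<mu> ms)
    then obtain c where c: "c \<noteq> 0" "foldr T ms v = scale c v" by auto
    have "T \<mu> (scale c v) = scale (c * (l - \<mu>)) v"
      by (simp only: T_scale) (simp add: T_def v(1) scale_left_diff_distrib[symmetric])
    thus ?case using c Cons.prems by (intro exI[of _ "c * (l - \<mu>)"]) auto
  qed
  with ms(2) show "v = 0" by auto
qed

context vertex_superalgebra
begin

lemma Y_add_right: "Y u m (v + w) = Y u m v + Y u m w"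
  and Y_scale_right: "Y u m (smul c v) = smul c (Y u m v)"
  using Y_linear_right[of u m] by (simp_all add: Vector_Spaces.linear_iff)

lemma Y_add_left: "Y (u + v) m w = Y u m w + Y v m w"
  and Y_scale_left: "Y (smul c u) m w = smul c (Y u m w)"
  using Y_linear_left[of m w] by (simp_all add: Vector_Spaces.linear_iff)

lemma Y_zero_right [simp]: "Y u m 0 = 0"
  using Y_scale_right[of u m 0 0] by simp

lemma Y_zero_left [simp]: "Y 0 m w = 0"
  using Y_scale_left[of 0 0 m w] by simp

lemma Y_sum_right: "Y u m (\<Sum>i\<in>I. f i) = (\<Sum>i\<in>I. Y u m (f i))"
  by (induction I rule: infinite_finite_induct) (simp_all add: Y_add_right)

lemma Sum_any_in_subspace: "subspace S \<Longrightarrow> (\<And>i. g i \<in> S) \<Longrightarrow> Sum_any g \<in> S"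
  unfolding Sum_any.expand_set by (rule subspace_sum) auto

end

text \<open>
  \<open>X x\<close> stands for \<open>x(-1)1\<close>.  The operator products of these vectors fix all commutators of their modes.
\<close>

locale osp_current_algebra = vertex_superalgebra smul V Y vac
  for smul :: "complex \<Rightarrow> 'v::ab_group_add \<Rightarrow> 'v" and V Y vac +
  fixes k :: complex and X :: "'n::finite smat \<Rightarrow> 'v"
  assumes X_add: "x \<in> osp \<Longrightarrow> y \<in> osp \<Longrightarrow> X (x + y) = X x + X y"
    and X_scale: "x \<in> osp \<Longrightarrow> X (smat_scale c x) = smul c (X x)"
    and X_parity: "x \<in> charge_space q \<Longrightarrow> X x \<in> V (odd q)"
    and ope_0: "x \<in> charge_space p \<Longrightarrow> y \<in> charge_space q \<Longrightarrow> Y (X x) 0 (X y) = X (sbracket x y)"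
    and ope_1: "x \<in> charge_space p \<Longrightarrow> y \<in> charge_space q \<Longrightarrow> Y (X x) 1 (X y) = smul (k * osp_form x y) vac"
    and ope_2: "x \<in> charge_space p \<Longrightarrow> y \<in> charge_space q \<Longrightarrow> n \<ge> 2 \<Longrightarrow> Y (X x) n (X y) = 0"
    and vac_nonzero: "vac \<noteq> 0"
begin

abbreviation mode :: "'n smat \<Rightarrow> int \<Rightarrow> 'v \<Rightarrow> 'v" where
  "mode x m \<equiv> Y (X x) m"

lemma X_zero [simp]: "X 0 = 0"
  using X_scale[OF smat.subspace_0[OF subspace_osp], of 0] by simp

text \<open>
  The Borcherds identity at \<open>l = 0\<close>.  Only \<open>i = 0, 1\<close> contribute on its left, by the operator products,
  and only \<open>i = 0\<close> on its right.
\<close>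

lemma mode_commutator:
  assumes x: "x \<in> charge_space p" and y: "y \<in> charge_space q"
  shows "mode x m (mode y r w) = smul (super_sign (odd p) (odd q)) (mode y r (mode x m w))
     + mode (sbracket x y) (m + r) w + smul (if m + r = 0 then of_int m * k * osp_form x y else 0) w"
proof -
  let ?L = "\<lambda>i::nat. smul (of_int m gchoose i) (Y (Y (X x) (0 + int i) (X y)) (m + r - int i) w)"
  let ?R = "\<lambda>i::nat. smul ((- 1) ^ i * (of_int 0 gchoose i))
         (mode x (m + 0 - int i) (mode y (r + int i) w)
          - smul ((- 1) powi 0 * super_sign (odd p) (odd q)) (mode y (r + 0 - int i) (mode x (m + int i) w)))"
  have "Sum_any ?L = Sum_any ?R"
    by (rule borcherds_identity[OF X_parity[OF x] X_parity[OF y]])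
  moreover have "Sum_any ?L = (\<Sum>i\<in>{0, 1}. ?L i)"
  proof (rule Sum_any.expand_superset)
    show "{i. ?L i \<noteq> 0} \<subseteq> {0, 1}"
    proof
      fix i assume i: "i \<in> {i. ?L i \<noteq> 0}"
      show "i \<in> {0, 1}"
      proof (rule ccontr)
        assume "i \<notin> {0, 1}"
        hence "Y (X x) (0 + int i) (X y) = 0" by (intro ope_2[OF x y]) auto
        thus False using i by simp
      qed
    qed
  qed simp
  moreover have "(\<Sum>i\<in>{0, 1}. ?L i) = mode (sbracket x y) (m + r) w
      + smul (if m + r = 0 then of_int m * k * osp_form x y else 0) w"
    by (simp add: ope_0[OF x y] ope_1[OF x y] Y_scale_left vacuum mult.assoc)
  moreover have "Sum_any ?R = (\<Sum>i\<in>{0}. ?R i)"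
  proof (rule Sum_any.expand_superset)
    show "{i. ?R i \<noteq> 0} \<subseteq> {0}"
    proof safe
      fix i assume i: "?R i \<noteq> 0"
      { assume "i \<noteq> 0"
        hence "(of_int 0 :: complex) gchoose i = 0" by (cases i) simp_all
        hence False using i by simp }
      thus "i = 0" by blast
    qed
  qed simp
  ultimately show ?thesis by (simp add: algebra_simps)
qed

text \<open>The Borcherds identity at \<open>m = 0\<close>, where only \<open>i = 0\<close> contributes on the left.\<close>

lemma iterate_formula:
  assumes x: "x \<in> charge_space p" and u: "u \<in> V q"
  shows "Y (mode x n u) r w = Sum_any (\<lambda>i::nat. smul ((- 1) ^ i * (of_int n gchoose i))
         (mode x (n - int i) (Y u (r + int i) w)
          - smul ((- 1) powi n * super_sign (odd p) q) (Y u (r + n - int i) (mode x (int i) w))))"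
proof -
  let ?L = "\<lambda>i::nat. smul (of_int 0 gchoose i) (Y (mode x (n + int i) u) (0 + r - int i) w)"
  have "Sum_any ?L = (\<Sum>i\<in>{0}. ?L i)"
  proof (rule Sum_any.expand_superset)
    show "{i. ?L i \<noteq> 0} \<subseteq> {0}"
    proof safe
      fix i assume i: "?L i \<noteq> 0"
      { assume "i \<noteq> 0"
        hence "(of_int 0 :: complex) gchoose i = 0" by (cases i) simp_all
        hence False using i by simp }
      thus "i = 0" by blast
    qed
  qed simp
  thus ?thesis using borcherds_identity[OF X_parity[OF x] u, of 0 n r w] by simp
qed

text \<open>
  The first two arguments are the weight and the charge that a word of modes is entitled to.  They are
  arguments, and not functions of the vector, because the zero vector is a monomial of many
  bidegrees.
\<close>

inductive monomial :: "int \<Rightarrow> int \<Rightarrow> 'v \<Rightarrow> bool" where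
  monomial_vac: "monomial 0 0 vac"
| monomial_mode: "monomial p q w \<Longrightarrow> x \<in> charge_space r \<Longrightarrow> monomial (p - m) (q + r) (mode x m w)"

lemma monomial_parity: "monomial p q w \<Longrightarrow> w \<in> V (odd q)"
proof (induction rule: monomial.induct)
  case monomial_vac
  show ?case using vacuum_even by simp
next
  case (monomial_mode p q w x r m)
  hence "mode x m w \<in> V (odd r \<noteq> odd q)" using Y_parity[OF X_parity] by blast
  moreover have "odd (q + r) = (odd r \<noteq> odd q)" by auto
  ultimately show ?case by simp
qed

lemma heis_zero_mode_monomial: "monomial p q w \<Longrightarrow> mode heis 0 w = smul (of_int q) w"
proof (induction rule: monomial.induct)
  case monomial_vac
  show ?case by (simp add: creation)
next
  case (monomial_mode p q w x r m)
  have "mode heis 0 (mode x m w) = mode x m (mode heis 0 w) + mode (sbracket heis x) m w"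
    using mode_commutator[OF heis_charge monomial_mode(2), of 0 m w] by (simp add: super_sign_def)
  also have "\<dots> = smul (of_int (q + r)) (mode x m w)"
    using charge_space_osp[OF monomial_mode(2)]
    by (simp add: monomial_mode.IH Y_scale_right sbracket_heis[OF monomial_mode(2)] X_scale Y_scale_left
        scale_left_distrib)
  finally show ?case .
qed

end

section \<open>A lower bound for weight minus a multiple of charge\<close>

lemma (in vertex_superalgebra) Y_span:
  assumes "\<And>w. w \<in> S \<Longrightarrow> Y u m w \<in> span T" "w \<in> span S"
  shows "Y u m w \<in> span T"
  using assms(2)
  by (induction rule: span_induct_alt)
     (auto simp: Y_add_right Y_scale_right intro: span_zero span_add span_scale assms(1))

context osp_current_algebra
begin

lemma mode_sum_left: "(\<And>i. i \<in> I \<Longrightarrow> f i \<in> osp) \<Longrightarrow> mode (\<Sum>i\<in>I. smat_scale (c i) (f i)) m w = (\<Sum>i\<in>I. smul (c i) (mode (f i) m w))"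
proof (induction I rule: infinite_finite_induct)
  case (insert i I)
  have "(\<Sum>i\<in>I. smat_scale (c i) (f i)) \<in> osp"
    using insert.prems by (intro smat.subspace_sum[OF subspace_osp] smat.subspace_scale[OF subspace_osp]) auto
  moreover have "smat_scale (c i) (f i) \<in> osp" using insert.prems by (intro smat.subspace_scale[OF subspace_osp]) auto
  ultimately show ?case using insert by (simp add: X_add X_scale Y_add_left Y_scale_left)
qed simp_all

text \<open>The bracket has charge \<open>2\<close>, hence is zero, and the form pairs charge \<open>1\<close> with charge \<open>-1\<close> only.\<close>

lemma charge_one_anticommute:
  assumes "x \<in> charge_space 1" "y \<in> charge_space 1"
  shows "mode x m (mode y l w) = - mode y l (mode x m w)"
proof -
  have "sbracket x y = 0"
    using charge_space_trivial[OF sbracket_charge[OF assms]] by simp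
  moreover have "osp_form x y = 0" using osp_form_charge[OF assms] by simp
  ultimately show ?thesis
    using mode_commutator[OF assms, of m l w] by (simp add: super_sign_def)
qed

lemma charge_one_square: "x \<in> charge_space 1 \<Longrightarrow> mode x m (mode x m w) = 0"
proof -
  assume x: "x \<in> charge_space 1"
  let ?v = "mode x m (mode x m w)"
  have "?v + ?v = 0" using charge_one_anticommute[OF x x, of m m w] by (simp add: eq_neg_iff_add_eq_0)
  hence "smul 2 ?v = 0" using scale_left_distrib[of 1 1 ?v] by simp
  thus ?thesis by simp
qed

text \<open>
  Words in the charge \<open>1\<close> modes \<open>\<psi>(-j)\<close>, with \<open>\<psi>\<close> from a fixed basis.  For \<open>j \<le> s\<close> these are the
  creation modes that do not raise the degree weight minus \<open>s\<close> times charge.  Being words in a finite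
  anticommuting alphabet, only finitely many of them are nonzero.
\<close>

definition fermion_word :: "(('n + 'n) \<times> int) list \<Rightarrow> 'v" where
  "fermion_word ps = foldr (\<lambda>(r, j). mode (charge_one_basis r) (- j)) ps vac"

lemma fermion_word_simps [simp]: "fermion_word [] = vac"
  "fermion_word ((r, j) # ps) = mode (charge_one_basis r) (- j) (fermion_word ps)"
  by (simp_all add: fermion_word_def)

text \<open>Anticommute the outer letter to its copy, where the square vanishes.\<close>

lemma fermion_word_repeat: "(r, j) \<in> set ps \<Longrightarrow> mode (charge_one_basis r) (- j) (fermion_word ps) = 0"
proof (induction ps)
  case (Cons a ps)
  obtain r' j' where a: "a = (r', j')" by (cases a)
  show ?case
  proof (cases "a = (r, j)")
    case True
    thus ?thesis by (simp add: charge_one_square[OF charge_one_basis_in])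
  next
    case False
    hence "mode (charge_one_basis r) (- j) (fermion_word ps) = 0" using Cons by simp
    thus ?thesis
      using charge_one_anticommute[OF charge_one_basis_in charge_one_basis_in, of r "- j" r' "- j'" "fermion_word ps"]
      by (simp add: a)
  qed
qed simp

lemma fermion_word_distinct: "fermion_word ps \<noteq> 0 \<Longrightarrow> distinct ps"
proof (induction ps)
  case (Cons a ps)
  obtain r j where a: "a = (r, j)" by (cases a)
  have "fermion_word ps \<noteq> 0" using Cons.prems by (auto simp: a)
  moreover have "a \<notin> set ps" using Cons.prems fermion_word_repeat[of r j ps] by (auto simp: a)
  ultimately show ?case using Cons.IH by simp
qed simp

definition fermion_letters :: "nat \<Rightarrow> (('n + 'n) \<times> int) set" where
  "fermion_letters s = UNIV \<times> {1..int s}"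

definition fermion_degree :: "nat \<Rightarrow> (('n + 'n) \<times> int) list \<Rightarrow> int" where
  "fermion_degree s ps = (\<Sum>(r, j)\<leftarrow>ps. j - int s)"

definition fermion_span :: "nat \<Rightarrow> int \<Rightarrow> 'v set" where
  "fermion_span s d = span {fermion_word ps | ps. set ps \<subseteq> fermion_letters s \<and> fermion_degree s ps = d}"

lemma fermion_span_step:
  assumes "1 \<le> j" "j \<le> int s" "w \<in> fermion_span s d" "d' = d + j - int s"
  shows "mode (charge_one_basis r) (- j) w \<in> fermion_span s d'"
  using assms(3) unfolding fermion_span_def
proof (rule Y_span[rotated])
  fix w assume "w \<in> {fermion_word ps | ps. set ps \<subseteq> fermion_letters s \<and> fermion_degree s ps = d}"
  then obtain ps where "w = fermion_word ps" "set ps \<subseteq> fermion_letters s" "fermion_degree s ps = d" by blast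
  hence "mode (charge_one_basis r) (- j) w = fermion_word ((r, j) # ps) \<and>
      set ((r, j) # ps) \<subseteq> fermion_letters s \<and> fermion_degree s ((r, j) # ps) = d'"
    using assms by (simp add: fermion_letters_def fermion_degree_def)
  thus "mode (charge_one_basis r) (- j) w \<in>
      span {fermion_word ps | ps. set ps \<subseteq> fermion_letters s \<and> fermion_degree s ps = d'}"
    by (intro span_base) blast
qed

text \<open>
  Together the modes of nonpositive degree form a subalgebra, and this lemma says that its module
  generated by the vacuum is spanned by the fermion words.  An annihilation mode is moved to
  the right until it meets the vacuum; the brackets on the way have
  nonpositive degree again.  The only creation modes of nonpositive degree are those of charge \<open>1\<close>.
\<close>

lemma fermion_span_stable:
  assumes "set ps \<subseteq> fermion_letters s" "x \<in> charge_space q" "m \<ge> - int s * q"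
  shows "mode x m (fermion_word ps) \<in> fermion_span s (fermion_degree s ps - m - int s * q)"
  using assms
proof (induction ps arbitrary: x q m)
  case Nil
  have base: "mode x m w \<in> fermion_span s (d - m - int s * q)"
    if m: "m < 0" and x: "x \<in> charge_space q" "m \<ge> - int s * q" and w: "w \<in> fermion_span s d" for x q m w d
  proof (cases "q = 1")
    case True
    have "mode x m w = (\<Sum>r\<in>UNIV. smul (x $ Inl False $ Inr r) (mode (charge_one_basis r) m w))"
      using x(1) charge_one_basis_in charge_space_osp unfolding True
      by (subst charge_one_expansion[of x], blast, subst mode_sum_left) blast+
    also have "\<dots> \<in> fermion_span s (d - m - int s * q)"
    proof -
      have "mode (charge_one_basis r) m w \<in> fermion_span s (d - m - int s * q)" for r
        using fermion_span_step[of "- m" s w d "d - m - int s * q" r] m x(2) w by (simp add: True)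
      thus ?thesis unfolding fermion_span_def by (intro span_sum span_scale)
    qed
    finally show ?thesis .
  next
    case False
    have "int s * q > 0" using m x(2) by linarith
    hence "q > 0" by (simp add: zero_less_mult_iff)
    with False have "x = 0" by (intro charge_space_trivial[OF x(1)]) simp
    thus ?thesis by (simp add: fermion_span_def span_zero)
  qed
  show ?case
  proof (cases "m < 0")
    case True
    have "vac \<in> fermion_span s 0" unfolding fermion_span_def
      by (intro span_base CollectI exI[of _ "[]"]) (simp add: fermion_degree_def)
    thus ?thesis using base[OF True Nil(2,3), of vac 0] by (simp add: fermion_degree_def)
  next
    case False
    thus ?thesis by (simp add: creation fermion_span_def span_zero)
  qed
next
  case (Cons a ps)
  obtain r j where a: "a = (r, j)" by (cases a)
  have ps: "set ps \<subseteq> fermion_letters s" and j: "1 \<le> j" "j \<le> int s"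
    using Cons.prems(1) by (auto simp: a fermion_letters_def)
  let ?e = "charge_one_basis r :: 'n smat" and ?w = "fermion_word ps" and ?d = "fermion_degree s ps"
  have D: "fermion_degree s (a # ps) = ?d + j - int s" by (simp add: fermion_degree_def a)
  have w: "?w \<in> fermion_span s ?d" unfolding fermion_span_def using ps by (intro span_base) blast
  have 1: "mode ?e (- j) (mode x m ?w) \<in> fermion_span s (?d + j - int s - m - int s * q)"
    by (rule fermion_span_step[OF j Cons.IH[OF ps Cons.prems(2,3)]]) simp
  have 2: "mode (sbracket x ?e) (m - j) ?w \<in> fermion_span s (?d + j - int s - m - int s * q)"
  proof -
    have "- int s * (q + 1) \<le> m - j" using Cons.prems(3) j by (simp add: algebra_simps)
    from Cons.IH[OF ps sbracket_charge[OF Cons.prems(2) charge_one_basis_in] this]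
    show ?thesis by (simp add: algebra_simps)
  qed
  have 3: "smul (if m + - j = 0 then of_int m * k * osp_form x ?e else 0) ?w
      \<in> fermion_span s (?d + j - int s - m - int s * q)"
  proof (cases "m = j \<and> q = - 1")
    case True
    thus ?thesis using w by (auto simp: fermion_span_def intro: span_scale)
  next
    case False
    hence "(if m + - j = 0 then of_int m * k * osp_form x ?e else 0) = 0"
      using osp_form_charge[OF Cons.prems(2) charge_one_basis_in[of r]] by auto
    thus ?thesis by (simp only: scale_zero_left) (simp add: fermion_span_def span_zero)
  qed
  let ?c = "smul (if m + - j = 0 then of_int m * k * osp_form x ?e else 0) ?w"
  have "mode x m (fermion_word (a # ps)) = smul (super_sign (odd q) (odd 1)) (mode ?e (- j) (mode x m ?w))
     + mode (sbracket x ?e) (m - j) ?w + ?c"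
    using mode_commutator[OF Cons.prems(2) charge_one_basis_in, of m r "- j" ?w] by (simp add: a)
  moreover have "smul (super_sign (odd q) (odd 1)) (mode ?e (- j) (mode x m ?w))
     + mode (sbracket x ?e) (m - j) ?w + ?c \<in> fermion_span s (?d + j - int s - m - int s * q)"
    unfolding fermion_span_def
    by (intro span_add 2[unfolded fermion_span_def] 3[unfolded fermion_span_def],
        rule span_scale, rule 1[unfolded fermion_span_def])
  ultimately show ?case unfolding D by simp
qed

text \<open>
  Modes of positive degree applied to fermion words.  These vectors span \<open>V\<close>, as in a
  Poincare-Birkhoff-Witt argument for the splitting of the affine algebra into positive and nonpositive
  degrees.
\<close>

inductive raised :: "nat \<Rightarrow> int \<Rightarrow> 'v \<Rightarrow> bool" for s where
  raised_fermion: "set ps \<subseteq> fermion_letters s \<Longrightarrow> raised s (fermion_degree s ps) (fermion_word ps)"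
| raised_mode: "raised s d w \<Longrightarrow> x \<in> charge_space q \<Longrightarrow> - m - int s * q \<ge> 1
    \<Longrightarrow> raised s (d - m - int s * q) (mode x m w)"

lemma raised_mode_span:
  assumes "w \<in> span {w. raised s d w}" "x \<in> charge_space q" "- m - int s * q \<ge> 1" "d' = d - m - int s * q"
  shows "mode x m w \<in> span {w. raised s d' w}"
  by (rule Y_span[OF _ assms(1)]) (auto intro!: span_base simp: assms(4) intro: raised_mode[OF _ assms(2,3)])

text \<open>
  The degree is carried along, so that \<open>monomial_in_raised\<close> expresses a monomial by raised vectors of the
  same degree.  A monomial of too small a degree is then a combination of zero vectors.
\<close>

lemma raised_stable:
  assumes "raised s d w" "z \<in> charge_space q"
  shows "mode z m w \<in> span {w. raised s (d - m - int s * q) w}"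
  using assms
proof (induction arbitrary: z q m rule: raised.induct)
  case (raised_fermion ps)
  show ?case
  proof (cases "- m - int s * q \<ge> 1")
    case True
    show ?thesis
      by (intro span_base CollectI raised_mode raised.raised_fermion raised_fermion True)
  next
    case False
    hence "mode z m (fermion_word ps) \<in> fermion_span s (fermion_degree s ps - m - int s * q)"
      using raised_fermion by (intro fermion_span_stable) auto
    moreover have "fermion_span s d \<subseteq> span {w. raised s d w}" for d
      unfolding fermion_span_def by (intro span_mono) (auto intro: raised.raised_fermion)
    ultimately show ?thesis by blast
  qed
next
  case (raised_mode d w x r l)
  show ?case
  proof (cases "- m - int s * q \<ge> 1")
    case True
    show ?thesis
      using raised_mode raised.raised_mode True by (intro span_base CollectI) blast
  next
    case False
    let ?d = "d - l - int s * r - m - int s * q"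
    have 1: "mode x l (mode z m w) \<in> span {w. raised s ?d w}"
      by (rule raised_mode_span[OF raised_mode.IH[OF raised_mode.prems] raised_mode.hyps(2,3)]) simp
    have 2: "mode (sbracket z x) (m + l) w \<in> span {w. raised s ?d w}"
      using raised_mode.IH[OF sbracket_charge[OF raised_mode.prems raised_mode.hyps(2)], of "m + l"]
      by (simp add: algebra_simps)
    have 3: "smul (if m + l = 0 then of_int m * k * osp_form z x else 0) w \<in> span {w. raised s ?d w}"
    proof (cases "m + l = 0 \<and> q + r = 0")
      case True
      hence "l = - m" "r = - q" by auto
      hence "?d = d" by (simp add: algebra_simps)
      have "w \<in> span {w. raised s d w}" using raised_mode.hyps(1) by (intro span_base) simp
      thus ?thesis unfolding \<open>?d = d\<close> by (rule span_scale)
    next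
      case False
      hence "(if m + l = 0 then of_int m * k * osp_form z x else 0) = 0"
        using osp_form_charge[OF raised_mode.prems raised_mode.hyps(2)] by auto
      thus ?thesis by (simp only: scale_zero_left span_zero)
    qed
    show ?thesis
      unfolding mode_commutator[OF raised_mode.prems raised_mode.hyps(2)]
      by (intro span_add 2 3, rule span_scale, rule 1)
  qed
qed

lemma monomial_in_raised: "monomial p q w \<Longrightarrow> w \<in> span {w. raised s (p - int s * q) w}"
proof (induction rule: monomial.induct)
  case monomial_vac
  have "raised s 0 vac" using raised_fermion[of "[]" s] by (simp add: fermion_degree_def)
  thus ?case by (intro span_base) simp
next
  case (monomial_mode p q w x r m)
  have "mode x m w' \<in> span {w. raised s (p - int s * q - m - int s * r) w}"
    if "w' \<in> span {w. raised s (p - int s * q) w}" for w'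
    by (rule Y_span[OF _ that]) (use raised_stable[OF _ monomial_mode(2)] in blast)
  from this[OF monomial_mode.IH] show ?case by (simp add: algebra_simps)
qed

lemma raised_bound: "raised s d w \<Longrightarrow> w \<noteq> 0 \<Longrightarrow> d \<ge> - int (s * card (fermion_letters s :: (('n + 'n) \<times> int) set))"
proof (induction rule: raised.induct)
  case (raised_fermion ps)
  have fin: "finite (fermion_letters s :: (('n + 'n) \<times> int) set)" by (simp add: fermion_letters_def)
  have "length ps = card (set ps)"
    using fermion_word_distinct[OF raised_fermion.prems] by (simp add: distinct_card)
  also have "\<dots> \<le> card (fermion_letters s :: (('n + 'n) \<times> int) set)"
    using raised_fermion.hyps by (intro card_mono fin)
  finally have l: "s * length ps \<le> s * card (fermion_letters s :: (('n + 'n) \<times> int) set)" by simp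
  have "fermion_degree s ps \<ge> - int (s * length ps)" using raised_fermion.hyps
    by (induction ps) (auto simp: fermion_degree_def fermion_letters_def algebra_simps)
  with l show ?case by linarith
next
  case (raised_mode d w x q m)
  hence "w \<noteq> 0" by auto
  with raised_mode show ?case by simp
qed

lemma monomial_bound:
  assumes "monomial p q w" "w \<noteq> 0"
  shows "p - int s * q \<ge> - int (s * card (fermion_letters s :: (('n + 'n) \<times> int) set))"
proof (rule ccontr)
  assume "\<not> ?thesis"
  hence "{w. raised s (p - int s * q) w} \<subseteq> {0}" using raised_bound by blast
  hence "span {w. raised s (p - int s * q) w} \<subseteq> {0}" using span_mono[of _ "{0}"] by (simp add: span_0 subset_singleton_iff) 
  with monomial_in_raised[OF assms(1), of s] assms(2) show False by blast
qed

text \<open>The case \<open>s = 0\<close>, where the alphabet of fermions is empty.\<close>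

lemma monomial_weight_nonneg: "monomial p q w \<Longrightarrow> w \<noteq> 0 \<Longrightarrow> p \<ge> 0"
  using monomial_bound[of p q w 0] by simp

end

section \<open>Matrix coefficients of a lowest energy vector\<close>

lemma (in vector_space) separating_functional:
  assumes "v \<notin> span S"
  obtains f :: "'b \<Rightarrow> 'a" where "\<And>u w. f (u + w) = f u + f w" "\<And>c u. f (scale c u) = c * f u"
    "f v = 1" "\<And>u. u \<in> S \<Longrightarrow> f u = 0"
proof -
  obtain B where B: "B \<subseteq> span S" "independent B" "span S \<subseteq> span B"
    using maximal_independent_subset[of "span S"] by blast
  have SB: "span B = span S"
    using B span_minimal[OF B(1) subspace_span] by blast
  have "independent (insert v B)" using B(2) assms SB by (simp add: independent_insertI)
  then obtain C where C: "insert v B \<subseteq> C" "independent C" "span C = UNIV"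
    using extend_basis_superset independent_extend_basis span_extend_basis by meson
  let ?f = "\<lambda>u. representation C u v"
  have add: "?f (u + w) = ?f u + ?f w" for u w using representation_add[OF C(2)] C(3) by simp
  have scal: "?f (scale c u) = c * ?f u" for c u using representation_scale[OF C(2)] C(3) by simp
  have vB: "v \<notin> B" using assms SB span_base by blast
  show thesis
  proof (rule that[OF add scal])
    show "?f v = 1" using representation_basis[OF C(2), of v] C(1) by simp
    fix u assume "u \<in> S"
    hence "u \<in> span B" using SB span_base by blast
    thus "?f u = 0"
    proof (induction rule: span_induct_alt)
      case base
      show ?case using scal[of 0 0] by simp
    next
      case (step c x y)
      have "?f x = 0" using representation_basis[OF C(2), of x] C(1) step(1) vB by auto
      thus ?case using step by (simp add: add scal)
    qed
  qed
qed

locale graded_current_algebra = osp_current_algebra smul V Y vac k X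
  for smul :: "complex \<Rightarrow> 'v::ab_group_add \<Rightarrow> 'v" and V Y vac k and X :: "'n::finite smat \<Rightarrow> 'v" +
  fixes D :: "'v \<Rightarrow> 'v"
  assumes D_add: "D (u + w) = D u + D w"
    and D_scale: "D (smul c u) = smul c (D u)"
    and D_vac: "D vac = 0"
    and D_mode: "x \<in> charge_space q \<Longrightarrow> D (mode x m w) = mode x m (D w) - smul (of_int m) (mode x m w)"
    and generated: "span {w. \<exists>p q. monomial p q w} = UNIV"
begin

lemma D_monomial: "monomial p q w \<Longrightarrow> D w = smul (of_int p) w"
  by (induction rule: monomial.induct)
     (simp_all add: D_vac D_mode Y_scale_right scale_left_diff_distrib)

lemma monomial_induct [case_names zero step]:
  assumes "P 0" "\<And>c p q x y. monomial p q x \<Longrightarrow> P y \<Longrightarrow> P (smul c x + y)"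
  shows "P u"
proof -
  have "u \<in> span {w. \<exists>p q. monomial p q w}" using generated by simp
  thus ?thesis by (induction rule: span_induct_alt) (use assms in auto)
qed

lemma monomial_separated:
  assumes "monomial p q v" "v \<noteq> 0"
  shows "v \<notin> span {w. \<exists>p' q'. monomial p' q' w \<and> (p', q') \<noteq> (p, q)}"
proof
  assume v: "v \<in> span {w. \<exists>p' q'. monomial p' q' w \<and> (p', q') \<noteq> (p, q)}"
  \<comment> \<open>Weight and charge are integers, so the single operator \<open>D + \<i> h(0)\<close> separates the bidegrees.\<close>
  define A where "A w = D w + smul \<i> (mode heis 0 w)" for w
  have A: "A w = smul (of_int p' + \<i> * of_int q') w" if "monomial p' q' w" for p' q' w
    using D_monomial[OF that] heis_zero_mode_monomial[OF that] by (simp add: A_def scale_left_distrib)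
  have "{w. \<exists>p' q'. monomial p' q' w \<and> (p', q') \<noteq> (p, q)}
      \<subseteq> {w. \<exists>\<mu>. \<mu> \<noteq> of_int p + \<i> * of_int q \<and> A w = smul \<mu> w}"
  proof
    fix w assume "w \<in> {w. \<exists>p' q'. monomial p' q' w \<and> (p', q') \<noteq> (p, q)}"
    then obtain p' q' where w: "monomial p' q' w" "(p', q') \<noteq> (p, q)" by blast
    have "of_int p' + \<i> * of_int q' \<noteq> (of_int p + \<i> * of_int q :: complex)"
      using w(2) by (auto simp: complex_eq_iff)
    thus "w \<in> {w. \<exists>\<mu>. \<mu> \<noteq> of_int p + \<i> * of_int q \<and> A w = smul \<mu> w}"
      using A[OF w(1)] by blast
  qed
  hence "v \<in> span {w. \<exists>\<mu>. \<mu> \<noteq> of_int p + \<i> * of_int q \<and> A w = smul \<mu> w}"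
    using v span_mono by blast
  hence "v = 0"
    by (rule eigenvector_not_in_other_eigenspaces[of A, rotated 3])
       (simp_all add: A[OF assms(1)], simp_all add: A_def D_add D_scale Y_add_right Y_scale_right scale_right_distrib mult.commute)
  with assms(2) show False ..
qed

lemma Y_monomial: "monomial p q u \<Longrightarrow> monomial p' q' w \<Longrightarrow>
   Y u r w \<in> span {z. monomial (p + p' - r - 1) (q + q') z}"
proof (induction arbitrary: p' q' w r rule: monomial.induct)
  case monomial_vac
  thus ?case by (auto simp: vacuum span_zero intro: span_base)
next
  case (monomial_mode p q u x t n)
  let ?S = "span {z. monomial (p - n + p' - r - 1) (q + t + q') z}"
  have 1: "mode x (n - int i) (Y u (r + int i) w) \<in> ?S" for i
  proof (rule Y_span[OF _ monomial_mode.IH[OF monomial_mode.prems]])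
    fix z assume "z \<in> {z. monomial (p + p' - (r + int i) - 1) (q + q') z}"
    hence "monomial (p + p' - (r + int i) - 1 - (n - int i)) (q + q' + t) (mode x (n - int i) z)"
      using monomial.monomial_mode[OF _ monomial_mode.hyps(2)] by blast
    thus "mode x (n - int i) z \<in> ?S" by (intro span_base) (simp add: algebra_simps)
  qed
  have 2: "Y u (r + n - int i) (mode x (int i) w) \<in> ?S" for i
    using monomial_mode.IH[OF monomial.monomial_mode[OF monomial_mode.prems monomial_mode.hyps(2)], of "r + n - int i" "int i"]
    by (simp add: algebra_simps)
  show ?case
    unfolding iterate_formula[OF monomial_mode.hyps(2) monomial_parity[OF monomial_mode.hyps(1)]]
    by (intro Sum_any_in_subspace subspace_span span_scale span_diff 1 2)
qed

lemma truncation_nat: "\<exists>N. \<forall>i>N. Y u (r + int i) w = 0"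
proof -
  obtain M where M: "\<forall>m\<ge>M. Y u m w = 0" using truncation by blast
  have "Y u (r + int i) w = 0" if "i > nat (M - r)" for i using that M by auto
  thus ?thesis by blast
qed

end

lemma gbinomial_one: "i > 1 \<Longrightarrow> (1 :: complex) gchoose i = 0"
  by (metis binomial_gbinomial binomial_eq_0 of_nat_0 of_nat_1)

text \<open>
  The energy is weight minus \<open>s\<close> times charge; \<open>v\<close> is a monomial of least energy, and \<open>\<theta>\<close> is a
  functional concentrated on the bidegree of \<open>v\<close>.  So \<open>\<theta>\<close> is a covector of lowest energy,
  annihilated by the modes that raise the energy (\<open>\<theta>_mode\<close>), while \<open>v\<close> is annihilated by those that lower it
  (\<open>mode_v\<close>).
\<close>

locale spectral_flow = graded_current_algebra smul V Y vac k X D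
  for smul :: "complex \<Rightarrow> 'v::ab_group_add \<Rightarrow> 'v" and V Y vac k and X :: "'n::finite smat \<Rightarrow> 'v" and D +
  fixes s :: nat and v :: 'v and p0 q0 :: int and \<theta> :: "'v \<Rightarrow> complex"
  assumes v_monomial: "monomial p0 q0 v"
    and v_minimal: "monomial p q w \<Longrightarrow> w \<noteq> 0 \<Longrightarrow> p0 - int s * q0 \<le> p - int s * q"
    and \<theta>_add: "\<theta> (u + w) = \<theta> u + \<theta> w"
    and \<theta>_scale: "\<theta> (smul c w) = c * \<theta> w"
    and \<theta>_v: "\<theta> v = 1"
    and \<theta>_other: "monomial p q w \<Longrightarrow> (p, q) \<noteq> (p0, q0) \<Longrightarrow> \<theta> w = 0"
begin

lemma \<theta>_zero [simp]: "\<theta> 0 = 0" using \<theta>_scale[of 0 0] by simp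

lemma \<theta>_diff: "\<theta> (u - w) = \<theta> u - \<theta> w"
  using \<theta>_add[of "u - w" w] by simp

lemma subspace_\<theta>: "subspace {w. \<theta> w = 0}"
  by (simp add: subspace_def \<theta>_add \<theta>_scale)

lemma \<theta>_sum: "\<theta> (\<Sum>i\<in>I. f i) = (\<Sum>i\<in>I. \<theta> (f i))"
  by (induction I rule: infinite_finite_induct) (simp_all add: \<theta>_add)

lemma \<theta>_Sum_any: "finite {i. g i \<noteq> 0} \<Longrightarrow> \<theta> (Sum_any g) = Sum_any (\<lambda>i. \<theta> (g i))"
proof -
  assume fin: "finite {i. g i \<noteq> 0}"
  have "Sum_any (\<lambda>i. \<theta> (g i)) = (\<Sum>i | g i \<noteq> 0. \<theta> (g i))"
    by (rule Sum_any.expand_superset[OF fin]) auto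
  thus ?thesis by (simp add: Sum_any.expand_set \<theta>_sum)
qed

lemma \<theta>_mode: "x \<in> charge_space q \<Longrightarrow> j + int s * q < 0 \<Longrightarrow> \<theta> (mode x j w) = 0"
proof (induction w rule: monomial_induct)
  case (step c p' q' w y)
  have "\<theta> (mode x j w) = 0"
  proof (cases "w = 0 \<or> (p' - j, q' + q) \<noteq> (p0, q0)")
    case True
    thus ?thesis using \<theta>_other[OF monomial_mode[OF step(1) step.prems(1)], of j] by auto
  next
    case False
    hence "p0 - int s * q0 \<le> p' - int s * q'" using v_minimal[OF step(1)] by blast
    moreover have "p' = p0 + j" "q' = q0 - q" using False by auto
    ultimately show ?thesis using step.prems(2) by (simp add: algebra_simps)
  qed
  thus ?case using step by (simp add: Y_add_right Y_scale_right \<theta>_add \<theta>_scale)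
qed simp

lemma mode_v: "x \<in> charge_space q \<Longrightarrow> j + int s * q > 0 \<Longrightarrow> mode x j v = 0"
  using v_minimal[OF monomial_mode[OF v_monomial], of x q j] by (auto simp: algebra_simps)

lemma \<theta>_heis: "\<theta> (mode heis 0 w) = of_int q0 * \<theta> w"
proof (induction w rule: monomial_induct)
  case (step c p q w y)
  have "\<theta> (mode heis 0 w) = of_int q0 * \<theta> w"
    using \<theta>_other[OF step(1)] by (cases "q = q0") (auto simp: heis_zero_mode_monomial[OF step(1)] \<theta>_scale)
  thus ?case using step by (simp add: Y_add_right Y_scale_right \<theta>_add \<theta>_scale algebra_simps)
qed simp

text \<open>
  \<open>\<phi> u\<close> is the matrix coefficient \<open>\<theta>(Y(u, z)v)\<close> at \<open>z = 1\<close>.  For a monomial \<open>u\<close> one mode contributes, the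
  zero mode with respect to the energy (\<open>\<phi>_monomial\<close>).
\<close>

definition \<phi> :: "'v \<Rightarrow> complex" where
  "\<phi> u = Sum_any (\<lambda>m. \<theta> (Y u m v))"

lemma \<theta>_Y_monomial:
  assumes "monomial p q u" "r \<noteq> p - int s * q - 1"
  shows "\<theta> (Y u r v) = 0"
proof -
  have ne: "(p + p0 - r - 1, q + q0) \<noteq> (p0, q0)" using assms(2) by auto
  have "Y u r v \<in> span {z. monomial (p + p0 - r - 1) (q + q0) z}"
    by (rule Y_monomial[OF assms(1) v_monomial])
  also have "\<dots> \<subseteq> {w. \<theta> w = 0}"
    using \<theta>_other[OF _ ne] by (intro span_minimal subspace_\<theta>) auto
  finally show ?thesis by simp
qed

lemma \<phi>_monomial: "monomial p q u \<Longrightarrow> \<phi> u = \<theta> (Y u (p - int s * q - 1) v)"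
  unfolding \<phi>_def using \<theta>_Y_monomial[of p q u]
  by (subst Sum_any.expand_superset[of "{p - int s * q - 1}"]) auto

lemma \<phi>_finite: "finite {m. \<theta> (Y u m v) \<noteq> 0}"
proof (induction u rule: monomial_induct)
  case (step c p q x y)
  have "{m. \<theta> (Y (smul c x + y) m v) \<noteq> 0} \<subseteq> {p - int s * q - 1} \<union> {m. \<theta> (Y y m v) \<noteq> 0}"
    using \<theta>_Y_monomial[OF step(1)] by (auto simp: Y_add_left Y_scale_left \<theta>_add \<theta>_scale)
  thus ?case by (rule finite_subset) (simp add: step(2))
qed simp

lemma \<phi>_add: "\<phi> (u + w) = \<phi> u + \<phi> w"
  unfolding \<phi>_def by (simp add: Y_add_left \<theta>_add Sum_any.distrib \<phi>_finite)

lemma \<phi>_scale: "\<phi> (smul c u) = c * \<phi> u"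
  unfolding \<phi>_def by (simp add: Y_scale_left \<theta>_scale Sum_any_right_distrib \<phi>_finite)

lemma \<phi>_zero [simp]: "\<phi> 0 = 0" using \<phi>_scale[of 0 0] by simp

lemma \<phi>_vac: "\<phi> vac = 1"
  using \<phi>_monomial[OF monomial_vac] by (simp add: vacuum \<theta>_v)

text \<open>
  The Borcherds identity under \<open>\<theta>\<close> and on \<open>v\<close>.  The index \<open>r = p - s t - n - s q - 1 - m\<close> is the one
  for which every term on the left is an energy zero mode, that is, a value of \<open>\<phi>\<close>.  In terms of the current
  \<open>x\<close> near the point \<open>z = 1\<close>, with \<open>\<zeta> = z - 1\<close>, the left side is \<open>x\<close> weighted with \<open>\<zeta>\<^sup>n (1 + \<zeta>)\<^sup>m\<close>.
\<close>

lemma \<phi>_borcherds: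
  assumes u: "monomial p t u" and x: "x \<in> charge_space q"
  shows "Sum_any (\<lambda>i. (of_int m gchoose i) * \<phi> (mode x (n + int i) u))
    = Sum_any (\<lambda>i. \<theta> (smul ((- 1) ^ i * (of_int n gchoose i))
         (mode x (m + n - int i) (Y u (p - int s * t - n - int s * q - 1 - m + int i) v)
          - smul ((- 1) powi n * super_sign (odd q) (odd t))
              (Y u (p - int s * t - n - int s * q - 1 - m + n - int i) (mode x (m + int i) v)))))"
proof -
  let ?r = "p - int s * t - n - int s * q - 1 - m"
  let ?L = "\<lambda>i::nat. smul (of_int m gchoose i) (Y (mode x (n + int i) u) (m + ?r - int i) v)"
  let ?R = "\<lambda>i::nat. smul ((- 1) ^ i * (of_int n gchoose i))
         (mode x (m + n - int i) (Y u (?r + int i) v)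
          - smul ((- 1) powi n * super_sign (odd q) (odd t)) (Y u (?r + n - int i) (mode x (m + int i) v)))"
  have eq: "Sum_any ?L = Sum_any ?R"
    by (rule borcherds_identity[OF X_parity[OF x] monomial_parity[OF u]])
  have finL: "finite {i. ?L i \<noteq> 0}"
  proof -
    obtain N where "\<forall>i>N. mode x (n + int i) u = 0" using truncation_nat by blast
    hence "{i. ?L i \<noteq> 0} \<subseteq> {..N}" by (auto simp: not_less[symmetric])
    thus ?thesis by (rule finite_subset) simp
  qed
  have finR: "finite {i. ?R i \<noteq> 0}"
  proof -
    obtain N1 N2 where "\<forall>i>N1. Y u (?r + int i) v = 0" "\<forall>i>N2. mode x (m + int i) v = 0"
      using truncation_nat by meson
    hence "{i. ?R i \<noteq> 0} \<subseteq> {..max N1 N2}" by (auto simp: not_less[symmetric])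
    thus ?thesis by (rule finite_subset) simp
  qed
  have "\<theta> (?L i) = (of_int m gchoose i) * \<phi> (mode x (n + int i) u)" for i
    unfolding \<theta>_scale \<phi>_monomial[OF monomial_mode[OF u x]] by (simp add: algebra_simps)
  hence "Sum_any (\<lambda>i. (of_int m gchoose i) * \<phi> (mode x (n + int i) u)) = \<theta> (Sum_any ?L)"
    unfolding \<theta>_Sum_any[OF finL] by simp
  also have "\<dots> = Sum_any (\<lambda>i. \<theta> (?R i))" unfolding eq by (rule \<theta>_Sum_any[OF finR])
  finally show ?thesis .
qed

text \<open>
  With \<open>m = 1 - s q\<close> and \<open>n \<le> -2\<close> the function \<open>\<zeta>\<^sup>n (1 + \<zeta>)\<^sup>m\<close> vanishes to such an order at \<open>z = 0\<close> and at
  infinity that each mode on the right either lowers the energy of \<open>v\<close>, or produces vectors of more than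
  the least energy, where \<open>\<theta>\<close> is zero.  The binomial coefficients of \<open>1 - s q\<close> instead of those of \<open>1\<close> are the trace of the spectral flow;
  the operators \<open>flow\<close> below remove them.
\<close>

lemma \<phi>_vanishing:
  assumes x: "x \<in> charge_space q" and n: "n \<le> - 2"
  shows "Sum_any (\<lambda>i. (of_int (1 - int s * q) gchoose i) * \<phi> (mode x (n + int i) u)) = 0"
proof -
  let ?g = "\<lambda>u i. (of_int (1 - int s * q) gchoose i) * \<phi> (mode x (n + int i) u)"
  have fin: "finite {i. ?g u i \<noteq> 0}" for u
  proof -
    obtain N where "\<forall>i>N. mode x (n + int i) u = 0" using truncation_nat by blast
    hence "{i. ?g u i \<noteq> 0} \<subseteq> {..N}"
      by (auto simp: not_less[symmetric])
    thus ?thesis by (rule finite_subset) simp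
  qed
  have vanish: "\<theta> (smul a (mode x (1 - int s * q + n - int i) w
      - smul b (Y u r (mode x (1 - int s * q + int i) v)))) = 0" for a b i w u r
    using n by (simp add: \<theta>_scale \<theta>_diff \<theta>_mode[OF x] mode_v[OF x])
  show ?thesis
  proof (induction u rule: monomial_induct)
    case (step c p t u y)
    have "Sum_any (?g u) = 0"
      unfolding \<phi>_borcherds[OF step(1) x] by (simp add: vanish)
    moreover have "Sum_any (?g (smul c u + y)) = Sum_any (\<lambda>i. ?g (smul c u) i + ?g y i)"
      by (simp only: Y_add_right \<phi>_add distrib_left)
    moreover have "\<dots> = Sum_any (?g (smul c u)) + Sum_any (?g y)"
      by (rule Sum_any.distrib[OF fin fin])
    moreover have "Sum_any (?g (smul c u)) = Sum_any (\<lambda>i. c * ?g u i)"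
      by (simp only: Y_scale_right \<phi>_scale mult.left_commute)
    moreover have "\<dots> = c * Sum_any (?g u)"
      by (rule Sum_any_right_distrib[OF fin, symmetric])
    ultimately show ?case using step(2) by simp
  qed simp
qed

text \<open>
  The same with \<open>x = h\<close>, \<open>m = 1\<close>, \<open>n = -1\<close>.  One term on the right survives: \<open>h(0)\<close> under \<open>\<theta>\<close>.
\<close>

lemma \<phi>_heis: "\<phi> (mode heis (- 1) u) + \<phi> (mode heis 0 u) = of_int q0 * \<phi> u"
proof (induction u rule: monomial_induct)
  case (step c p t u y)
  have "Sum_any (\<lambda>i. (of_int 1 gchoose i) * \<phi> (mode heis (- 1 + int i) u))
     = (\<Sum>i\<in>{0, 1}. ((of_int 1 :: complex) gchoose i) * \<phi> (mode heis (- 1 + int i) u))"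
  proof (rule Sum_any.expand_superset)
    show "{i. ((of_int 1 :: complex) gchoose i) * \<phi> (mode heis (- 1 + int i) u) \<noteq> 0} \<subseteq> {0, 1}"
    proof
      fix i assume "i \<in> {i. ((of_int 1 :: complex) gchoose i) * \<phi> (mode heis (- 1 + int i) u) \<noteq> 0}"
      hence "\<not> i > 1" using gbinomial_one[of i] by auto
      thus "i \<in> {0, 1}" by auto
    qed
  qed simp
  also have "\<dots> = \<phi> (mode heis (- 1) u) + \<phi> (mode heis 0 u)" by simp
  finally have 1: "Sum_any (\<lambda>i. (of_int 1 gchoose i) * \<phi> (mode heis (- 1 + int i) u))
     = \<phi> (mode heis (- 1) u) + \<phi> (mode heis 0 u)" .
  have "Sum_any (\<lambda>i. (of_int 1 gchoose i) * \<phi> (mode heis (- 1 + int i) u))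
     = Sum_any (\<lambda>i::nat. if i = 0 then of_int q0 * \<phi> u else 0)"
    unfolding \<phi>_borcherds[OF step(1) heis_charge]
    by (intro arg_cong[where f = Sum_any] ext)
       (auto simp: \<theta>_scale \<theta>_diff \<theta>_mode[OF heis_charge] mode_v[OF heis_charge] \<theta>_heis \<phi>_monomial[OF step(1)])
  also have "\<dots> = of_int q0 * \<phi> u" by simp
  finally have "\<phi> (mode heis (- 1) u) + \<phi> (mode heis 0 u) = of_int q0 * \<phi> u" unfolding 1 .
  thus ?case using step(2) by (simp add: Y_add_right Y_scale_right \<phi>_add \<phi>_scale algebra_simps flip: distrib_left)
qed simp

end

section \<open>Spectral flow\<close>

lemma sum_triangle_swap:
  fixes f :: "nat \<Rightarrow> nat \<Rightarrow> 'a::comm_monoid_add"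
  shows "(\<Sum>l\<le>j. \<Sum>i\<le>j - l. f l i) = (\<Sum>i\<le>j. \<Sum>l\<le>j - i. f l i)"
proof -
  have "(\<Sum>l\<le>j. \<Sum>i\<le>j - l. f l i) = (\<Sum>(l, i)\<in>Sigma {..j} (\<lambda>l. {..j - l}). f l i)"
    by (rule sum.Sigma) auto
  also have "\<dots> = (\<Sum>(i, l)\<in>Sigma {..j} (\<lambda>i. {..j - i}). f l i)"
    by (rule sum.reindex_bij_witness[of _ "\<lambda>(i, l). (l, i)" "\<lambda>(i, l). (l, i)"]) auto
  also have "\<dots> = (\<Sum>i\<le>j. \<Sum>l\<le>j - i. f l i)"
    by (rule sum.Sigma[symmetric]) auto
  finally show ?thesis .
qed

lemma sum_triangle_diagonals:
  fixes f :: "nat \<Rightarrow> nat \<Rightarrow> 'a::comm_monoid_add"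
  shows "(\<Sum>l\<le>j. \<Sum>i\<le>j - l. f l i) = (\<Sum>t\<le>j. \<Sum>l\<le>t. f l (t - l))"
proof -
  have "(\<Sum>l\<le>j. \<Sum>i\<le>j - l. f l i) = (\<Sum>(l, i)\<in>Sigma {..j} (\<lambda>l. {..j - l}). f l i)"
    by (rule sum.Sigma) auto
  also have "Sigma {..j} (\<lambda>l. {..j - l}) = {(l, i). l + i \<le> j}" by auto
  finally show ?thesis by (simp add: sum.triangle_reindex_eq)
qed

text \<open>
  Compare coefficients in \<open>z f' = a z (1 + z)\<^sup>-\<^sup>1 f\<close> for \<open>f = (1 + z)\<^sup>a\<close>.
\<close>

lemma gbinomial_log_derivative:
  fixes a :: complex
  shows "of_nat (Suc t) * (a gchoose Suc t) = a * (\<Sum>l\<le>t. (- 1) ^ l * (a gchoose (t - l)))"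
proof -
  have "(\<Sum>l\<le>t. (- 1) ^ l * (a gchoose (t - l))) = (a - 1) gchoose t"
  proof (induction t)
    case (Suc t)
    have "(\<Sum>l\<le>Suc t. (- 1) ^ l * (a gchoose (Suc t - l)))
       = (a gchoose Suc t) + (\<Sum>l\<le>t. (- 1) ^ Suc l * (a gchoose (t - l)))"
      by (subst sum.atMost_Suc_shift) simp
    also have "\<dots> = (a gchoose Suc t) - ((a - 1) gchoose t)"
      by (simp add: Suc sum_negf)
    also have "\<dots> = (a - 1) gchoose Suc t"
      using gbinomial_Suc_Suc[of "a - 1" t] by simp
    finally show ?case .
  qed simp
  thus ?thesis using gbinomial_absorption[of t a] by (simp add: Suc_times_gbinomial)
qed

lemma Sum_any_shift:
  fixes f :: "nat \<Rightarrow> complex"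
  assumes "finite {j. f j \<noteq> 0}"
  shows "Sum_any (\<lambda>j. if m \<le> j then f (j - m) else 0) = Sum_any f"
proof -
  have "Sum_any (\<lambda>j. if m \<le> j then f (j - m) else 0) = (\<Sum>j\<in>(\<lambda>j. j + m) ` {j. f j \<noteq> 0}. if m \<le> j then f (j - m) else 0)"
  proof (rule Sum_any.expand_superset)
    show "{j. (if m \<le> j then f (j - m) else 0) \<noteq> 0} \<subseteq> (\<lambda>j. j + m) ` {j. f j \<noteq> 0}"
    proof
      fix j assume "j \<in> {j. (if m \<le> j then f (j - m) else 0) \<noteq> 0}"
      hence "m \<le> j" "f (j - m) \<noteq> 0" by (auto split: if_splits)
      thus "j \<in> (\<lambda>j. j + m) ` {j. f j \<noteq> 0}" by (intro image_eqI[of _ _ "j - m"]) auto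
    qed
  qed (use assms in simp)
  also have "\<dots> = Sum_any f" by (subst sum.reindex) (auto simp: Sum_any.expand_set)
  finally show ?thesis .
qed

lemma Sum_any_convolution:
  fixes g :: "nat \<Rightarrow> nat \<Rightarrow> complex"
  assumes "\<And>i l. i > N \<or> l > N \<Longrightarrow> g i l = 0"
  shows "Sum_any (\<lambda>j. \<Sum>i\<le>j. g i (j - i)) = (\<Sum>l\<le>N. \<Sum>i\<le>N. g i l)"
proof -
  have "Sum_any (\<lambda>j. \<Sum>i\<le>j. g i (j - i)) = (\<Sum>j\<le>2 * N. \<Sum>i\<le>j. g i (j - i))"
  proof (rule Sum_any.expand_superset)
    show "{j. (\<Sum>i\<le>j. g i (j - i)) \<noteq> 0} \<subseteq> {..2 * N}"
    proof
      fix j assume "j \<in> {j. (\<Sum>i\<le>j. g i (j - i)) \<noteq> 0}"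
      then obtain i where "i \<le> j" "g i (j - i) \<noteq> 0" by (auto elim: sum.not_neutral_contains_not_neutral)
      hence "i \<le> N" "j - i \<le> N" using assms by (meson not_less)+
      thus "j \<in> {..2 * N}" by simp
    qed
  qed simp
  also have "\<dots> = (\<Sum>i\<le>2 * N. \<Sum>l\<le>2 * N - i. g i l)"
    by (rule sum_triangle_diagonals[symmetric])
  also have "\<dots> = (\<Sum>i\<le>N. \<Sum>l\<le>2 * N - i. g i l)"
    using assms by (intro sum.mono_neutral_right) auto
  also have "\<dots> = (\<Sum>i\<le>N. \<Sum>l\<le>N. g i l)"
    using assms by (intro sum.cong[OF refl] sum.mono_neutral_right) auto
  also have "\<dots> = (\<Sum>l\<le>N. \<Sum>i\<le>N. g i l)" by (rule sum.swap)
  finally show ?thesis .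
qed

context spectral_flow
begin

text \<open>
  \<open>flow j\<close> is the component of Li's operator \<open>exp(-s \<Sum>\<^sub>i (-1)\<^sup>i\<^sup>+\<^sup>1 h(i)/i)\<close>, the sum over \<open>i \<ge> 1\<close>, that lowers the weight by \<open>j\<close>.
  The recursion is the coefficient form of its logarithmic derivative.  It spares the exponential, and
  it makes the conjugation formulas below provable by induction on \<open>j\<close>.
\<close>

fun flow :: "nat \<Rightarrow> 'v \<Rightarrow> 'v" where
  "flow 0 u = u"
| "flow (Suc j) u = smul (- of_nat s / of_nat (Suc j))
     (\<Sum>l\<le>j. smul ((- 1) ^ l) (mode heis (int l + 1) (flow (j - l) u)))"

declare flow.simps(2) [simp del]

lemma flow_recursion: "smul (of_nat (Suc j)) (flow (Suc j) u)
    = (\<Sum>l\<le>j. smul (- of_nat s * (- 1) ^ l) (mode heis (int l + 1) (flow (j - l) u)))"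
  unfolding flow.simps(2) by (simp add: scale_sum_right del: of_nat_Suc)

lemma flow_eqI:
  assumes "smul (of_nat (Suc j)) (flow (Suc j) u) = smul (of_nat (Suc j)) w"
  shows "flow (Suc j) u = w"
  using assms by (simp del: of_nat_Suc)

lemma flow_add: "flow j (u + w) = flow j u + flow j w"
proof (induction j rule: less_induct)
  case (less j)
  show ?case
  proof (cases j)
    case (Suc i)
    hence "flow (i - l) (u + w) = flow (i - l) u + flow (i - l) w" for l using less by simp
    thus ?thesis unfolding Suc flow.simps(2)
      by (simp add: Y_add_right scale_right_distrib sum.distrib)
  qed simp
qed

lemma flow_scale: "flow j (smul c u) = smul c (flow j u)"
proof (induction j rule: less_induct)
  case (less j)
  show ?case
  proof (cases j)
    case (Suc i)
    hence "flow (i - l) (smul c u) = smul c (flow (i - l) u)" for l using less by simp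
    thus ?thesis unfolding Suc flow.simps(2)
      by (simp add: Y_scale_right scale_sum_right mult.commute mult.left_commute)
  qed simp
qed

lemma flow_zero [simp]: "flow j 0 = 0"
  using flow_scale[of j 0 0] by simp

lemma flow_monomial: "monomial p q u \<Longrightarrow> flow j u \<in> span {w. monomial (p - int j) q w}"
proof (induction j rule: less_induct)
  case (less j)
  show ?case
  proof (cases j)
    case 0
    thus ?thesis using less.prems by (auto intro: span_base)
  next
    case (Suc i)
    have "mode heis (int l + 1) (flow (i - l) u) \<in> span {w. monomial (p - int j) q w}" if l: "l \<le> i" for l
    proof (rule Y_span[OF _ less.IH[OF _ less.prems, of "i - l"]])
      fix w assume "w \<in> {w. monomial (p - int (i - l)) q w}"
      hence "monomial (p - int (i - l) - (int l + 1)) (q + 0) (mode heis (int l + 1) w)"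
        using monomial_mode heis_charge by blast
      thus "mode heis (int l + 1) w \<in> span {w. monomial (p - int j) q w}"
        using l Suc by (intro span_base) (simp add: of_nat_diff algebra_simps)
    qed (use Suc in simp)
    thus ?thesis unfolding Suc flow.simps(2) using Suc by (intro span_scale span_sum) auto
  qed
qed

lemma flow_locally_finite: "\<exists>N. \<forall>j>N. flow j u = 0"
proof (induction u rule: monomial_induct)
  case (step c p q x y)
  then obtain N where N: "\<forall>j>N. flow j y = 0" by blast
  have "flow j x = 0" if "j > nat p" for j
  proof -
    have "{w. monomial (p - int j) q w} \<subseteq> {0}"
      using monomial_weight_nonneg[of "p - int j" q] that by fastforce
    hence "span {w. monomial (p - int j) q w} \<subseteq> {0}"
      by (intro span_minimal subspace_single_0)
    thus ?thesis using flow_monomial[OF step(1), of j] by blast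
  qed
  hence "flow j (smul c x + y) = 0" if "j > max (nat p) N" for j
    using that N by (simp add: flow_add flow_scale)
  thus ?case by blast
qed auto

lemma flow_support_finite:
  fixes f :: "'v \<Rightarrow> complex"
  assumes "f 0 = 0"
  shows "finite {j. f (flow j u) \<noteq> 0}"
proof -
  obtain N where "\<forall>j>N. flow j u = 0" using flow_locally_finite by blast
  hence "{j. f (flow j u) \<noteq> 0} \<subseteq> {..N}" using assms by (auto simp: not_less[symmetric])
  thus ?thesis by (rule finite_subset) simp
qed

lemma flow_vac: "j > 0 \<Longrightarrow> flow j vac = 0"
proof (induction j rule: less_induct)
  case (less j)
  then obtain i where j: "j = Suc i" by (cases j) auto
  have "mode heis (int l + 1) (flow (i - l) vac) = 0" if "l \<le> i" for l
  proof (cases "l = i")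
    case False
    hence "flow (i - l) vac = 0" using that j by (intro less.IH) auto
    thus ?thesis by simp
  qed (simp add: creation)
  thus ?case unfolding j flow.simps(2) by simp
qed

text \<open>
  Conjugation multiplies a current of charge \<open>q\<close> by \<open>(1 + \<zeta>)\<^sup>a\<close> with \<open>a = -s q\<close>.  In the induction step, moving \<open>h(l + 1)\<close>
  past \<open>x(n + i)\<close> leaves a product term, to which the recursion applies again, and a
  bracket term, to which \<open>gbinomial_log_derivative\<close> applies.  Their coefficients \<open>j - i\<close> and \<open>i\<close> add up
  to \<open>j\<close>.
\<close>

lemma flow_charged:
  assumes x: "x \<in> charge_space q" and q: "q \<noteq> 0"
  shows "flow j (mode x n u)
    = (\<Sum>i\<le>j. smul (of_int (- int s * q) gchoose i) (mode x (n + int i) (flow (j - i) u)))"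
proof (induction j rule: less_induct)
  case (less j)
  let ?a = "of_int (- int s * q) :: complex"
  have a: "?a = - of_nat s * of_int q" by simp
  show ?case
  proof (cases j)
    case (Suc t)
    have comm: "mode heis (int l + 1) (mode x (n + int i) w)
      = mode x (n + int i) (mode heis (int l + 1) w) + smul (of_int q) (mode x (n + int (Suc (i + l))) w)" for l i w
    proof -
      have "osp_form heis x = 0" using osp_form_charge[OF heis_charge x] q by simp
      thus ?thesis using mode_commutator[OF heis_charge x, of "int l + 1" "n + int i" w] charge_space_osp[OF x]
        by (simp add: super_sign_def sbracket_heis[OF x] X_scale Y_scale_left algebra_simps)
    qed
    \<comment> \<open>\<open>?A\<close> collects the product terms, \<open>?B\<close> the bracket terms.\<close>
    let ?A = "\<Sum>l\<le>t. \<Sum>i\<le>t - l. smul (- of_nat s * (- 1) ^ l * (?a gchoose i))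
           (mode x (n + int i) (mode heis (int l + 1) (flow (t - l - i) u)))"
    let ?B = "\<Sum>l\<le>t. \<Sum>i\<le>t - l. smul (?a * ((- 1) ^ l * (?a gchoose i)))
           (mode x (n + int (Suc (i + l))) (flow (t - l - i) u))"
    have "smul (of_nat (Suc t)) (flow (Suc t) (mode x n u))
      = (\<Sum>l\<le>t. smul (- of_nat s * (- 1) ^ l) (mode heis (int l + 1) (flow (t - l) (mode x n u))))"
      by (rule flow_recursion)
    also have "\<dots> = (\<Sum>l\<le>t. \<Sum>i\<le>t - l. smul (- of_nat s * (- 1) ^ l * (?a gchoose i))
           (mode heis (int l + 1) (mode x (n + int i) (flow (t - l - i) u))))"
    proof (rule sum.cong[OF refl])
      fix l assume "l \<in> {..t}"
      have "flow (t - l) (mode x n u) = (\<Sum>i\<le>t - l. smul (?a gchoose i) (mode x (n + int i) (flow (t - l - i) u)))"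
        using Suc by (intro less.IH) auto
      thus "smul (- of_nat s * (- 1) ^ l) (mode heis (int l + 1) (flow (t - l) (mode x n u)))
        = (\<Sum>i\<le>t - l. smul (- of_nat s * (- 1) ^ l * (?a gchoose i))
           (mode heis (int l + 1) (mode x (n + int i) (flow (t - l - i) u))))"
        by (simp only: Y_sum_right Y_scale_right scale_sum_right scale_scale)
    qed
    also have "\<dots> = ?A + ?B"
      unfolding sum.distrib[symmetric]
    proof (intro sum.cong refl)
      fix l i
      show "smul (- of_nat s * (- 1) ^ l * (?a gchoose i)) (mode heis (int l + 1) (mode x (n + int i) (flow (t - l - i) u)))
        = smul (- of_nat s * (- 1) ^ l * (?a gchoose i)) (mode x (n + int i) (mode heis (int l + 1) (flow (t - l - i) u)))
        + smul (?a * ((- 1) ^ l * (?a gchoose i))) (mode x (n + int (Suc (i + l))) (flow (t - l - i) u))"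
        unfolding comm scale_right_distrib scale_scale a by (simp only: mult_ac)
    qed
    also have "?A = (\<Sum>i\<le>t. smul (of_nat (Suc t - i) * (?a gchoose i)) (mode x (n + int i) (flow (Suc t - i) u)))"
    proof (subst sum_triangle_swap, rule sum.cong[OF refl])
      fix i assume "i \<in> {..t}"
      hence i: "Suc t - i = Suc (t - i)" by auto
      have "(\<Sum>l\<le>t - i. smul (- of_nat s * (- 1) ^ l * (?a gchoose i))
           (mode x (n + int i) (mode heis (int l + 1) (flow (t - l - i) u))))
        = smul (?a gchoose i) (mode x (n + int i) (\<Sum>l\<le>t - i. smul (- of_nat s * (- 1) ^ l)
           (mode heis (int l + 1) (flow (t - i - l) u))))"
        unfolding Y_sum_right Y_scale_right scale_sum_right scale_scale
        by (intro sum.cong refl) (simp add: mult_ac add.commute)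
      also have "\<dots> = smul (of_nat (Suc t - i) * (?a gchoose i)) (mode x (n + int i) (flow (Suc t - i) u))"
        unfolding flow_recursion[symmetric] i Y_scale_right scale_scale by (simp only: mult_ac)
      finally show "(\<Sum>l\<le>t - i. smul (- of_nat s * (- 1) ^ l * (?a gchoose i))
           (mode x (n + int i) (mode heis (int l + 1) (flow (t - l - i) u))))
        = smul (of_nat (Suc t - i) * (?a gchoose i)) (mode x (n + int i) (flow (Suc t - i) u))" .
    qed
    also have "?B = (\<Sum>i\<le>t. smul (of_nat (Suc i) * (?a gchoose Suc i)) (mode x (n + int (Suc i)) (flow (t - i) u)))"
      unfolding sum_triangle_diagonals
    proof (rule sum.cong[OF refl])
      fix i assume "i \<in> {..t}"
      have "(\<Sum>l\<le>i. smul (?a * ((- 1) ^ l * (?a gchoose (i - l))))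
           (mode x (n + int (Suc (i - l + l))) (flow (t - l - (i - l)) u)))
        = (\<Sum>l\<le>i. smul (?a * ((- 1) ^ l * (?a gchoose (i - l)))) (mode x (n + int (Suc i)) (flow (t - i) u)))"
        by (intro sum.cong refl) auto
      also have "\<dots> = smul (of_nat (Suc i) * (?a gchoose Suc i)) (mode x (n + int (Suc i)) (flow (t - i) u))"
        unfolding gbinomial_log_derivative by (simp only: scale_sum_left[symmetric] sum_distrib_left)
      finally show "(\<Sum>l\<le>i. smul (?a * ((- 1) ^ l * (?a gchoose (i - l))))
           (mode x (n + int (Suc (i - l + l))) (flow (t - l - (i - l)) u)))
        = smul (of_nat (Suc i) * (?a gchoose Suc i)) (mode x (n + int (Suc i)) (flow (t - i) u))" .
    qed
    also have "(\<Sum>i\<le>t. smul (of_nat (Suc t - i) * (?a gchoose i)) (mode x (n + int i) (flow (Suc t - i) u)))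
      + (\<Sum>i\<le>t. smul (of_nat (Suc i) * (?a gchoose Suc i)) (mode x (n + int (Suc i)) (flow (t - i) u)))
      = (\<Sum>i\<le>Suc t. smul (of_nat (Suc t - i) * (?a gchoose i)) (mode x (n + int i) (flow (Suc t - i) u)))
      + (\<Sum>i\<le>Suc t. smul (of_nat i * (?a gchoose i)) (mode x (n + int i) (flow (Suc t - i) u)))"
    proof -
      have "(\<Sum>i\<le>Suc t. smul (of_nat i * (?a gchoose i)) (mode x (n + int i) (flow (Suc t - i) u)))
        = (\<Sum>i\<le>t. smul (of_nat (Suc i) * (?a gchoose Suc i)) (mode x (n + int (Suc i)) (flow (t - i) u)))"
        by (subst sum.atMost_Suc_shift) (simp del: of_nat_Suc)
      thus ?thesis by (simp del: of_nat_Suc)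
    qed
    also have "\<dots> = smul (of_nat (Suc t)) (\<Sum>i\<le>Suc t. smul (?a gchoose i) (mode x (n + int i) (flow (Suc t - i) u)))"
      unfolding sum.distrib[symmetric] scale_sum_right
    proof (rule sum.cong[OF refl])
      fix i assume "i \<in> {..Suc t}"
      hence "(of_nat (Suc t - i) * (?a gchoose i) + of_nat i * (?a gchoose i)) = of_nat (Suc t) * (?a gchoose i)"
        by (simp add: of_nat_diff algebra_simps)
      thus "smul (of_nat (Suc t - i) * (?a gchoose i)) (mode x (n + int i) (flow (Suc t - i) u))
          + smul (of_nat i * (?a gchoose i)) (mode x (n + int i) (flow (Suc t - i) u))
        = smul (of_nat (Suc t)) (smul (?a gchoose i) (mode x (n + int i) (flow (Suc t - i) u)))"
        by (simp only: scale_left_distrib[symmetric] scale_scale)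
    qed
    finally show ?thesis unfolding Suc by (rule flow_eqI)
  qed simp
qed

text \<open>
  The scalar by which conjugation shifts \<open>x(-m)\<close> for neutral \<open>x\<close>: the central term of
  \<open>[h(m), x(-m)]\<close>, which is \<open>m k (h|x)\<close>, times the coefficient \<open>-s (-1)\<^sup>m\<^sup>+\<^sup>1/m\<close> of \<open>h(m)\<close> in the exponent.
\<close>

definition flow_anomaly :: "'n smat \<Rightarrow> nat \<Rightarrow> complex" where
  "flow_anomaly x m = (if m = 0 then 0 else of_nat s * k * osp_form heis x * (- 1) ^ m)"

lemma flow_neutral:
  assumes x: "x \<in> charge_space 0"
  shows "flow j (mode x (- int m) u) = mode x (- int m) (flow j u)
    + (if m \<le> j then smul (flow_anomaly x m) (flow (j - m) u) else 0)"
proof (induction j rule: less_induct)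
  case (less j)
  let ?\<tau> = "flow_anomaly x m"
  show ?case
  proof (cases j)
    case 0
    thus ?thesis by (simp add: flow_anomaly_def)
  next
    case (Suc t)
    have comm: "mode heis (int l + 1) (mode x (- int m) w) = mode x (- int m) (mode heis (int l + 1) w)
      + (if m = Suc l then smul (of_nat m * k * osp_form heis x) w else 0)" for l w
      using mode_commutator[OF heis_charge x, of "int l + 1" "- int m" w] charge_space_osp[OF x]
      by (auto simp: super_sign_def sbracket_heis[OF x])
    let ?C = "\<lambda>l. smul (- of_nat s * (- 1) ^ l)"
    have "smul (of_nat (Suc t)) (flow (Suc t) (mode x (- int m) u))
      = (\<Sum>l\<le>t. ?C l (mode heis (int l + 1) (flow (t - l) (mode x (- int m) u))))"
      by (rule flow_recursion)
    also have "\<dots> = (\<Sum>l\<le>t. ?C l (mode x (- int m) (mode heis (int l + 1) (flow (t - l) u)))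
        + (if m = Suc l then smul (of_nat m * ?\<tau>) (flow (Suc t - m) u) else 0)
        + (if m + l \<le> t then smul ?\<tau> (?C l (mode heis (int l + 1) (flow (t - m - l) u))) else 0))"
    proof (rule sum.cong[OF refl])
      fix l assume l: "l \<in> {..t}"
      have IH: "flow (t - l) (mode x (- int m) u) = mode x (- int m) (flow (t - l) u)
         + (if m \<le> t - l then smul ?\<tau> (flow (t - l - m) u) else 0)"
        using Suc by (intro less.IH) simp
      have 1: "?C l (mode heis (int l + 1) (mode x (- int m) (flow (t - l) u)))
        = ?C l (mode x (- int m) (mode heis (int l + 1) (flow (t - l) u)))
        + (if m = Suc l then smul (of_nat m * ?\<tau>) (flow (Suc t - m) u) else 0)"
        unfolding comm by (auto simp: scale_right_distrib flow_anomaly_def mult_ac simp del: of_nat_Suc)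
      have 2: "?C l (mode heis (int l + 1) (if m \<le> t - l then smul ?\<tau> (flow (t - l - m) u) else 0))
        = (if m + l \<le> t then smul ?\<tau> (?C l (mode heis (int l + 1) (flow (t - m - l) u))) else 0)"
        using l by (auto simp: Y_scale_right mult_ac add.commute)
      show "?C l (mode heis (int l + 1) (flow (t - l) (mode x (- int m) u)))
        = ?C l (mode x (- int m) (mode heis (int l + 1) (flow (t - l) u)))
        + (if m = Suc l then smul (of_nat m * ?\<tau>) (flow (Suc t - m) u) else 0)
        + (if m + l \<le> t then smul ?\<tau> (?C l (mode heis (int l + 1) (flow (t - m - l) u))) else 0)"
        unfolding IH Y_add_right scale_right_distrib 1 2 ..
    qed
    also have "\<dots> = (\<Sum>l\<le>t. ?C l (mode x (- int m) (mode heis (int l + 1) (flow (t - l) u))))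
        + (\<Sum>l\<le>t. if m = Suc l then smul (of_nat m * ?\<tau>) (flow (Suc t - m) u) else 0)
        + (\<Sum>l\<le>t. if m + l \<le> t then smul ?\<tau> (?C l (mode heis (int l + 1) (flow (t - m - l) u))) else 0)"
      by (simp only: sum.distrib)
    also have "(\<Sum>l\<le>t. ?C l (mode x (- int m) (mode heis (int l + 1) (flow (t - l) u))))
       = smul (of_nat (Suc t)) (mode x (- int m) (flow (Suc t) u))"
      by (simp only: Y_scale_right[symmetric] Y_sum_right[symmetric] flow_recursion)
    also have "(\<Sum>l\<le>t. if m = Suc l then smul (of_nat m * ?\<tau>) (flow (Suc t - m) u) else 0)
       = (if m \<le> Suc t then smul (of_nat m * ?\<tau>) (flow (Suc t - m) u) else 0)"
    proof (cases m)
      case (Suc m')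
      have "(\<Sum>l\<le>t. if m = Suc l then smul (of_nat m * ?\<tau>) (flow (Suc t - m) u) else 0)
        = (\<Sum>l\<le>t. if l = m' then smul (of_nat m * ?\<tau>) (flow (Suc t - m) u) else 0)"
        by (intro sum.cong refl) (auto simp: Suc)
      thus ?thesis by (simp add: Suc del: of_nat_Suc)
    qed simp
    also have "(\<Sum>l\<le>t. if m + l \<le> t then smul ?\<tau> (?C l (mode heis (int l + 1) (flow (t - m - l) u))) else 0)
      = (if m \<le> Suc t then smul (of_nat (Suc t - m) * ?\<tau>) (flow (Suc t - m) u) else 0)"
    proof (cases "m \<le> t")
      case True
      have "(\<Sum>l\<le>t. if m + l \<le> t then smul ?\<tau> (?C l (mode heis (int l + 1) (flow (t - m - l) u))) else 0)
        = (\<Sum>l\<le>t - m. smul ?\<tau> (?C l (mode heis (int l + 1) (flow (t - m - l) u))))"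
        using True by (intro sum.mono_neutral_cong_right) auto
      also have "\<dots> = smul ?\<tau> (smul (of_nat (Suc (t - m))) (flow (Suc (t - m)) u))"
        by (simp only: scale_sum_right[symmetric] flow_recursion)
      finally show ?thesis using True by (simp add: Suc_diff_le mult.commute del: of_nat_Suc)
    qed auto
    also have "smul (of_nat (Suc t)) (mode x (- int m) (flow (Suc t) u))
        + (if m \<le> Suc t then smul (of_nat m * ?\<tau>) (flow (Suc t - m) u) else 0)
        + (if m \<le> Suc t then smul (of_nat (Suc t - m) * ?\<tau>) (flow (Suc t - m) u) else 0)
      = smul (of_nat (Suc t)) (mode x (- int m) (flow (Suc t) u)
        + (if m \<le> Suc t then smul ?\<tau> (flow (Suc t - m) u) else 0))"
    proof (cases "m \<le> Suc t")
      case True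
      hence "of_nat m * ?\<tau> + of_nat (Suc t - m) * ?\<tau> = of_nat (Suc t) * ?\<tau>"
        by (simp add: of_nat_diff algebra_simps)
      thus ?thesis using True
        by (simp add: add.assoc scale_left_distrib[symmetric] scale_right_distrib del: of_nat_Suc)
    qed simp
    finally show ?thesis unfolding Suc by (rule flow_eqI)
  qed
qed

text \<open>
  \<open>\<Phi>\<close> is \<open>\<phi>\<close> composed with Li's operator: the same zero mode, taken in the spectrally flowed
  module.
\<close>

definition \<Phi> :: "'v \<Rightarrow> complex" where
  "\<Phi> u = Sum_any (\<lambda>j. \<phi> (flow j u))"

lemma \<Phi>_finite: "finite {j. \<phi> (flow j u) \<noteq> 0}"
  by (rule flow_support_finite) simp

lemma \<Phi>_add: "\<Phi> (u + w) = \<Phi> u + \<Phi> w"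
  unfolding \<Phi>_def by (simp add: flow_add \<phi>_add Sum_any.distrib \<Phi>_finite)

lemma \<Phi>_scale: "\<Phi> (smul c u) = c * \<Phi> u"
  unfolding \<Phi>_def by (simp add: flow_scale \<phi>_scale Sum_any_right_distrib \<Phi>_finite)

lemma \<Phi>_vac: "\<Phi> vac = 1"
proof -
  have "\<Phi> vac = (\<Sum>j\<in>{0}. \<phi> (flow j vac))"
    unfolding \<Phi>_def by (rule Sum_any.expand_superset) (use flow_vac in \<open>auto intro: ccontr\<close>)
  thus ?thesis by (simp add: \<phi>_vac)
qed

lemma \<Phi>_neutral:
  assumes x: "x \<in> charge_space 0"
  shows "\<Phi> (mode x (- int m) u) = Sum_any (\<lambda>j. \<phi> (mode x (- int m) (flow j u))) + flow_anomaly x m * \<Phi> u"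
proof -
  have fin: "finite {j. \<phi> (mode x (- int m) (flow j u)) \<noteq> 0}"
    by (rule flow_support_finite) simp
  let ?h = "\<lambda>j. flow_anomaly x m * \<phi> (flow j u)"
  have fh: "finite {j. ?h j \<noteq> 0}" by (rule finite_subset[OF _ \<Phi>_finite[of u]]) auto
  have "\<Phi> (mode x (- int m) u)
    = Sum_any (\<lambda>j. \<phi> (mode x (- int m) (flow j u)) + (if m \<le> j then ?h (j - m) else 0))"
    unfolding \<Phi>_def flow_neutral[OF x] \<phi>_add by (simp add: \<phi>_scale if_distrib cong: if_cong)
  also have "\<dots> = Sum_any (\<lambda>j. \<phi> (mode x (- int m) (flow j u))) + Sum_any (\<lambda>j. if m \<le> j then ?h (j - m) else 0)"
  proof (rule Sum_any.distrib[OF fin])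
    have "{j. (if m \<le> j then ?h (j - m) else 0) \<noteq> 0} \<subseteq> (\<lambda>j. j + m) ` {j. ?h j \<noteq> 0}"
    proof
      fix j assume "j \<in> {j. (if m \<le> j then ?h (j - m) else 0) \<noteq> 0}"
      thus "j \<in> (\<lambda>j. j + m) ` {j. ?h j \<noteq> 0}" by (intro image_eqI[of _ _ "j - m"]) (auto split: if_splits)
    qed
    thus "finite {j. (if m \<le> j then ?h (j - m) else 0) \<noteq> 0}" by (rule finite_subset) (use fh in simp)
  qed
  also have "Sum_any (\<lambda>j. if m \<le> j then ?h (j - m) else 0) = flow_anomaly x m * \<Phi> u"
    unfolding Sum_any_shift[OF fh] \<Phi>_def by (rule Sum_any_right_distrib[OF \<Phi>_finite, symmetric])
  finally show ?thesis .
qed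

text \<open>
  For charged \<open>x\<close>, conjugation turns the weight \<open>\<zeta>\<^sup>n (1 + \<zeta>)\<close> into \<open>\<zeta>\<^sup>n (1 + \<zeta>)\<^sup>m\<close> with \<open>m = 1 - s q\<close>, which \<open>\<phi>_vanishing\<close>
  covers.  For neutral \<open>x\<close> the weight is unchanged and the two anomalies cancel, because they alternate
  in sign.
\<close>

lemma \<Phi>_vanishing:
  assumes x: "x \<in> charge_space q" and n: "n \<le> - 2"
  shows "\<Phi> (mode x n u) + \<Phi> (mode x (n + 1) u) = 0"
proof (cases "q = 0")
  case True
  hence x0: "x \<in> charge_space 0" using x by simp
  obtain m where m: "n = - int (Suc (Suc m))" using n by (intro that[of "nat (- n - 2)"]) simp
  have m': "n + 1 = - int (Suc m)" using m by simp
  have *: "\<phi> (mode x n w) + \<phi> (mode x (n + 1) w) = 0" for w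
  proof -
    have "Sum_any (\<lambda>i. (1 gchoose i) * \<phi> (mode x (n + int i) w))
      = (\<Sum>i\<in>{0, 1}. (1 gchoose i) * \<phi> (mode x (n + int i) w))"
    proof (rule Sum_any.expand_superset)
      show "{i. (1 gchoose i) * \<phi> (mode x (n + int i) w) \<noteq> 0} \<subseteq> {0, 1}"
      proof
        fix i assume "i \<in> {i. (1 gchoose i) * \<phi> (mode x (n + int i) w) \<noteq> 0}"
        hence "\<not> i > 1" using gbinomial_one[of i] by auto
        thus "i \<in> {0, 1}" by auto
      qed
    qed simp
    thus ?thesis using \<phi>_vanishing[OF x0 n, of w] by simp
  qed
  have fin: "finite {j. \<phi> (mode x n (flow j u)) \<noteq> 0}" for n
    by (rule flow_support_finite) simp
  have "Sum_any (\<lambda>j. \<phi> (mode x n (flow j u))) + Sum_any (\<lambda>j. \<phi> (mode x (n + 1) (flow j u)))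
     = Sum_any (\<lambda>j. \<phi> (mode x n (flow j u)) + \<phi> (mode x (n + 1) (flow j u)))"
    by (rule Sum_any.distrib[OF fin fin, symmetric])
  also have "\<dots> = 0" by (simp add: *)
  finally show ?thesis
    using \<Phi>_neutral[OF x0, of "Suc (Suc m)" u] \<Phi>_neutral[OF x0, of "Suc m" u]
    unfolding m[symmetric] m'[symmetric] by (simp add: flow_anomaly_def)
next
  case False
  let ?a = "of_int (- int s * q) :: complex"
  obtain N0 where N0: "\<And>l. l > N0 \<Longrightarrow> flow l u = 0" using flow_locally_finite by blast
  have "\<forall>l. \<exists>N. \<forall>i>N. mode x (n + int i) (flow l u) = 0" using truncation_nat by blast
  then obtain f where f: "\<And>l i. i > f l \<Longrightarrow> mode x (n + int i) (flow l u) = 0" by metis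
  \<comment> \<open>One bound for both indices, so that all sums become finite over the same square.\<close>
  define N where "N = max N0 (Max (f ` {..N0}))"
  have fN: "f l \<le> N" if "l \<le> N0" for l
  proof -
    have "f l \<le> Max (f ` {..N0})" using that by (intro Max_ge) auto
    thus ?thesis by (simp add: N_def)
  qed
  define g where "g i l = \<phi> (mode x (n + int i) (flow l u))" for i l
  have g: "g i l = 0" if "i > N \<or> l > N" for i l
  proof (cases "l > N0")
    case False
    hence "i > f l" using that fN[of l] by (auto simp: N_def)
    thus ?thesis by (simp add: g_def f)
  qed (simp add: g_def N0)
  have \<Phi>: "\<Phi> (mode x (n + int d) u) = (\<Sum>l\<le>N. \<Sum>i\<le>N. (?a gchoose i) * g (i + d) l)" for d
  proof -
    have "\<Phi> (mode x (n + int d) u) = Sum_any (\<lambda>j. \<Sum>i\<le>j. (?a gchoose i) * g (i + d) (j - i))"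
      unfolding \<Phi>_def flow_charged[OF x False] g_def
    proof -
      have s: "\<phi> (\<Sum>i\<in>I. h i) = (\<Sum>i\<in>I. \<phi> (h i))" for I and h :: "nat \<Rightarrow> 'v"
        by (induction I rule: infinite_finite_induct) (simp_all add: \<phi>_add)
      show "Sum_any (\<lambda>j. \<phi> (\<Sum>i\<le>j. smul (?a gchoose i) (mode x (n + int d + int i) (flow (j - i) u))))
        = Sum_any (\<lambda>j. \<Sum>i\<le>j. (?a gchoose i) * \<phi> (mode x (n + int (i + d)) (flow (j - i) u)))"
        unfolding s \<phi>_scale by (simp add: algebra_simps)
    qed
    also have "\<dots> = (\<Sum>l\<le>N. \<Sum>i\<le>N. (?a gchoose i) * g (i + d) l)"
      by (rule Sum_any_convolution) (use g in auto)
    finally show ?thesis .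
  qed
  have "(\<Sum>i\<le>N. (?a gchoose i) * g (i + 0) l) + (\<Sum>i\<le>N. (?a gchoose i) * g (i + 1) l) = 0" for l
  proof -
    have "0 = Sum_any (\<lambda>i. (of_int (1 - int s * q) gchoose i) * g i l)"
      using \<phi>_vanishing[OF x n, of "flow l u"] by (simp add: g_def)
    also have "of_int (1 - int s * q) = ?a + 1" by simp
    also have "Sum_any (\<lambda>i. ((?a + 1) gchoose i) * g i l) = (\<Sum>i\<le>Suc N. ((?a + 1) gchoose i) * g i l)"
    proof (rule Sum_any.expand_superset)
      show "{i. ((?a + 1) gchoose i) * g i l \<noteq> 0} \<subseteq> {..Suc N}"
      proof
        fix i assume "i \<in> {i. ((?a + 1) gchoose i) * g i l \<noteq> 0}"
        hence "\<not> i > N" using g[of i l] by auto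
        thus "i \<in> {..Suc N}" by simp
      qed
    qed simp
    also have "\<dots> = g 0 l + (\<Sum>i\<le>N. ((?a + 1) gchoose Suc i) * g (Suc i) l)"
      by (subst sum.atMost_Suc_shift) simp
    also have "\<dots> = (g 0 l + (\<Sum>i\<le>N. (?a gchoose Suc i) * g (Suc i) l)) + (\<Sum>i\<le>N. (?a gchoose i) * g (Suc i) l)"
      unfolding gbinomial_Suc_Suc by (simp add: distrib_right sum.distrib)
    also have "g 0 l + (\<Sum>i\<le>N. (?a gchoose Suc i) * g (Suc i) l) = (\<Sum>i\<le>Suc N. (?a gchoose i) * g i l)"
      by (subst sum.atMost_Suc_shift) simp
    also have "\<dots> = (\<Sum>i\<le>N. (?a gchoose i) * g i l)" using g[of "Suc N" l] by simp
    finally show ?thesis by simp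
  qed
  thus ?thesis using \<Phi>[of 0] \<Phi>[of 1] by (simp add: sum.distrib[symmetric])
qed

text \<open>
  Here \<open>m = 1\<close> occurs without the compensating \<open>m = 2\<close>, so the anomaly \<open>-k s (h|h) = 2 k s\<close> stays.
\<close>

lemma \<Phi>_heis: "\<Phi> (mode heis (- 1) u) + \<Phi> (mode heis 0 u) = (of_int q0 + 2 * k * of_nat s) * \<Phi> u"
proof -
  have fin: "finite {j. \<phi> (mode heis n (flow j u)) \<noteq> 0}" for n
    by (rule flow_support_finite) simp
  have "Sum_any (\<lambda>j. \<phi> (mode heis (- 1) (flow j u))) + Sum_any (\<lambda>j. \<phi> (mode heis 0 (flow j u)))
     = Sum_any (\<lambda>j. \<phi> (mode heis (- 1) (flow j u)) + \<phi> (mode heis 0 (flow j u)))"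
    by (rule Sum_any.distrib[OF fin fin, symmetric])
  also have "\<dots> = of_int q0 * \<Phi> u"
    unfolding \<phi>_heis \<Phi>_def by (rule Sum_any_right_distrib[OF \<Phi>_finite, symmetric])
  finally show ?thesis
    using \<Phi>_neutral[OF heis_charge, of 1 u] \<Phi>_neutral[OF heis_charge, of 0 u]
    by (simp add: flow_anomaly_def osp_form_heis algebra_simps)
qed

lemma \<Phi>_heis_power: "\<Phi> ((mode heis (- 1) ^^ j) vac) = (of_int q0 + 2 * k * of_nat s) ^ j"
proof (induction j)
  case (Suc j)
  have "mode heis 0 ((mode heis (- 1) ^^ j) vac) = 0"
  proof -
    have "\<exists>p. monomial p 0 ((mode heis (- 1) ^^ j) vac)"
    proof (induction j)
      case 0
      show ?case using monomial_vac by auto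
    next
      case (Suc j)
      thus ?case using monomial_mode[OF _ heis_charge] by fastforce
    qed
    thus ?thesis using heis_zero_mode_monomial by fastforce
  qed
  thus ?case using \<Phi>_heis[of "(mode heis (- 1) ^^ j) vac"] Suc \<Phi>_scale[of 0 0] by simp
qed (simp add: \<Phi>_vac)

end

section \<open>From C2-cofiniteness to infinitely many roots\<close>

lemma (in vector_space) span_finite_support:
  assumes "finite B" "B \<subseteq> span S"
  obtains T where "finite T" "T \<subseteq> S" "B \<subseteq> span T"
proof -
  have "\<forall>b\<in>B. \<exists>T. finite T \<and> T \<subseteq> S \<and> b \<in> span T"
  proof
    fix b assume "b \<in> B"
    hence "b \<in> span S" using assms(2) by blast
    then obtain T r where T: "finite T" "T \<subseteq> S" "b = (\<Sum>a\<in>T. scale (r a) a)"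
      unfolding span_explicit by blast
    hence "b \<in> span T" by (auto intro: span_sum span_scale span_base)
    with T show "\<exists>T. finite T \<and> T \<subseteq> S \<and> b \<in> span T" by blast
  qed
  then obtain T where T: "\<And>b. b \<in> B \<Longrightarrow> finite (T b) \<and> T b \<subseteq> S \<and> b \<in> span (T b)" by metis
  show thesis
  proof (rule that[of "\<Union>b\<in>B. T b"])
    show "B \<subseteq> span (\<Union>b\<in>B. T b)"
      using T span_mono[of _ "\<Union>b\<in>B. T b"] by blast
  qed (use T assms(1) in auto)
qed

context osp_current_algebra
begin

text \<open>
  Words in negative modes only.  The induction in \<open>creation_monomial_deep\<close> fails for words with
  annihilation modes, and \<open>creation_monomial_stable\<close> shows that they can be avoided.
\<close>

inductive creation_monomial :: "'v \<Rightarrow> bool" where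
  creation_vac: "creation_monomial vac"
| creation_mode: "creation_monomial w \<Longrightarrow> x \<in> charge_space q \<Longrightarrow> n \<le> - 1 \<Longrightarrow> creation_monomial (mode x n w)"

lemma creation_monomial_parity: "creation_monomial w \<Longrightarrow> \<exists>p. w \<in> V p"
proof (induction rule: creation_monomial.induct)
  case creation_vac
  show ?case using vacuum_even by blast
next
  case (creation_mode w x q n)
  thus ?case using Y_parity[OF X_parity] by blast
qed

lemma creation_monomial_stable:
  "creation_monomial w \<Longrightarrow> x \<in> charge_space q \<Longrightarrow> mode x n w \<in> span {w. creation_monomial w}"
proof (induction arbitrary: x q n rule: creation_monomial.induct)
  case (creation_vac x q n)
  show ?case
  proof (cases "n \<le> - 1")
    case True
    thus ?thesis using creation_mode[OF creation_monomial.creation_vac creation_vac] by (intro span_base) simp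
  qed (simp add: creation span_zero)
next
  case (creation_mode w y r l x q n)
  have w: "w \<in> span {w. creation_monomial w}" using creation_mode.hyps by (intro span_base) simp
  have "mode y l u \<in> span {w. creation_monomial w}" if "u \<in> span {w. creation_monomial w}" for u
    by (rule Y_span[OF _ that])
       (use creation_monomial.creation_mode[OF _ creation_mode.hyps(2,3)] in \<open>auto intro: span_base\<close>)
  hence 1: "mode y l (mode x n w) \<in> span {w. creation_monomial w}"
    using creation_mode.IH[OF creation_mode.prems] by blast
  show ?case unfolding mode_commutator[OF creation_mode.prems creation_mode.hyps(2)]
    by (intro span_add span_scale 1 w creation_mode.IH[OF sbracket_charge[OF creation_mode.prems creation_mode.hyps(2)]])
qed

lemma monomial_in_creation_span: "monomial p q w \<Longrightarrow> w \<in> span {w. creation_monomial w}"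
proof (induction rule: monomial.induct)
  case monomial_vac
  show ?case using creation_vac by (intro span_base) simp
next
  case (monomial_mode p q w x r m)
  show ?case by (rule Y_span[OF _ monomial_mode.IH]) (use creation_monomial_stable monomial_mode(2) in blast)
qed

text \<open>An upper bound for \<open>C2\<close> in terms of the currents alone (\<open>C2_subset_deep_modes\<close>).\<close>

definition deep_modes :: "'v set" where
  "deep_modes = span {mode x n w | x q n w. x \<in> charge_space q \<and> n \<le> - 2}"

lemma deep_modesI: "x \<in> charge_space q \<Longrightarrow> n \<le> - 2 \<Longrightarrow> mode x n w \<in> deep_modes"
  unfolding deep_modes_def by (intro span_base) blast

lemma subspace_deep_modes: "subspace deep_modes"
  by (simp add: deep_modes_def subspace_span)

lemma deep_modes_stable:
  assumes x: "x \<in> charge_space q" and w: "w \<in> deep_modes"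
  shows "mode x (- 1) w \<in> deep_modes"
  using w unfolding deep_modes_def
proof (rule Y_span[rotated])
  fix w assume "w \<in> {mode x n w | x q n w. x \<in> charge_space q \<and> n \<le> - 2}"
  then obtain y r n u where w: "w = mode y n u" "y \<in> charge_space r" "n \<le> - 2" by blast
  have "(if - 1 + n = 0 then of_int (- 1) * k * osp_form x y else 0) = 0" using w(3) by simp
  hence "mode x (- 1) w = smul (super_sign (odd q) (odd r)) (mode y n (mode x (- 1) u))
     + mode (sbracket x y) (- 1 + n) u"
    unfolding w(1) mode_commutator[OF x w(2)] by simp
  also have "\<dots> \<in> deep_modes"
    using deep_modesI[OF w(2,3)] deep_modesI[OF sbracket_charge[OF x w(2)], of "- 1 + n"] w(3)
    by (intro subspace_add[OF subspace_deep_modes] subspace_scale[OF subspace_deep_modes]) auto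
  finally show "mode x (- 1) w \<in> span {mode x n w | x q n w. x \<in> charge_space q \<and> n \<le> - 2}"
    unfolding deep_modes_def .
qed

text \<open>
  In the iterate formula for \<open>(x(n)u)\<^sub>r\<close> with \<open>n \<le> -1\<close> and \<open>r \<le> -2\<close>, each term either has an outer mode
  of \<open>x\<close> below \<open>-1\<close> or an outer mode of \<open>u\<close> below \<open>-1\<close>.  The one exception is \<open>x(-1)u\<^sub>r\<close>, where
  \<open>deep_modes_stable\<close> helps.
\<close>

lemma creation_monomial_deep: "creation_monomial u \<Longrightarrow> r \<le> - 2 \<Longrightarrow> Y u r w \<in> deep_modes"
proof (induction arbitrary: r w rule: creation_monomial.induct)
  case creation_vac
  thus ?case using subspace_0[OF subspace_deep_modes] by (simp add: vacuum)
next
  case (creation_mode u x q n)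
  obtain p where p: "u \<in> V p" using creation_monomial_parity[OF creation_mode.hyps(1)] by blast
  have 1: "mode x (n - int i) (Y u (r + int i) w) \<in> deep_modes" for i
  proof (cases "n - int i \<le> - 2")
    case True
    thus ?thesis by (rule deep_modesI[OF creation_mode.hyps(2)])
  next
    case False
    hence "i = 0" "n = - 1" using creation_mode.hyps(3) by auto
    thus ?thesis using deep_modes_stable[OF creation_mode.hyps(2) creation_mode.IH[OF creation_mode.prems]] by simp
  qed
  have 2: "Y u (r + n - int i) (mode x (int i) w) \<in> deep_modes" for i
    using creation_mode.hyps(3) creation_mode.prems by (intro creation_mode.IH) simp
  show ?case unfolding iterate_formula[OF creation_mode.hyps(2) p]
    by (intro Sum_any_in_subspace[OF subspace_deep_modes] subspace_scale[OF subspace_deep_modes]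
        subspace_diff[OF subspace_deep_modes] 1 2)
qed

end

context graded_current_algebra
begin

lemma C2_subset_deep_modes: "C2 \<subseteq> deep_modes"
proof -
  have "Y u (- 2) w \<in> deep_modes" for u w
  proof -
    have "UNIV \<subseteq> span {w. creation_monomial w}"
      unfolding generated[symmetric] using monomial_in_creation_span
      by (intro span_minimal subspace_span) auto
    hence "u \<in> span {w. creation_monomial w}" by blast
    thus ?thesis
    proof (induction rule: span_induct_alt)
      case base
      show ?case using subspace_0[OF subspace_deep_modes] by simp
    next
      case (step c x y)
      thus ?case using creation_monomial_deep[of x "- 2" w]
        by (auto simp: Y_add_left Y_scale_left intro!: subspace_add[OF subspace_deep_modes] subspace_scale[OF subspace_deep_modes])
    qed
  qed
  thus ?thesis unfolding C2_def by (intro span_minimal subspace_deep_modes) auto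
qed

lemma deep_modes_monomial:
  "deep_modes \<subseteq> span {mode x n w | x q n w p t. x \<in> charge_space q \<and> n \<le> - 2 \<and> monomial p t w}"
    (is "_ \<subseteq> span ?G")
proof -
  have "mode x n w \<in> span ?G" if x: "x \<in> charge_space q" "n \<le> - 2" for x q n w
  proof (induction w rule: monomial_induct)
    case (step c p t w y)
    have "mode x n w \<in> span ?G" using x step(1) by (intro span_base) blast
    thus ?case using step(2) by (simp add: Y_add_right Y_scale_right span_add span_scale)
  qed (simp add: span_zero)
  thus ?thesis unfolding deep_modes_def by (intro span_minimal subspace_span) auto
qed

text \<open>
  Zhu's relations \<open>x \<circ> w = (x(-2) + x(-1))w\<close> for the weight one vectors \<open>x\<close>, and their shifts to
  lower modes.
\<close>

definition zhu_relations :: "'v set" where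
  "zhu_relations = {mode x n w + mode x (n + 1) w | x q n w. x \<in> charge_space q \<and> n \<le> - 2}"

text \<open>
  Modulo Zhu's relations, \<open>x(n)w\<close> with \<open>n \<le> -2\<close> equals \<open>-x(n + 1)w\<close>, whose weight is smaller by one.  So
  whatever can be removed modulo \<open>C\<^sub>2\<close> can be traded for vectors of smaller weight, by induction on the
  weight.  The generators have to be homogeneous for this, and the components of the wrong
  weight have to be discarded, which is where \<open>D\<close> is used.
\<close>

lemma C2_cofinite_imp_zhu_finite:
  assumes "C2_cofinite"
  obtains B where "finite B" "span (zhu_relations \<union> B) = UNIV"
proof -
  obtain B0 where B0: "finite B0" "span (C2 \<union> B0) = UNIV" using assms by (auto simp: C2_cofinite_def)
  obtain B where B: "finite B" "B \<subseteq> {w. \<exists>p q. monomial p q w}" "B0 \<subseteq> span B"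
    using span_finite_support[OF B0(1), of "{w. \<exists>p q. monomial p q w}"] generated by auto
  let ?G = "{mode x n w | x q n w p t. x \<in> charge_space q \<and> n \<le> - 2 \<and> monomial p t w}"
  have "C2 \<union> B0 \<subseteq> span (?G \<union> B)"
    using C2_subset_deep_modes deep_modes_monomial B(3) span_mono[of ?G "?G \<union> B"] span_mono[of B "?G \<union> B"]
    by blast
  hence spanG: "span (?G \<union> B) = UNIV"
    using span_minimal[of "C2 \<union> B0" "span (?G \<union> B)", OF _ subspace_span] B0(2) by auto
  have G_monomial: "\<exists>p q. monomial p q g" if "g \<in> ?G \<union> B" for g
    using that B(2) monomial_mode by blast
  have "w \<in> span (zhu_relations \<union> B)" if "monomial p q w" for p q w
    using that
  proof (induction "nat p" arbitrary: p q w rule: less_induct)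
    case less
    let ?G1 = "{g \<in> ?G \<union> B. \<exists>q. monomial p q g}" and ?G2 = "{g \<in> ?G \<union> B. \<not> (\<exists>q. monomial p q g)}"
    have split: "?G \<union> B = ?G1 \<union> ?G2" by blast
    have "w \<in> span (?G \<union> B)" using spanG by simp
    hence "w \<in> span (?G1 \<union> ?G2)" by (rule back_subst[of "\<lambda>A. w \<in> span A", OF _ split])
    then obtain c1 c2 where c: "w = c1 + c2" "c1 \<in> span ?G1" "c2 \<in> span ?G2"
      unfolding span_Un by blast
    have "D c1 = smul (of_int p) c1" using c(2)
    proof (induction rule: span_induct_alt)
      case base
      show ?case using D_scale[of 0 0] by simp
    next
      case (step c x y)
      hence "D x = smul (of_int p) x" using D_monomial by blast
      thus ?case using step(2) by (simp add: D_add D_scale scale_right_distrib mult.commute)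
    qed
    moreover have "D w = smul (of_int p) w" by (rule D_monomial[OF less.prems])
    ultimately have "D c2 = smul (of_int p) c2" by (simp add: c(1) D_add scale_right_distrib)
    moreover have "?G2 \<subseteq> {w. \<exists>\<mu>. \<mu> \<noteq> of_int p \<and> D w = smul \<mu> w}"
    proof
      fix g assume g: "g \<in> ?G2"
      then obtain p' q' where "monomial p' q' g" using G_monomial by blast
      with g have "p' \<noteq> p" "D g = smul (of_int p') g" using D_monomial by auto
      thus "g \<in> {w. \<exists>\<mu>. \<mu> \<noteq> of_int p \<and> D w = smul \<mu> w}" using of_int_eq_iff by blast
    qed
    hence "c2 \<in> span {w. \<exists>\<mu>. \<mu> \<noteq> of_int p \<and> D w = smul \<mu> w}" using c(3) span_mono by blast
    ultimately have "c2 = 0"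
      by (intro eigenvector_not_in_other_eigenspaces[of D c2 "of_int p", OF D_add D_scale])
    hence "w \<in> span ?G1" using c by simp
    moreover have "?G1 \<subseteq> span (zhu_relations \<union> B)"
    proof
      fix g assume g: "g \<in> ?G1"
      show "g \<in> span (zhu_relations \<union> B)"
      proof (cases "g \<in> B \<or> g = 0")
        case True
        thus ?thesis by (auto intro: span_base span_zero)
      next
        case False
        then obtain x t n u p' q' where u: "g = mode x n u" "x \<in> charge_space t" "n \<le> - 2" "monomial p' q' u"
          using g by blast
        have "monomial (p' - n) (q' + t) g" unfolding u(1) by (rule monomial_mode[OF u(4,2)])
        hence "D g = smul (of_int (p' - n)) g" by (rule D_monomial)
        moreover have "D g = smul (of_int p) g" using g D_monomial by blast
        ultimately have "of_int (p' - n) = (of_int p :: complex)" using False by (metis scale_cancel_right)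
        hence p: "p = p' - n" by (metis of_int_eq_iff)
        have "u \<noteq> 0" using False u(1) by auto
        hence "p' \<ge> 0" by (rule monomial_weight_nonneg[OF u(4)])
        hence "nat (p' - (n + 1)) < nat p" using p u(3) by simp
        from less.hyps[OF this monomial_mode[OF u(4,2)]]
        have "mode x (n + 1) u \<in> span (zhu_relations \<union> B)" .
        moreover have "mode x n u + mode x (n + 1) u \<in> span (zhu_relations \<union> B)"
          using u(2,3) unfolding zhu_relations_def by (intro span_base) blast
        ultimately have "(mode x n u + mode x (n + 1) u) - mode x (n + 1) u \<in> span (zhu_relations \<union> B)"
          by (rule_tac span_diff)
        thus ?thesis by (simp add: u(1))
      qed
    qed
    ultimately show ?case using span_minimal[OF _ subspace_span] by blast
  qed
  hence "UNIV \<subseteq> span (zhu_relations \<union> B)"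
    unfolding generated[symmetric] by (intro span_minimal subspace_span) auto
  with B(1) show thesis by (intro that[of B]) auto
qed

text \<open>
  A nonzero monomial of least energy exists because energies of nonzero monomials are bounded below.
\<close>

lemma spectral_flow_functional:
  assumes "s > 0"
  obtains f q where "q \<ge> 0" "\<And>u w. f (u + w) = f u + f w" "\<And>c u. f (smul c u) = c * f u"
    "\<And>u. u \<in> zhu_relations \<Longrightarrow> f u = 0"
    "\<And>j. f ((mode heis (- 1) ^^ j) vac) = (of_int q + 2 * k * of_nat s) ^ j"
proof -
  let ?c = "int (s * card (fermion_letters s :: (('n + 'n) \<times> int) set))"
  let ?P = "\<lambda>d. \<exists>p q w. monomial p q w \<and> w \<noteq> 0 \<and> d = nat (p - int s * q + ?c)"
  have "?P (nat ?c)" using monomial_vac vac_nonzero by (intro exI[of _ 0] exI[of _ vac]) simp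
  hence "?P (LEAST d. ?P d)" by (rule LeastI)
  then obtain p0 q0 v where v: "monomial p0 q0 v" "v \<noteq> 0" "(LEAST d. ?P d) = nat (p0 - int s * q0 + ?c)" by blast
  have min: "p0 - int s * q0 \<le> p - int s * q" if "monomial p q w" "w \<noteq> 0" for p q w
  proof -
    have "(LEAST d. ?P d) \<le> nat (p - int s * q + ?c)" using that by (intro Least_le) blast
    thus ?thesis using v(3) monomial_bound[OF that, of s] monomial_bound[OF v(1,2), of s] by simp
  qed
  obtain \<theta> where \<theta>: "\<And>u w. \<theta> (u + w) = \<theta> u + \<theta> w" "\<And>c u. \<theta> (smul c u) = c * \<theta> u" "\<theta> v = 1"
    "\<And>u. u \<in> {w. \<exists>p' q'. monomial p' q' w \<and> (p', q') \<noteq> (p0, q0)} \<Longrightarrow> \<theta> u = 0"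
    using separating_functional[OF monomial_separated[OF v(1,2)]] by blast
  interpret spectral_flow smul V Y vac k X D s v p0 q0 \<theta>
    by unfold_locales (use v(1) min \<theta> in blast)+
  have "p0 - int s * q0 \<le> 0" using min[OF monomial_vac vac_nonzero] by simp
  moreover have "p0 \<ge> 0" by (rule monomial_weight_nonneg[OF v(1,2)])
  ultimately have "int s * q0 \<ge> 0" by linarith
  hence q0: "q0 \<ge> 0" using assms by (simp add: zero_le_mult_iff)
  have "\<Phi> u = 0" if "u \<in> zhu_relations" for u
    using that \<Phi>_vanishing by (auto simp: zhu_relations_def \<Phi>_add)
  from that[OF q0 \<Phi>_add \<Phi>_scale this \<Phi>_heis_power] show thesis .
qed

theorem not_C2_cofinite:
  assumes k: "k = of_nat K" "K > 0"
  shows "\<not> C2_cofinite"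
proof
  assume "C2_cofinite"
  then obtain B where B: "finite B" "span (zhu_relations \<union> B) = UNIV"
    by (rule C2_cofinite_imp_zhu_finite)
  let ?h = "\<lambda>j. (mode heis (- 1) ^^ j) vac"
  have "\<exists>b\<in>span B. ?h j - b \<in> span zhu_relations" for j
  proof -
    have "?h j \<in> span (zhu_relations \<union> B)" using B(2) by simp
    then obtain o' b where "?h j = o' + b" "o' \<in> span zhu_relations" "b \<in> span B"
      unfolding span_Un by blast
    thus ?thesis by (intro bexI[of _ b]) auto
  qed
  then obtain b where b: "\<And>j. b j \<in> span B" "\<And>j. ?h j - b j \<in> span zhu_relations" by metis
  obtain c where c: "\<exists>j\<le>card B. c j \<noteq> 0" "(\<Sum>j\<le>card B. smul (c j) (b j)) = 0"
    using nontrivial_relation[OF B(1), of b] b(1) by blast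
  define P where "P = (\<Sum>j\<le>card B. monom (c j) j)"
  have "P \<noteq> 0"
  proof
    assume "P = 0"
    hence "coeff P j = 0" for j by simp
    moreover have "coeff P j = c j" if "j \<le> card B" for j
      using that by (simp add: P_def coeff_sum)
    ultimately show False using c(1) by metis
  qed
  hence fin: "finite {x. poly P x = 0}" by (rule poly_roots_finite)
  have "\<exists>\<mu>. poly P \<mu> = 0 \<and> Re \<mu> \<ge> real s" if s: "s > 0" for s :: nat
  proof -
    obtain q f where f: "q \<ge> 0" "\<And>u w. f (u + w) = f u + f w" "\<And>c u. f (smul c u) = c * f u"
      "\<And>u. u \<in> zhu_relations \<Longrightarrow> f u = 0" "\<And>j. f (?h j) = (of_int q + 2 * k * of_nat s) ^ j"
      by (rule spectral_flow_functional[OF s], rule that; assumption)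
    have f0: "f 0 = 0" using f(3)[of 0 0] by simp
    have fs: "f (\<Sum>i\<in>I. g i) = (\<Sum>i\<in>I. f (g i))" for I :: "nat set" and g
      by (induction I rule: infinite_finite_induct) (simp_all add: f0 f(2))
    have fz: "f u = 0" if "u \<in> span zhu_relations" for u
      using that by (induction rule: span_induct_alt) (simp_all add: f0 f)
    have fh: "f (?h j) = f (b j)" for j
      using f(2)[of "?h j - b j" "b j"] fz[OF b(2)[of j]] by simp
    have "poly P (of_int q + 2 * k * of_nat s) = (\<Sum>j\<le>card B. c j * f (?h j))"
      by (simp add: P_def poly_sum poly_monom f(5))
    also have "\<dots> = f (\<Sum>j\<le>card B. smul (c j) (b j))" unfolding fs fh f(3) ..
    also have "\<dots> = 0" unfolding c(2) f0 ..
    finally have "poly P (of_int q + 2 * k * of_nat s) = 0" .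
    moreover have "real s \<le> real_of_int q + 2 * real K * real s"
    proof -
      have "1 * real s \<le> 2 * real K * real s" using k(2) by (intro mult_right_mono) auto
      thus ?thesis using f(1) by simp
    qed
    ultimately show ?thesis using k(1) by (intro exI[of _ "of_int q + 2 * k * of_nat s"]) simp
  qed
  \<comment> \<open>The roots \<open>q + 2 k s\<close> have real part at least \<open>s\<close>, because \<open>q \<ge> 0\<close> and \<open>k > 0\<close>.\<close>
  hence root: "\<exists>\<mu>. poly P \<mu> = 0 \<and> Re \<mu> \<ge> real (Suc s)" for s by blast
  define M where "M = Max (Re ` {x. poly P x = 0})"
  have M: "Re x \<le> M" if "poly P x = 0" for x
    unfolding M_def using fin that by (intro Max_ge) auto
  obtain s :: nat where "real s > M" using reals_Archimedean2 by blast
  with root[of s] M show False by fastforce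
qed

end

section \<open>The weight operator\<close>

context osp_current_algebra
begin

definition quadratic_span :: "'v set" where
  "quadratic_span = span {mode a (- 1) (X b) | a b p q. a \<in> charge_space p \<and> b \<in> charge_space q}"

lemma quadratic_spanI:
  assumes "a \<in> osp" "b \<in> osp"
  shows "mode a (- 1) (X b) \<in> quadratic_span"
  using assms(1)
proof (induction rule: osp_charge_induct)
  case (charge p a)
  note a = charge
  show ?case using assms(2)
  proof (induction rule: osp_charge_induct)
    case (charge q b)
    with a show ?case unfolding quadratic_span_def by (intro span_base) blast
  next
    case (add b b')
    thus ?case by (simp add: X_add Y_add_right quadratic_span_def span_add)
  qed
next
  case (add a a')
  thus ?case by (simp add: X_add Y_add_left quadratic_span_def span_add)
qed

lemma subspace_X_osp: "subspace (X ` osp)"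
  unfolding subspace_def
proof (intro conjI ballI allI)
  show "0 \<in> X ` osp" using smat.subspace_0[OF subspace_osp] by (intro image_eqI[of _ _ 0]) simp_all
  fix u w assume "u \<in> X ` osp" "w \<in> X ` osp"
  then obtain x y where "u = X x" "w = X y" "x \<in> osp" "y \<in> osp" by blast
  thus "u + w \<in> X ` osp" using smat.subspace_add[OF subspace_osp]
    by (intro image_eqI[of _ _ "x + y"]) (simp_all add: X_add)
next
  fix c u assume "u \<in> X ` osp"
  then obtain x where "u = X x" "x \<in> osp" by blast
  thus "smul c u \<in> X ` osp" using smat.subspace_scale[OF subspace_osp]
    by (intro image_eqI[of _ _ "smat_scale c x"]) (simp_all add: X_scale)
qed

lemma ope_shift:
  assumes "x \<in> charge_space p" "y \<in> charge_space q"
  shows "i \<ge> 1 \<Longrightarrow> mode x (1 + int i) (X y) = 0" "mode x (2 + int i) (X y) = 0"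
    "i \<ge> 2 \<Longrightarrow> mode x (int i) (X y) = 0"
  by (rule ope_2[OF assms]; simp)+

lemma nat_cases_012: obtains "i = 0" | "i = 1" | "i \<ge> (2::nat)"
  by linarith

text \<open>
  The iterate formula has at most three nonzero terms here, and each is a multiple of \<open>a\<close>, of \<open>b\<close>, or of
  \<open>[b, [a, x]]\<close>.
\<close>

lemma quadratic_mode_1:
  assumes "\<eta> \<in> quadratic_span" and x: "x \<in> charge_space q"
  shows "Y \<eta> 1 (X x) \<in> X ` osp"
  using assms(1) unfolding quadratic_span_def
proof (induction rule: span_induct_alt)
  case base
  show ?case using subspace_0[OF subspace_X_osp] by simp
next
  case (step c \<eta> \<zeta>)
  then obtain a b p r where \<eta>: "\<eta> = mode a (- 1) (X b)" "a \<in> charge_space p" "b \<in> charge_space r" by blast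
  note a = \<eta>(2) and b = \<eta>(3)
  have ao: "X a \<in> X ` osp" and bo: "X b \<in> X ` osp" using charge_space_osp a b by blast+
  have scaled: "smul c u \<in> X ` osp" if "u \<in> X ` osp" for c u using subspace_scale[OF subspace_X_osp that] .
  have 1: "mode a (- 1 - int i) (mode b (1 + int i) (X x)) \<in> X ` osp" for i
  proof (cases "i = 0")
    case True
    thus ?thesis by (simp add: ope_1[OF b x] Y_scale_right creation scaled[OF ao])
  next
    case False
    thus ?thesis using subspace_0[OF subspace_X_osp] by (simp add: ope_shift[OF b x])
  qed
  have 2: "mode b (1 + - 1 - int i) (mode a (int i) (X x)) \<in> X ` osp" for i
  proof (cases i rule: nat_cases_012)
    case 1
    have "sbracket b (sbracket a x) \<in> osp" using sbracket_osp charge_space_osp a b x by blast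
    thus ?thesis using 1 by (simp add: ope_0[OF a x] ope_0[OF b sbracket_charge[OF a x]])
  next
    case 2
    thus ?thesis by (simp add: ope_1[OF a x] Y_scale_right creation scaled[OF bo])
  next
    case 3
    thus ?thesis using subspace_0[OF subspace_X_osp] by (simp add: ope_shift[OF a x])
  qed
  have "Y \<eta> 1 (X x) \<in> X ` osp"
    unfolding \<eta>(1) iterate_formula[OF a X_parity[OF b]]
    by (intro Sum_any_in_subspace[OF subspace_X_osp] scaled subspace_diff[OF subspace_X_osp] 1 2)
  thus ?case using step(2) by (simp add: Y_add_left Y_scale_left subspace_add[OF subspace_X_osp] scaled)
qed

text \<open>Only \<open>b(1)a(0)x(-1)1\<close> survives, and it is a multiple of the vacuum.\<close>

lemma quadratic_mode_2:
  assumes "\<eta> \<in> quadratic_span" and x: "x \<in> charge_space q"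
  shows "Y \<eta> 2 (X x) \<in> span {vac}"
  using assms(1) unfolding quadratic_span_def
proof (induction rule: span_induct_alt)
  case base
  show ?case by (simp add: span_zero)
next
  case (step c \<eta> \<zeta>)
  then obtain a b p r where \<eta>: "\<eta> = mode a (- 1) (X b)" "a \<in> charge_space p" "b \<in> charge_space r" by blast
  note a = \<eta>(2) and b = \<eta>(3)
  have 1: "mode a (- 1 - int i) (mode b (2 + int i) (X x)) \<in> span {vac}" for i
    by (simp add: ope_shift[OF b x] span_zero)
  have 2: "mode b (2 + - 1 - int i) (mode a (int i) (X x)) \<in> span {vac}" for i
  proof (cases i rule: nat_cases_012)
    case 1
    thus ?thesis
      by (simp add: ope_0[OF a x] ope_1[OF b sbracket_charge[OF a x]] span_scale span_base)
  next
    case 2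
    thus ?thesis by (simp add: ope_1[OF a x] Y_scale_right creation span_zero)
  next
    case 3
    thus ?thesis by (simp add: ope_shift[OF a x] span_zero)
  qed
  have "Y \<eta> 2 (X x) \<in> span {vac}"
    unfolding \<eta>(1) iterate_formula[OF a X_parity[OF b]]
    by (intro Sum_any_in_subspace[OF subspace_span] span_scale span_diff 1 2)
  thus ?case using step(2) by (simp add: Y_add_left Y_scale_left span_add span_scale)
qed

lemma conformal_commutator:
  assumes \<omega>: "\<omega> \<in> V False" and x: "x \<in> charge_space q"
  shows "Y \<omega> (int m) (mode x r w) = mode x r (Y \<omega> (int m) w)
    + (\<Sum>i\<le>m. smul (of_nat (m choose i)) (Y (Y \<omega> (int i) (X x)) (int m + r - int i) w))"
proof -
  let ?L = "\<lambda>i::nat. smul (of_int (int m) gchoose i) (Y (Y \<omega> (0 + int i) (X x)) (int m + r - int i) w)"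
  let ?R = "\<lambda>i::nat. smul ((- 1) ^ i * (of_int 0 gchoose i))
         (Y \<omega> (int m + 0 - int i) (mode x (r + int i) w)
          - smul ((- 1) powi 0 * super_sign False (odd q)) (mode x (r + 0 - int i) (Y \<omega> (int m + int i) w)))"
  have "Sum_any ?L = Sum_any ?R"
    by (rule borcherds_identity[OF \<omega> X_parity[OF x]])
  moreover have "Sum_any ?L = (\<Sum>i\<le>m. ?L i)"
  proof (rule Sum_any.expand_superset)
    show "{i. ?L i \<noteq> 0} \<subseteq> {..m}"
    proof
      fix i assume i: "i \<in> {i. ?L i \<noteq> 0}"
      show "i \<in> {..m}"
      proof (rule ccontr)
        assume "i \<notin> {..m}"
        hence "(of_nat m :: complex) gchoose i = 0"
          by (simp add: binomial_gbinomial[symmetric] binomial_eq_0)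
        thus False using i by simp
      qed
    qed
  qed simp
  moreover have "Sum_any ?R = (\<Sum>i\<in>{0}. ?R i)"
  proof (rule Sum_any.expand_superset)
    show "{i. ?R i \<noteq> 0} \<subseteq> {0}"
    proof
      fix i assume i: "i \<in> {i. ?R i \<noteq> 0}"
      show "i \<in> {0}"
      proof (rule ccontr)
        assume "i \<notin> {0}"
        hence "(of_int 0 :: complex) gchoose i = 0" by (cases i) simp_all
        thus False using i by simp
      qed
    qed
  qed simp
  ultimately show ?thesis by (simp add: super_sign_def binomial_gbinomial algebra_simps)
qed

text \<open>
  Write \<open>\<omega>\<^sub>1 x(-1)1 = z(x)(-1)1\<close> and \<open>\<omega>\<^sub>2 x(-1)1 = c(x)1\<close>.  Since \<open>[\<omega>\<^sub>1, x(r)] = -(r + 1)x(r) + z(x)(r)\<close>,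
  the operator \<open>\<omega>\<^sub>1\<close> has to be corrected by whatever distinguishes \<open>z(x)\<close> from \<open>x\<close>.  Applying
  \<open>\<omega>\<^sub>2\<close> to \<open>x(0)y(-1)1\<close> gives \<open>c([x, y]) = 2 k (z(x) - x|y)\<close>.  The functional \<open>c\<close> vanishes on odd elements, so \<open>c = 2 k (a|\<cdot>)\<close>
  for a neutral \<open>a\<close>.  Invariance and nondegeneracy of the form turn the equation into \<open>z(x) - x = [a, x]\<close>,
  whence \<open>D = \<omega>\<^sub>1 - a(0)\<close> has the required commutators.
\<close>

lemma weight_operator_exists:
  assumes \<omega>: "\<omega> \<in> V False" "\<omega> \<in> quadratic_span"
    and deriv: "\<And>u m w. Y (Y \<omega> 0 u) m w = smul (- of_int m) (Y u (m - 1) w)"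
    and k: "k \<noteq> 0"
  obtains D where "\<And>u w. D (u + w) = D u + D w" "\<And>c u. D (smul c u) = smul c (D u)" "D vac = 0"
    "\<And>x q m w. x \<in> charge_space q \<Longrightarrow> D (mode x m w) = mode x m (D w) - smul (of_int m) (mode x m w)"
proof -
  obtain N and a b :: "nat \<Rightarrow> 'n smat" where dual: "osp_dual_bases N a b" by (rule osp_dual_bases_exist)
  hence ab: "\<And>i. i < N \<Longrightarrow> a i \<in> osp" "\<And>i. i < N \<Longrightarrow> b i \<in> osp" "smat.span (a ` {..<N}) = osp"
    "\<And>i j. i < N \<Longrightarrow> j < N \<Longrightarrow> osp_form (b i) (a j) = (if i = j then 1 else 0)"
    by (auto simp: osp_dual_bases_def)
  have "\<exists>z. z \<in> osp \<and> Y \<omega> 1 (X x) = X z" if "x \<in> charge_space q" for x :: "'n smat" and q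
    using quadratic_mode_1[OF \<omega>(2) that] by blast
  then obtain z where z: "\<And>x q. x \<in> charge_space q \<Longrightarrow> z x \<in> osp \<and> Y \<omega> 1 (X x) = X (z x)" by metis
  have "\<exists>c. Y \<omega> 2 (X x) = smul c vac" if "x \<in> osp" for x using that
  proof (induction rule: osp_charge_induct)
    case (charge q x)
    thus ?case using quadratic_mode_2[OF \<omega>(2)] by (auto simp: span_singleton)
  next
    case (add x y)
    then obtain c d where "Y \<omega> 2 (X x) = smul c vac" "Y \<omega> 2 (X y) = smul d vac" by blast
    thus ?case using add by (intro exI[of _ "c + d"]) (simp add: X_add Y_add_right scale_left_distrib)
  qed
  then obtain c where c: "\<And>x. x \<in> osp \<Longrightarrow> Y \<omega> 2 (X x) = smul (c x) vac" by metis
  have c_add: "c (x + y) = c x + c y" if "x \<in> osp" "y \<in> osp" for x y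
  proof -
    have "smul (c (x + y)) vac = smul (c x + c y) vac"
      using c[OF that(1)] c[OF that(2)] c[OF smat.subspace_add[OF subspace_osp that]]
      by (simp add: X_add that Y_add_right scale_left_distrib)
    thus ?thesis using vac_nonzero by simp
  qed
  have c_scale: "c (smat_scale d x) = d * c x" if "x \<in> osp" for x d
  proof -
    have "smul (c (smat_scale d x)) vac = Y \<omega> 2 (X (smat_scale d x))"
      by (rule c[OF smat.subspace_scale[OF subspace_osp that], symmetric])
    also have "\<dots> = smul (d * c x) vac"
      by (simp add: X_scale that Y_scale_right c)
    finally show ?thesis using vac_nonzero by simp
  qed
  have c_odd: "c x = 0" if x: "x \<in> charge_space q" "q \<noteq> 0" for x q
  proof (cases "odd q")
    case True
    have "Y \<omega> 2 (X x) \<in> V True" using Y_parity[OF \<omega>(1) X_parity[OF x(1)], of 2] True by simp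
    moreover have "Y \<omega> 2 (X x) \<in> V False"
      using subspace_scale[OF subspace_V vacuum_even] by (simp add: c charge_space_osp[OF x(1)])
    ultimately have "Y \<omega> 2 (X x) = 0" using V_direct by blast
    thus ?thesis using c[OF charge_space_osp[OF x(1)]] vac_nonzero by simp
  next
    case False
    hence "\<bar>q\<bar> > 1" using x(2) by presburger
    hence "x = 0" using charge_space_trivial[OF x(1)] by blast
    thus ?thesis using c_scale[OF smat.subspace_0[OF subspace_osp], of 0] by simp
  qed
  define a1 where "a1 = (\<Sum>i<N. smat_scale (c (a i) / (2 * k)) (b i))"
  have a1o: "a1 \<in> osp" unfolding a1_def using ab(2)
    by (intro smat.subspace_sum[OF subspace_osp] smat.subspace_scale[OF subspace_osp]) auto
  have a1: "c u = 2 * k * osp_form a1 u" if "u \<in> osp" for u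
  proof -
    have "u \<in> smat.span (a ` {..<N})" using that ab(3) by simp
    hence "u \<in> osp \<and> c u = 2 * k * osp_form a1 u"
    proof (induction rule: smat.span_induct_alt)
      case base
      show ?case using c_scale[OF smat.subspace_0[OF subspace_osp], of 0] smat.subspace_0[OF subspace_osp] by simp
    next
      case (step d x y)
      then obtain j where j: "j < N" "x = a j" by blast
      have "osp_form a1 x = (\<Sum>i<N. if i = j then c (a i) / (2 * k) else 0)"
        unfolding a1_def osp_form_sum_left osp_form_scale_left j(2) using ab(4) j(1)
        by (intro sum.cong refl) auto
      hence "c x = 2 * k * osp_form a1 x" using j k by simp
      moreover have x: "x \<in> osp" using ab(1) j by simp
      moreover have sx: "smat_scale d x \<in> osp" by (rule smat.subspace_scale[OF subspace_osp x])
      moreover have "smat_scale d x + y \<in> osp"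
        using step(2) by (intro smat.subspace_add[OF subspace_osp] sx) simp
      moreover have "c (smat_scale d x + y) = d * c x + c y"
        using step(2) by (simp add: c_add[OF sx] c_scale[OF x])
      ultimately show ?case using step(2)
        by (simp add: osp_form_add_right osp_form_scale_right distrib_left)
    qed
    thus ?thesis by blast
  qed
  define a0 where "a0 = charge_part 0 a1"
  have a0: "a0 \<in> charge_space 0" unfolding a0_def by (rule charge_part_in[OF a1o])
  have a0_form: "c u = 2 * k * osp_form a0 u" if u: "u \<in> charge_space q" for u q
  proof (cases "q = 0")
    case True
    have "osp_form (charge_part p a1) u = 0" if "p \<noteq> 0" for p
      using osp_form_charge[OF charge_part_in[OF a1o] u] that True by simp
    hence "osp_form a1 u = osp_form a0 u"
      using arg_cong[OF charge_decomposition[OF a1o], of "\<lambda>a. osp_form a u"]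
      by (simp add: osp_form_add_left a0_def)
    thus ?thesis using a1[OF charge_space_osp[OF u]] by simp
  next
    case False
    thus ?thesis using c_odd[OF u] osp_form_charge[OF a0 u] by simp
  qed
  have z_form: "c (sbracket x y) = 2 * k * osp_form (z x - x) y"
    if x: "x \<in> charge_space p" and y: "y \<in> charge_space q" for x y p q
  proof -
    have zy: "mode (z x) 1 (X y) = smul (k * osp_form (z x) y) vac"
    proof -
      have "z x \<in> osp" using z[OF x] by blast
      thus ?thesis
      proof (induction rule: osp_charge_induct)
        case (add u v)
        thus ?case by (simp add: X_add Y_add_left osp_form_add_left distrib_left scale_left_distrib)
      qed (rule ope_1[OF _ y])
    qed
    have "smul (c (sbracket x y)) vac = Y \<omega> 2 (mode x 0 (X y))"
      using c[OF sbracket_osp[OF charge_space_osp[OF x] charge_space_osp[OF y]]] by (simp add: ope_0[OF x y])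
    also have "\<dots> = mode x 0 (Y \<omega> 2 (X y)) + (\<Sum>i\<le>2. smul (of_nat (2 choose i)) (Y (Y \<omega> (int i) (X x)) (2 + 0 - int i) (X y)))"
      using conformal_commutator[OF \<omega>(1) x, of 2 0 "X y"] by simp
    also have "mode x 0 (Y \<omega> 2 (X y)) = 0"
      by (simp add: c charge_space_osp[OF y] Y_scale_right creation)
    also have "(\<Sum>i\<le>2. smul (of_nat (2 choose i)) (Y (Y \<omega> (int i) (X x)) (2 + 0 - int i) (X y)))
      = Y (Y \<omega> 0 (X x)) 2 (X y) + smul 2 (Y (Y \<omega> 1 (X x)) 1 (X y)) + Y (Y \<omega> 2 (X x)) 0 (X y)"
      by (simp add: eval_nat_numeral)
    also have "\<dots> = smul (2 * k * osp_form (z x - x) y) vac"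
    proof -
      have "Y \<omega> 1 (X x) = X (z x)" using z[OF x] by blast
      thus ?thesis
        by (simp add: deriv zy ope_1[OF x y] c charge_space_osp[OF x] Y_scale_left vacuum
            osp_form_diff_left scale_left_diff_distrib algebra_simps)
    qed
    finally show ?thesis using vac_nonzero by simp
  qed
  have z_eq: "z x = x + sbracket a0 x" if x: "x \<in> charge_space p" for x p
  proof -
    have a0x: "sbracket a0 x \<in> osp" using sbracket_osp charge_space_osp a0 x by blast
    have xo: "z x - x \<in> osp" using z[OF x] charge_space_osp[OF x] smat.subspace_diff[OF subspace_osp] by blast
    have "osp_form (z x - x - sbracket a0 x) y = 0" if "y \<in> osp" for y
      using that
    proof (induction rule: osp_charge_induct)
      case (charge q y)
      have "2 * k * osp_form (z x - x) y = 2 * k * osp_form a0 (sbracket x y)"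
        by (rule trans[OF z_form[OF x charge, symmetric] a0_form[OF sbracket_charge[OF x charge]]])
      hence "osp_form (z x - x) y = osp_form a0 (sbracket x y)" using k by simp
      also have "\<dots> = osp_form (sbracket a0 x) y"
        using osp_form_invariant[of a0 x y] charge_space_parity[OF a0] by simp
      finally show ?case by (simp add: osp_form_diff_left)
    next
      case (add y y')
      thus ?case by (simp add: osp_form_add_right)
    qed
    hence "z x - x - sbracket a0 x = 0"
      by (intro osp_form_nondegenerate smat.subspace_diff[OF subspace_osp] xo a0x)
    thus ?thesis by (simp add: algebra_simps)
  qed
  show thesis
  proof (rule that[of "\<lambda>w. Y \<omega> 1 w - mode a0 0 w"])
    fix x q m w assume x: "x \<in> (charge_space q :: 'n smat set)"
    have "Y \<omega> 1 (mode x m w) = mode x m (Y \<omega> 1 w) + (\<Sum>i\<le>1. smul (of_nat (1 choose i)) (Y (Y \<omega> (int i) (X x)) (1 + m - int i) w))"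
      using conformal_commutator[OF \<omega>(1) x, of 1 m w] by simp
    also have "(\<Sum>i\<le>1. smul (of_nat (1 choose i)) (Y (Y \<omega> (int i) (X x)) (1 + m - int i) w))
      = smul (- of_int m) (mode x m w) + mode (sbracket a0 x) m w"
      using z[OF x] sbracket_osp[OF charge_space_osp[OF a0] charge_space_osp[OF x]]
      by (simp add: deriv z_eq[OF x] X_add charge_space_osp[OF x] Y_add_left scale_left_distrib scale_left_diff_distrib)
    finally have 1: "Y \<omega> 1 (mode x m w) = mode x m (Y \<omega> 1 w) + (smul (- of_int m) (mode x m w) + mode (sbracket a0 x) m w)" .
    have 2: "mode a0 0 (mode x m w) = mode x m (mode a0 0 w) + mode (sbracket a0 x) m w"
      using mode_commutator[OF a0 x, of 0 m w] by (simp add: super_sign_def)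
    have "mode x m (Y \<omega> 1 w - mode a0 0 w) = mode x m (Y \<omega> 1 w) - mode x m (mode a0 0 w)"
      using Y_add_right[of "X x" m "Y \<omega> 1 w - mode a0 0 w" "mode a0 0 w"] by (simp add: algebra_simps)
    thus "Y \<omega> 1 (mode x m w) - mode a0 0 (mode x m w)
      = mode x m (Y \<omega> 1 w - mode a0 0 w) - smul (of_int m) (mode x m w)"
      unfolding 1 2 by (simp add: algebra_simps)
  qed (simp_all add: Y_add_right Y_scale_right scale_right_diff_distrib creation)
qed

end

section \<open>The irreducible quotient of the vacuum module\<close>

lemma poly_mapping_sum_single: "f = (\<Sum>w\<in>Poly_Mapping.keys f. Poly_Mapping.single w (Poly_Mapping.lookup f w))"
proof (rule poly_mapping_eqI)
  fix w
  have "(\<Sum>v\<in>Poly_Mapping.keys f. Poly_Mapping.lookup (Poly_Mapping.single v (Poly_Mapping.lookup f v)) w)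
      = (\<Sum>v\<in>Poly_Mapping.keys f. if v = w then Poly_Mapping.lookup f w else 0)"
    by (intro sum.cong refl) (simp add: lookup_single when_def)
  thus "Poly_Mapping.lookup f w
      = Poly_Mapping.lookup (\<Sum>v\<in>Poly_Mapping.keys f. Poly_Mapping.single v (Poly_Mapping.lookup f v)) w"
    by (simp add: lookup_sum in_keys_iff)
qed

lemma tensor_scale_lookup: "Poly_Mapping.lookup (tensor_scale c f) w = c * Poly_Mapping.lookup f w"
  by (simp add: tensor_scale_def Poly_Mapping.map.rep_eq when_def)

lemma tensor_scale_word: "tensor_scale c (word w) = Poly_Mapping.single w c"
  by (rule poly_mapping_eqI) (simp add: tensor_scale_lookup word_def lookup_single when_def)

lemma left_mult_superset:
  assumes "finite A" "Poly_Mapping.keys f \<subseteq> A"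
  shows "left_mult x f = (\<Sum>w\<in>A. Poly_Mapping.single (x # w) (Poly_Mapping.lookup f w))"
  unfolding left_mult_def using assms
  by (intro sum.mono_neutral_left) (auto simp: in_keys_iff)

lemma left_mult_add: "left_mult x (f + g) = left_mult x f + left_mult x g"
proof -
  let ?A = "Poly_Mapping.keys f \<union> Poly_Mapping.keys g"
  have A: "finite ?A" by simp
  show ?thesis
    using left_mult_superset[OF A, of f x] left_mult_superset[OF A, of g x]
      left_mult_superset[OF A, of "f + g" x] Poly_Mapping.keys_add[of f g]
    by (simp add: lookup_add single_add sum.distrib)
qed

lemma left_mult_scale: "left_mult x (tensor_scale c f) = tensor_scale c (left_mult x f)"
proof -
  have "Poly_Mapping.keys (tensor_scale c f) \<subseteq> Poly_Mapping.keys f"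
    by (auto simp: in_keys_iff tensor_scale_lookup)
  hence "left_mult x (tensor_scale c f)
      = (\<Sum>w\<in>Poly_Mapping.keys f. Poly_Mapping.single (x # w) (c * Poly_Mapping.lookup f w))"
    by (subst left_mult_superset[of "Poly_Mapping.keys f"]) (simp_all add: tensor_scale_lookup)
  also have "\<dots> = tensor_scale c (left_mult x f)"
    unfolding left_mult_def
    by (rule poly_mapping_eqI)
       (simp add: tensor_scale_lookup lookup_sum lookup_single sum_distrib_left when_def if_distrib cong: if_cong)
  finally show ?thesis .
qed

lemma left_mult_word: "left_mult x (word w) = word (x # w)"
  by (simp add: left_mult_def word_def)

lemma word_in_tensor_alg: "w \<in> lists aff_osp \<Longrightarrow> word w \<in> tensor_alg"
  by (simp add: word_def tensor_alg_def)

lemma tensor_alg_closed: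
  "f \<in> tensor_alg \<Longrightarrow> g \<in> tensor_alg \<Longrightarrow> f + g \<in> tensor_alg"
  "f \<in> tensor_alg \<Longrightarrow> tensor_scale c f \<in> tensor_alg"
proof -
  show "f + g \<in> tensor_alg" if "f \<in> tensor_alg" "g \<in> tensor_alg"
    using that Poly_Mapping.keys_add[of f g] unfolding tensor_alg_def by blast
  have "Poly_Mapping.keys (tensor_scale c f) \<subseteq> Poly_Mapping.keys f"
    by (auto simp: in_keys_iff tensor_scale_lookup)
  thus "tensor_scale c f \<in> tensor_alg" if "f \<in> tensor_alg" using that unfolding tensor_alg_def by blast
qed

lemma smat_scale_0 [simp]: "smat_scale 0 X = 0" "smat_scale c 0 = 0"
  by (simp_all add: smat_scale_def vec_eq_iff)

lemma map_smat_scale_single: "Poly_Mapping.map (smat_scale c) (Poly_Mapping.single m x) = Poly_Mapping.single m (smat_scale c x)"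
  by (rule poly_mapping_eqI) (simp add: Poly_Mapping.map.rep_eq lookup_single when_def)

lemma map_smat_scale_lookup: "Poly_Mapping.lookup (Poly_Mapping.map (smat_scale c) f) m = smat_scale c (Poly_Mapping.lookup f m)"
  by (simp add: Poly_Mapping.map.rep_eq when_def)

lemma map_smat_scale_zero: "Poly_Mapping.map (smat_scale c) 0 = 0"
  by (rule poly_mapping_eqI) (simp add: map_smat_scale_lookup)

lemma map_smat_scale_1: "Poly_Mapping.map (smat_scale 1) f = f"
  by (rule poly_mapping_eqI) (simp add: map_smat_scale_lookup)

lemma zero_in_osp [simp]: "0 \<in> osp"
  by (rule smat.subspace_0[OF subspace_osp])

lemma smat_part_zero [simp]: "smat_part p 0 = 0"
  by (simp add: smat_part_def vec_eq_iff)

lemma aff_mode_in: "x \<in> osp \<Longrightarrow> aff_mode x m \<in> aff_osp"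
  by (simp add: aff_mode_def aff_osp_def lookup_single when_def)

lemma aff_mode_nonneg: "x \<in> osp \<Longrightarrow> m \<ge> 0 \<Longrightarrow> (Poly_Mapping.single m x, c) \<in> aff_nonneg"
  by (auto simp: aff_nonneg_def aff_osp_def lookup_single when_def)

lemma aff_mode_homogeneous: "x \<in> charge_space q \<Longrightarrow> aff_homogeneous (odd q) (aff_mode x m)"
  using charge_space_parity[of x q]
  by (simp add: aff_homogeneous_def aff_mode_def lookup_single when_def)

lemma aff_bracket_modes: "aff_bracket (aff_mode x m) (aff_mode y l)
    = (Poly_Mapping.single (m + l) (sbracket x y), if m + l = 0 then osp_form x y * of_int m else 0)"
  by (cases "x = 0"; cases "y = 0") (simp_all add: aff_bracket_def aff_mode_def)

lemma aff_bracket_central: "aff_bracket (0, c) y = (0, 0)"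
  by (cases y) (simp add: aff_bracket_def)

text \<open>
  The relations of the vacuum module are imposed on words; the lemmas below restate them as identities of
  operators on the quotient, and verify the assumptions of \<open>osp_current_algebra\<close>.
\<close>

locale osp_vacuum_VOSA =
  fixes k :: complex
    and smul :: "complex \<Rightarrow> 'v::ab_group_add \<Rightarrow> 'v"
    and act :: "'n::finite aff \<Rightarrow> 'v \<Rightarrow> 'v"
    and \<pi> :: "'n tensors \<Rightarrow> 'v"
    and Y :: "'v \<Rightarrow> int \<Rightarrow> 'v \<Rightarrow> 'v"
  assumes quotient: "irreducible_vacuum_quotient k smul act \<pi>"
    and VOSA: "affine_osp_VOSA k smul act \<pi> Y"
begin

lemma \<pi>_linear: "Vector_Spaces.linear tensor_scale smul \<pi>"
  using quotient by (simp add: irreducible_vacuum_quotient_def)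

sublocale tens: vector_space "tensor_scale :: complex \<Rightarrow> 'n tensors \<Rightarrow> _"
  using \<pi>_linear by (simp add: Vector_Spaces.linear_iff)

sublocale vs: vector_space smul
  using \<pi>_linear by (simp add: Vector_Spaces.linear_iff)

lemma \<pi>_add: "\<pi> (f + g) = \<pi> f + \<pi> g" and \<pi>_scale: "\<pi> (tensor_scale c f) = smul c (\<pi> f)"
  using \<pi>_linear by (simp_all add: Vector_Spaces.linear_iff)

lemma \<pi>_diff: "\<pi> (f - g) = \<pi> f - \<pi> g"
  using \<pi>_add[of "f - g" g] by simp

lemma \<pi>_surj: "\<exists>f\<in>tensor_alg. v = \<pi> f"
  using quotient by (force simp: irreducible_vacuum_quotient_def)

lemma \<pi>_relation: "f \<in> vacuum_relations k \<Longrightarrow> \<pi> f = 0"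
  using quotient by (simp add: irreducible_vacuum_quotient_def)

lemma \<pi>_left_mult: "x \<in> aff_osp \<Longrightarrow> f \<in> tensor_alg \<Longrightarrow> \<pi> (left_mult x f) = act x (\<pi> f)"
  using quotient by (simp add: irreducible_vacuum_quotient_def)

lemma \<pi>_word: "x \<in> aff_osp \<Longrightarrow> w \<in> lists aff_osp \<Longrightarrow> \<pi> (word (x # w)) = act x (\<pi> (word w))"
  by (metis left_mult_word \<pi>_left_mult word_in_tensor_alg)

lemma act_add: "x \<in> aff_osp \<Longrightarrow> act x (u + v) = act x u + act x v"
proof -
  assume x: "x \<in> aff_osp"
  obtain f g where fg: "f \<in> tensor_alg" "u = \<pi> f" "g \<in> tensor_alg" "v = \<pi> g" using \<pi>_surj by meson
  have "act x (u + v) = \<pi> (left_mult x (f + g))"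
    using \<pi>_left_mult[OF x tensor_alg_closed(1)[OF fg(1,3)]] by (simp add: fg \<pi>_add)
  thus ?thesis by (simp add: left_mult_add \<pi>_add \<pi>_left_mult[OF x] fg)
qed

lemma act_scale: "x \<in> aff_osp \<Longrightarrow> act x (smul c v) = smul c (act x v)"
proof -
  assume x: "x \<in> aff_osp"
  obtain f where f: "f \<in> tensor_alg" "v = \<pi> f" using \<pi>_surj by blast
  have "act x (smul c v) = \<pi> (left_mult x (tensor_scale c f))"
    using \<pi>_left_mult[OF x tensor_alg_closed(2)[OF f(1)]] by (simp add: f \<pi>_scale)
  thus ?thesis by (simp add: left_mult_scale \<pi>_scale \<pi>_left_mult[OF x] f)
qed

lemma act_zero [simp]: "x \<in> aff_osp \<Longrightarrow> act x 0 = 0"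
  using act_scale[of x 0 0] by simp

lemma word_induct [case_names zero step]:
  assumes "P 0" "\<And>c w v. w \<in> lists aff_osp \<Longrightarrow> P v \<Longrightarrow> P (smul c (\<pi> (word w)) + v)"
  shows "P v"
proof -
  obtain f where f: "f \<in> tensor_alg" "v = \<pi> f" using \<pi>_surj by blast
  have "P (\<pi> (\<Sum>w\<in>A. Poly_Mapping.single w (Poly_Mapping.lookup f w)))"
    if "finite A" "A \<subseteq> lists aff_osp" for A
    using that
  proof (induction A rule: finite_induct)
    case empty
    show ?case using assms(1) \<pi>_scale[of 0 0] by simp
  next
    case (insert w A)
    thus ?case using assms(2)[of w _ "Poly_Mapping.lookup f w"]
      by (simp add: \<pi>_add tensor_scale_word[symmetric] \<pi>_scale)
  qed
  from this[of "Poly_Mapping.keys f"] f poly_mapping_sum_single[of f] show ?thesis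
    by (simp add: tensor_alg_def)
qed

lemma act_linear_left:
  assumes xy: "x \<in> aff_osp" "y \<in> aff_osp" "aff_scale c x + aff_scale d y \<in> aff_osp"
  shows "act (aff_scale c x + aff_scale d y) v = smul c (act x v) + smul d (act y v)"
proof (induction v rule: word_induct)
  case (step e w v)
  have "word ([] @ [aff_scale c x + aff_scale d y] @ w)
         - tensor_scale c (word ([] @ [x] @ w)) - tensor_scale d (word ([] @ [y] @ w)) \<in> vacuum_relations k"
    unfolding vacuum_relations_def using xy(1,2) step(1)
    by (intro tens.span_base UnI1 CollectI exI conjI) (rule refl, auto)
  from \<pi>_relation[OF this]
  have "act (aff_scale c x + aff_scale d y) (\<pi> (word w)) = smul c (act x (\<pi> (word w))) + smul d (act y (\<pi> (word w)))"
    by (simp add: \<pi>_diff \<pi>_add \<pi>_scale \<pi>_word xy step(1) algebra_simps)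
  thus ?case using step(2)
    by (simp add: act_add act_scale xy vs.scale_right_distrib mult.commute algebra_simps)
qed (use xy in simp)

lemma act_super_commutator:
  assumes xy: "x \<in> aff_osp" "y \<in> aff_osp" "aff_homogeneous p x" "aff_homogeneous q y" "aff_bracket x y \<in> aff_osp"
  shows "act x (act y v) = smul (super_sign p q) (act y (act x v)) + act (aff_bracket x y) v"
proof (induction v rule: word_induct)
  case (step e w v)
  have "word ([] @ [x, y] @ w) - tensor_scale (super_sign p q) (word ([] @ [y, x] @ w))
         - word ([] @ [aff_bracket x y] @ w) \<in> vacuum_relations k"
    unfolding vacuum_relations_def using xy step(1)
    by (intro tens.span_base UnI1[OF UnI2] CollectI exI conjI) (rule refl, auto)
  from \<pi>_relation[OF this]
  have "act x (act y (\<pi> (word w))) = smul (super_sign p q) (act y (act x (\<pi> (word w)))) + act (aff_bracket x y) (\<pi> (word w))"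
    using xy step(1) by (simp add: \<pi>_diff \<pi>_add \<pi>_scale \<pi>_word algebra_simps)
  thus ?case using step(2)
    by (simp add: act_add act_scale xy vs.scale_right_distrib mult.commute algebra_simps)
qed (use xy in simp)

abbreviation vac :: 'v where "vac \<equiv> \<pi> (word [])"

lemma act_nonneg_vac: "x \<in> aff_nonneg \<Longrightarrow> act x vac = smul (k * snd x) vac"
proof -
  assume x: "x \<in> aff_nonneg"
  hence xo: "x \<in> aff_osp" by (auto simp: aff_nonneg_def)
  have "word ([] @ [x]) - tensor_scale (k * snd x) (word []) \<in> vacuum_relations k"
    unfolding vacuum_relations_def using x
    by (intro tens.span_base UnI2 CollectI exI conjI) (rule refl, auto)
  from \<pi>_relation[OF this] show ?thesis by (simp add: \<pi>_diff \<pi>_scale \<pi>_word xo)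
qed

definition X :: "'n smat \<Rightarrow> 'v" where
  "X x = act (aff_mode x (- 1)) vac"

lemma Y_X: "x \<in> osp \<Longrightarrow> Y (X x) m v = act (aff_mode x m) v"
  using VOSA by (simp add: affine_osp_VOSA_def X_def)

lemma act_mode_linear:
  assumes "x \<in> osp" "y \<in> osp"
  shows "act (aff_mode (smat_scale c x + smat_scale d y) m) v = smul c (act (aff_mode x m) v) + smul d (act (aff_mode y m) v)"
proof -
  have e: "aff_mode (smat_scale c x + smat_scale d y) m = aff_scale c (aff_mode x m) + aff_scale d (aff_mode y m)"
    by (simp add: aff_mode_def aff_scale_def map_smat_scale_single single_add)
  have "smat_scale c x + smat_scale d y \<in> osp"
    using assms by (intro smat.subspace_add[OF subspace_osp] smat.subspace_scale[OF subspace_osp])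
  hence "aff_mode (smat_scale c x + smat_scale d y) m \<in> aff_osp" by (rule aff_mode_in)
  thus ?thesis unfolding e using assms by (intro act_linear_left aff_mode_in) 
qed

text \<open>
  This gives all operator products at once: \<open>x(n)\<close> annihilates the vacuum, so only the affine bracket
  \<open>[x(n), y(-1)]\<close> is left.
\<close>

lemma act_mode_sbracket_vac:
  assumes x: "x \<in> charge_space p" and y: "y \<in> charge_space q" and n: "n \<ge> 0"
  shows "act (aff_mode x n) (X y) = act (aff_bracket (aff_mode x n) (aff_mode y (- 1))) vac"
proof -
  note xo = charge_space_osp[OF x] and yo = charge_space_osp[OF y]
  have "sbracket x y \<in> osp" by (rule sbracket_osp[OF xo yo])
  hence "aff_bracket (aff_mode x n) (aff_mode y (- 1)) \<in> aff_osp"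
    by (simp add: aff_bracket_modes aff_osp_def lookup_single when_def)
  hence "act (aff_mode x n) (X y) = smul (super_sign (odd p) (odd q)) (act (aff_mode y (- 1)) (act (aff_mode x n) vac))
      + act (aff_bracket (aff_mode x n) (aff_mode y (- 1))) vac"
    unfolding X_def by (intro act_super_commutator aff_mode_in xo yo aff_mode_homogeneous[OF x] aff_mode_homogeneous[OF y])
  moreover have "act (aff_mode x n) vac = 0"
    using act_nonneg_vac[OF aff_mode_nonneg[OF xo n, of 0]] by (simp add: aff_mode_def)
  ultimately show ?thesis using aff_mode_in[OF yo] by simp
qed

lemma VOSA_instance:
  obtains N and a b :: "nat \<Rightarrow> 'n smat" where "osp_dual_bases N a b"
    "vertex_operator_superalgebra smul (parity_subspace smul \<pi>) Y vac (sugawara_vector k smul act vac N a b)"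
proof -
  obtain N and a b :: "nat \<Rightarrow> 'n smat" where "osp_dual_bases N a b" by (rule osp_dual_bases_exist)
  with VOSA show thesis by (intro that[of N a b]) (auto simp: affine_osp_VOSA_def)
qed

text \<open>Otherwise the identity operator, which is a mode of the vacuum, would be zero.\<close>

lemma vac_nonzero: "vac \<noteq> 0"
proof
  assume 0: "vac = 0"
  obtain \<omega> where "vertex_operator_superalgebra smul (parity_subspace smul \<pi>) Y vac \<omega>"
    by (rule VOSA_instance)
  then interpret vertex_operator_superalgebra smul "parity_subspace smul \<pi>" Y vac \<omega> .
  have "v = 0" for v :: 'v
    using vacuum[of "- 1" v] Y_zero_left[of "- 1" v] unfolding 0 by simp
  hence "(UNIV :: 'v set) = {0}" by blast
  thus False using quotient by (simp add: irreducible_vacuum_quotient_def)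
qed

lemma current_algebra: "osp_current_algebra smul (parity_subspace smul \<pi>) Y vac k X"
proof -
  obtain \<omega> where "vertex_operator_superalgebra smul (parity_subspace smul \<pi>) Y vac \<omega>"
    by (rule VOSA_instance)
  then interpret vertex_operator_superalgebra smul "parity_subspace smul \<pi>" Y vac \<omega> .
  show ?thesis
  proof
    fix x y :: "'n smat" assume "x \<in> osp" "y \<in> osp"
    thus "X (x + y) = X x + X y"
      using act_mode_linear[of x y 1 1 "- 1" vac] by (simp add: X_def)
  next
    fix x :: "'n smat" and c assume "x \<in> osp"
    thus "X (smat_scale c x) = smul c (X x)"
      using act_mode_linear[of x x c 0 "- 1" vac] by (simp add: X_def)
  next
    fix x :: "'n smat" and q assume x: "x \<in> charge_space q"
    have "X x = \<pi> (word [aff_mode x (- 1)])"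
      using \<pi>_word[of "aff_mode x (- 1)" "[]"] aff_mode_in[OF charge_space_osp[OF x]] by (simp add: X_def)
    moreover have "\<pi> (word [aff_mode x (- 1)]) \<in> parity_subspace smul \<pi> (odd q)"
      unfolding parity_subspace_def
    proof (rule vs.span_base, rule CollectI, intro exI conjI)
      show "\<pi> (word [aff_mode x (- 1)]) = \<pi> (word [aff_mode x (- 1)])" ..
      show "list_all2 aff_homogeneous [odd q] [aff_mode x (- 1)]" using aff_mode_homogeneous[OF x] by simp
    qed (use aff_mode_in[OF charge_space_osp[OF x]] in auto)
    ultimately show "X x \<in> parity_subspace smul \<pi> (odd q)" by simp
  next
    fix x y :: "'n smat" and p q assume xy: "x \<in> charge_space p" "y \<in> charge_space q"
    note xo = charge_space_osp[OF xy(1)] and yo = charge_space_osp[OF xy(2)]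
    note bo = sbracket_osp[OF xo yo]
    show "Y (X x) 0 (X y) = X (sbracket x y)"
      unfolding Y_X[OF xo] act_mode_sbracket_vac[OF xy order_refl]
      by (simp add: aff_bracket_modes) (simp add: X_def aff_mode_def)
    show "Y (X x) 1 (X y) = smul (k * osp_form x y) vac"
      unfolding Y_X[OF xo] using act_mode_sbracket_vac[OF xy, of 1] act_nonneg_vac[OF aff_mode_nonneg[OF bo]]
      by (simp add: aff_bracket_modes)
    fix n :: int assume n: "n \<ge> 2"
    show "Y (X x) n (X y) = 0"
      unfolding Y_X[OF xo] using act_mode_sbracket_vac[OF xy, of n] act_nonneg_vac[OF aff_mode_nonneg[OF bo]] n
      by (simp add: aff_bracket_modes)
  qed (rule vac_nonzero)
qed

sublocale osp_current_algebra smul "parity_subspace smul \<pi>" Y vac k X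
  by (rule current_algebra)

lemma act_central: "monomial p q w \<Longrightarrow> act (0, c) w = smul (k * c) w"
proof (induction rule: monomial.induct)
  case monomial_vac
  have "(0, c) \<in> (aff_nonneg :: 'n aff set)"
    by (simp add: aff_nonneg_def aff_osp_def)
  thus ?case using act_nonneg_vac by simp
next
  case (monomial_mode p q w x r m)
  have o: "(0, c) \<in> (aff_osp :: 'n aff set)" for c
    by (simp add: aff_osp_def)
  have h: "aff_homogeneous False ((0, c) :: 'n aff)"
    by (simp add: aff_homogeneous_def smat_part_def vec_eq_iff)
  note xo = charge_space_osp[OF monomial_mode(2)]
  have z: "act (0, 0) v = 0" for v
  proof -
    have e: "aff_scale 0 (0, 0) + aff_scale 0 (0, 0) = ((0, 0) :: 'n aff)"
      by (simp add: aff_scale_def map_smat_scale_zero)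
    show ?thesis using act_linear_left[of "(0, 0)" "(0, 0)" 0 0 v] o[of 0] unfolding e by simp
  qed
  have "act (0, c) (act (aff_mode x m) w) = act (aff_mode x m) (act (0, c) w)"
    using act_super_commutator[of "(0, c)" "aff_mode x m" False "odd r" w]
    by (simp add: aff_bracket_central o h z aff_mode_in[OF xo] aff_mode_homogeneous[OF monomial_mode(2)] super_sign_def)
  thus ?case by (simp add: Y_X[OF xo] monomial_mode.IH act_scale aff_mode_in[OF xo])
qed

text \<open>
  An element of the affine algebra is a finite sum of modes and a multiple of \<open>K\<close>, and \<open>K\<close> acts on
  monomials by a scalar.
\<close>

lemma act_monomial:
  assumes w: "monomial p q w" and Z: "(P, c) \<in> aff_osp"
  shows "act (P, c) w \<in> vs.span {w. \<exists>p q. monomial p q w}"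
proof -
  have o: "(0, c) \<in> (aff_osp :: 'n aff set)" for c
    by (simp add: aff_osp_def)
  have P: "Poly_Mapping.lookup P m \<in> osp" for m using Z by (auto simp: aff_osp_def)
  have mode_in: "act (aff_mode x m) w \<in> vs.span {w. \<exists>p q. monomial p q w}" if "x \<in> osp" for x m
    using that
  proof (induction rule: osp_charge_induct)
    case (charge r x)
    have "monomial (p - m) (q + r) (act (aff_mode x m) w)"
      using monomial_mode[OF w charge, of m] Y_X[OF charge_space_osp[OF charge]] by simp
    thus ?case by (intro vs.span_base) blast
  next
    case (add x y)
    thus ?case using act_mode_linear[of x y 1 1 m w] by (simp add: vs.span_add)
  qed
  have S: "(\<Sum>m\<in>A. Poly_Mapping.single m (Poly_Mapping.lookup P m), c) \<in> aff_osp \<and>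
      act (\<Sum>m\<in>A. Poly_Mapping.single m (Poly_Mapping.lookup P m), c) w \<in> vs.span {w. \<exists>p q. monomial p q w}"
    if "finite A" for A
    using that
  proof (induction A rule: finite_induct)
    case empty
    show ?case using o act_central[OF w, of c] w by (auto intro: vs.span_scale vs.span_base)
  next
    case (insert m A)
    let ?Q = "\<Sum>m\<in>A. Poly_Mapping.single m (Poly_Mapping.lookup P m)"
    have e: "(Poly_Mapping.single m (Poly_Mapping.lookup P m) + ?Q, c)
        = aff_scale 1 (aff_mode (Poly_Mapping.lookup P m) m) + aff_scale 1 (?Q, c)"
      by (simp add: aff_mode_def aff_scale_def map_smat_scale_1)
    have i: "(Poly_Mapping.single m (Poly_Mapping.lookup P m) + ?Q, c) \<in> aff_osp"
      using insert.IH P[of m] smat.subspace_add[OF subspace_osp]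
      by (auto simp: aff_osp_def lookup_add lookup_single when_def)
    have "act (Poly_Mapping.single m (Poly_Mapping.lookup P m) + ?Q, c) w
        = smul 1 (act (aff_mode (Poly_Mapping.lookup P m) m) w) + smul 1 (act (?Q, c) w)"
      unfolding e using i insert.IH unfolding e by (intro act_linear_left aff_mode_in P) auto
    hence "act (Poly_Mapping.single m (Poly_Mapping.lookup P m) + ?Q, c) w \<in> vs.span {w. \<exists>p q. monomial p q w}"
      using mode_in[OF P] insert.IH by (simp add: vs.span_add)
    with i show ?case using insert.hyps by simp
  qed
  show ?thesis using S[of "Poly_Mapping.keys P"] poly_mapping_sum_single[of P] by simp
qed

text \<open>The span of the monomials is a nonzero submodule of an irreducible module.\<close>

lemma monomials_span: "vs.span {w. \<exists>p q. monomial p q w} = UNIV"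
proof -
  let ?S = "vs.span {w. \<exists>p q. monomial p q w}"
  have "act Z w \<in> ?S" if Z: "Z \<in> aff_osp" and "w \<in> ?S" for Z w
    using that(2)
  proof (induction rule: vs.span_induct_alt)
    case (step c x y)
    have "act Z x \<in> ?S" using step(1) Z act_monomial by (cases Z) blast
    thus ?case using step(2) Z by (simp add: act_add act_scale vs.span_add vs.span_scale)
  qed (use Z in \<open>simp add: vs.span_zero\<close>)
  hence "?S = {0} \<or> ?S = UNIV"
    using quotient vs.subspace_span unfolding irreducible_vacuum_quotient_def by blast
  moreover have "vac \<in> ?S" using monomial_vac by (intro vs.span_base) blast
  ultimately show ?thesis using vac_nonzero by blast
qed

theorem not_C2_cofinite_level:
  assumes "k = of_nat K" "K > 0"
  shows "\<not> C2_cofinite"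
proof -
  obtain N and a b :: "nat \<Rightarrow> 'n smat" where dual: "osp_dual_bases N a b" and
    V: "vertex_operator_superalgebra smul (parity_subspace smul \<pi>) Y vac (sugawara_vector k smul act vac N a b)"
    by (rule VOSA_instance)
  let ?\<omega> = "sugawara_vector k smul act vac N a b"
  interpret W: vertex_operator_superalgebra smul "parity_subspace smul \<pi>" Y vac ?\<omega> by (rule V)
  have \<omega>: "?\<omega> \<in> quadratic_span"
  proof -
    have "act (aff_mode (a i) (- 1)) (act (aff_mode (b i) (- 1)) vac) \<in> quadratic_span" if "i < N" for i
      using quadratic_spanI[of "a i" "b i"] dual that Y_X[of "a i" "- 1"]
      by (simp add: osp_dual_bases_def X_def)
    thus ?thesis unfolding sugawara_vector_def quadratic_span_def by (intro vs.span_scale vs.span_sum) auto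
  qed
  have "k \<noteq> 0" using assms by simp
  from weight_operator_exists[OF W.conformal_even \<omega> W.L_minus_1_derivative this]
  obtain D where D: "\<And>u w. D (u + w) = D u + D w" "\<And>c u. D (smul c u) = smul c (D u)" "D vac = 0"
    "\<And>x q m w. x \<in> charge_space q \<Longrightarrow> D (mode x m w) = mode x m (D w) - smul (of_int m) (mode x m w)"
    by blast
  interpret graded_current_algebra smul "parity_subspace smul \<pi>" Y vac k X D
    by unfold_locales (fact D monomials_span)+
  show ?thesis by (rule not_C2_cofinite[OF assms])
qed

end

theorem theorem4p8:
  fixes k :: nat
    and smul :: "complex \<Rightarrow> 'v::ab_group_add \<Rightarrow> 'v"
    and act :: "'n::finite aff \<Rightarrow> 'v \<Rightarrow> 'v"
    and \<pi> :: "'n tensors \<Rightarrow> 'v"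
    and Y :: "'v \<Rightarrow> int \<Rightarrow> 'v \<Rightarrow> 'v"
  assumes "k > 0"
    and "irreducible_vacuum_quotient (of_nat k) smul act \<pi>"
    and "affine_osp_VOSA (of_nat k) smul act \<pi> Y"
  shows "\<not> vertex_superalgebra.C2_cofinite smul Y"
proof -
  interpret osp_vacuum_VOSA "of_nat k" smul act \<pi> Y
    using assms(2,3) by unfold_locales
  show ?thesis by (rule not_C2_cofinite_level[OF refl assms(1)])
qed

end
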